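(* Let $p(x,\theta)=e^{\theta\cdot T(x)-\psi(\theta)}$ be a minimal $n$-dimensional exponential family, let $q(y,\theta)$ be the corresponding incomplete data density at the observed datum $y$, and let $M\subset\overline\Theta$ be a closed constraint set (see context). Suppose that $-\log q(y,\cdot)$ and $M$ are definable. Let $\theta^{(k)}\in M$ be a bounded sequence generated by the constrained EM algorithm $$\theta^{(k+1)}\in\mathop{\mathrm{argmin}}_{\theta\in M}\,-\mathbb E_{\theta^{(k)}}\big(\log p(x,\theta)\,\big|\,y\big),$$ which together with its accumulation points stays in $G=\mathrm{int}(\Theta)$. Then the sequence of accurate parameters $\theta'^{(k)}=P\theta^{(k)}$ converges, $\theta'^{(k)}\to\theta'^*$. Every accumulation point $\theta^*$ of the sequence $\theta^{(k)}$ solves the constrained incomplete data maximum likelihood problem $\min_{\theta\in M}-\log q(y,\theta)$, has the same projection $P\theta^*=\theta'^*$, and the conditional distributions $\mathbb P^{x|y}_{\theta^{(k)}}$ converge weakly to $\mathbb P^{x|y}_{\theta^*}$, the limit being the same for all $\theta^*$. Moreover, the sequence $T'(x_k)$ is also convergent, where $T'=P\circ T$ and $T'(x_{k+1}):=\mathbb E_{\theta^{(k)}}[T'(x)\,|\,y]$.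
   Context: $X$ is the complete data space (a topological space with its Borel $\sigma$-algebra, so that weak convergence makes sense) with $\sigma$-finite measure $\mu$; $h:X\to Y$ is measurable, $\nu=\mu\circ h^{-1}$, and $(\mu_y)_{y\in Y}$ is a disintegration of $\mu$ with respect to $\nu$: each $\mu_y$ is concentrated on $h^{-1}(y)$ and $\int_X f\,d\mu=\int_Y\int_{h^{-1}(y)}f\,d\mu_y\,d\nu(y)$ for $\mu$-integrable $f$. Exponential family: $T:X\to\mathbb R^n$ is the sufficient statistic, $\psi(\theta)=\log\int_Xe^{\theta\cdot T(x)}d\mu(x)$, $\Theta=\{\theta\in\mathbb R^n:\int_X e^{\theta\cdot T}d\mu<\infty\}$ is assumed of full dimension $n$, $G=\mathrm{int}(\Theta)$, $p(x,\theta)=e^{\theta\cdot T(x)-\psi(\theta)}$. The family is minimal if there is no $a\ne0$ with $a\cdot T(x)$ constant for $\mu$-a.a. $x$. Fix an observed $y\in Y$. $q(y,\theta)=\int_{h^{-1}(y)}p(x,\theta)d\mu_y(x)$; $k(x|y,\theta)=p(x,\theta)/q(y,\theta)=e^{\theta\cdot T(x)-\psi_y(\theta)}$ for $x\in h^{-1}(y)$, with $\psi_y(\theta)=\log\int_{h^{-1}(y)}e^{\theta\cdot T}d\mu_y$; $d\mathbb P^{x|y}_\theta=k(\cdot|y,\theta)d\mu_y$, and $\mathbb E_\theta(\cdot|y)$ is expectation under $\mathbb P^{x|y}_\theta$. Accurate parameter: let $V$ be a linear subspace of $\mathbb R^n$ of minimal dimension such that $T(h^{-1}(y))\subset t_0+V$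 for some $t_0$, where one may take $t_0\in V^\perp$, and let $P$ be the orthogonal projection onto $V$. The accurate parameter is $\theta'=P\theta$ (the measure $\mathbb P^{x|y}_\theta$ depends only on $\theta'$). Definable means definable in an o-minimal structure (e.g. $\mathbb R_{an}$ or $\mathbb R_{an,\exp}$).
   Formalization: "Solves the constrained maximum likelihood problem" is taken as the first-order necessary condition (minus the gradient of -log q lies in the regular normal cone of M), as EM can stay at a local maximum of -log q; V is the minimal subspace with T in t_0+V only for mu_y-almost all x of the fibre. *)

theory Defs
  imports "HOL-Analysis.Analysis"
begin

section \<open>O-minimal structures over the real field\<close>

text \<open>Points of real m-space are lists of length m; this allows the dimension to vary.\<close>

inductive_set poly_funs :: "nat \<Rightarrow> (real list \<Rightarrow> real) set" for m :: nat where
  const: "(\<lambda>xs. c) \<in> poly_funs m"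
| coord: "i < m \<Longrightarrow> (\<lambda>xs. xs ! i) \<in> poly_funs m"
| add: "f \<in> poly_funs m \<Longrightarrow> g \<in> poly_funs m \<Longrightarrow> (\<lambda>xs. f xs + g xs) \<in> poly_funs m"
| mult: "f \<in> poly_funs m \<Longrightarrow> g \<in> poly_funs m \<Longrightarrow> (\<lambda>xs. f xs * g xs) \<in> poly_funs m"

text \<open>\<open>S m\<close> is the collection of definable subsets of real m-space. Intervals may be open, closed,
  half-open, unbounded, or single points.\<close>

definition o_minimal :: "(nat \<Rightarrow> real list set set) \<Rightarrow> bool" where
  "o_minimal S \<longleftrightarrow>
     (\<forall>m. \<forall>A\<in>S m. A \<subseteq> {xs. length xs = m}) \<and>
     (\<forall>m. {} \<in> S m) \<and>
     (\<forall>m. \<forall>A\<in>S m. \<forall>B\<in>S m. A \<union> B \<in> S m) \<and>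
     (\<forall>m. \<forall>A\<in>S m. {xs. length xs = m} - A \<in> S m) \<and>
     (\<forall>m. \<forall>A\<in>S m. {x # xs | x xs. xs \<in> A} \<in> S (Suc m)) \<and>
     (\<forall>m. \<forall>A\<in>S m. {xs @ [x] | x xs. xs \<in> A} \<in> S (Suc m)) \<and>
     (\<forall>m. \<forall>A\<in>S (Suc m). butlast ` A \<in> S m) \<and>
     (\<forall>m. \<forall>f\<in>poly_funs m. {xs. length xs = m \<and> f xs = 0} \<in> S m) \<and>
     (\<forall>A. A \<in> S 1 \<longleftrightarrow> (\<exists>F :: real set set. finite F \<and> (\<forall>I\<in>F. is_interval I) \<and>
                             A = (\<lambda>x. [x]) ` \<Union>F))"

text \<open>The list of coordinates of a vector, in some fixed order. Definability does not depend on the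
  order, because definable sets are closed under permutation of coordinates.\<close>

definition coords :: "real ^ 'n::finite \<Rightarrow> real list" where
  "coords x = map (\<lambda>j. x $ from_nat_into UNIV j) [0..<CARD('n)]"

definition definable_set :: "(nat \<Rightarrow> real list set set) \<Rightarrow> (real ^ 'n::finite) set \<Rightarrow> bool" where
  "definable_set S A \<longleftrightarrow> coords ` A \<in> S CARD('n)"

definition definable_fun_on ::
  "(nat \<Rightarrow> real list set set) \<Rightarrow> (real ^ 'n::finite) set \<Rightarrow> (real ^ 'n \<Rightarrow> real) \<Rightarrow> bool" where
  "definable_fun_on S D f \<longleftrightarrow> (\<lambda>x. coords x @ [f x]) ` D \<in> S (Suc CARD('n))"


section \<open>Exponential families\<close>

definition natural_params :: "'x measure \<Rightarrow> ('x \<Rightarrow> real ^ 'n::finite) \<Rightarrow> (real ^ 'n) set" where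
  "natural_params \<mu> T = {\<theta>. integrable \<mu> (\<lambda>x. exp (\<theta> \<bullet> T x))}"

definition log_partition :: "'x measure \<Rightarrow> ('x \<Rightarrow> real ^ 'n::finite) \<Rightarrow> real ^ 'n \<Rightarrow> real" where
  "log_partition \<mu> T \<theta> = ln (\<integral>x. exp (\<theta> \<bullet> T x) \<partial>\<mu>)"

definition ef_density :: "'x measure \<Rightarrow> ('x \<Rightarrow> real ^ 'n::finite) \<Rightarrow> real ^ 'n \<Rightarrow> 'x \<Rightarrow> real" where
  "ef_density \<mu> T \<theta> x = exp (\<theta> \<bullet> T x - log_partition \<mu> T \<theta>)"

definition minimal_family :: "'x measure \<Rightarrow> ('x \<Rightarrow> real ^ 'n::finite) \<Rightarrow> bool" where
  "minimal_family \<mu> T \<longleftrightarrow> \<not> (\<exists>a c. a \<noteq> 0 \<and> (AE x in \<mu>. a \<bullet> T x = c))"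


section \<open>Incomplete data\<close>

text \<open>The fibre measures \<open>\<kappa> y\<close> are measures on the whole space that are concentrated on the fibre of
  \<open>h\<close> over \<open>y\<close>. Integrals over the fibre are therefore written as integrals over the whole space, and
  the fibre itself need not be measurable.\<close>

definition disintegration ::
  "'x measure \<Rightarrow> 'y measure \<Rightarrow> ('x \<Rightarrow> 'y) \<Rightarrow> ('y \<Rightarrow> 'x measure) \<Rightarrow> bool" where
  "disintegration \<mu> N h \<kappa> \<longleftrightarrow>
     h \<in> measurable \<mu> N \<and>
     (\<forall>y\<in>space N. sets (\<kappa> y) = sets \<mu> \<and> (AE x in \<kappa> y. h x = y)) \<and>
     (\<forall>f :: 'x \<Rightarrow> real. integrable \<mu> f \<longrightarrow>
        (AE y in distr \<mu> N h. integrable (\<kappa> y) f) \<and>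
        integrable (distr \<mu> N h) (\<lambda>y. \<integral>x. f x \<partial>\<kappa> y) \<and>
        (\<integral>x. f x \<partial>\<mu>) = (\<integral>y. (\<integral>x. f x \<partial>\<kappa> y) \<partial>distr \<mu> N h))"

text \<open>In the following three definitions \<open>\<mu>\<^sub>y\<close> is the fibre measure at the observed datum.\<close>

definition incomplete_density ::
  "'x measure \<Rightarrow> ('x \<Rightarrow> real ^ 'n::finite) \<Rightarrow> 'x measure \<Rightarrow> real ^ 'n \<Rightarrow> real" where
  "incomplete_density \<mu> T \<mu>\<^sub>y \<theta> = (\<integral>x. ef_density \<mu> T \<theta> x \<partial>\<mu>\<^sub>y)"

definition cond_distr ::
  "'x measure \<Rightarrow> ('x \<Rightarrow> real ^ 'n::finite) \<Rightarrow> 'x measure \<Rightarrow> real ^ 'n \<Rightarrow> 'x measure" where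
  "cond_distr \<mu> T \<mu>\<^sub>y \<theta> =
     density \<mu>\<^sub>y (\<lambda>x. ennreal (ef_density \<mu> T \<theta> x / incomplete_density \<mu> T \<mu>\<^sub>y \<theta>))"

text \<open>\<open>V\<close> is the direction space of the smallest affine subspace containing the values of \<open>T\<close> on the
  fibre. As in the definition of minimality, values taken on a null set only are disregarded:
  the measure \<open>\<mu>\<^sub>y\<close>, hence also the EM iteration, does not see them.\<close>

definition accurate_space ::
  "('x \<Rightarrow> real ^ 'n::finite) \<Rightarrow> 'x measure \<Rightarrow> (real ^ 'n) set \<Rightarrow> bool" where
  "accurate_space T \<mu>\<^sub>y V \<longleftrightarrow>
     subspace V \<and> (\<exists>t\<^sub>0. AE x in \<mu>\<^sub>y. T x - t\<^sub>0 \<in> V) \<and>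
     (\<forall>W. subspace W \<and> (\<exists>t\<^sub>0. AE x in \<mu>\<^sub>y. T x - t\<^sub>0 \<in> W) \<longrightarrow> dim V \<le> dim W)"

definition orth_proj :: "'a::euclidean_space set \<Rightarrow> 'a \<Rightarrow> 'a" where
  "orth_proj V x = (THE p. p \<in> V \<and> (\<forall>v\<in>V. orthogonal (x - p) v))"


section \<open>Weak convergence, accumulation points, constrained criticality\<close>

definition weakly_converges ::
  "(nat \<Rightarrow> 'x::topological_space measure) \<Rightarrow> 'x measure \<Rightarrow> bool" where
  "weakly_converges P Q \<longleftrightarrow>
     (\<forall>f :: 'x \<Rightarrow> real. continuous_on UNIV f \<and> bounded (range f) \<longrightarrow>
        (\<lambda>k. \<integral>x. f x \<partial>P k) \<longlonglongrightarrow> (\<integral>x. f x \<partial>Q))"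

definition accumulation_point :: "(nat \<Rightarrow> 'a::topological_space) \<Rightarrow> 'a \<Rightarrow> bool" where
  "accumulation_point s a \<longleftrightarrow> (\<exists>r. strict_mono (r :: nat \<Rightarrow> nat) \<and> (s \<circ> r) \<longlonglongrightarrow> a)"

text \<open>The regular (Frechet) normal cone. It is contained in the limiting normal cone, and for convex
  sets it is the normal cone of convex analysis.\<close>

definition normal_cone :: "'a::real_inner set \<Rightarrow> 'a \<Rightarrow> 'a set" where
  "normal_cone M a =
     {v. \<forall>\<epsilon>>0. \<forall>\<^sub>F z in at a within M. v \<bullet> (z - a) \<le> \<epsilon> * norm (z - a)}"

text \<open>The first-order necessary condition for a minimum of a smooth function over \<open>M\<close>. This is the
  sense in which an EM limit solves the (generally nonconvex) likelihood problem: an EM sequence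
  started at a symmetric local minimum of the likelihood can be constant, so neither global nor local
  optimality holds in general.\<close>

definition critical_on :: "'a::real_inner set \<Rightarrow> ('a \<Rightarrow> real) \<Rightarrow> 'a \<Rightarrow> bool" where
  "critical_on M f a \<longleftrightarrow> a \<in> M \<and> (\<exists>g. (GDERIV f a :> g) \<and> - g \<in> normal_cone M a)"

end

theory Submission
  imports Defs
begin

text \<open>An EM step minimizes \<open>f + D(\<cdot>, \<theta> k)\<close> over \<open>M\<close>, where \<open>f = - log q\<close> and \<open>D\<close> is the Bregman divergence of
  the conditional log-partition function. On compact sets \<open>D\<close> is comparable to the squared distance of the
  accurate parameters, so a step decreases \<open>f\<close> by at least a multiple of the squared step length
  \<open>d k = norm (P (\<theta> (k + 1)) - P (\<theta> k))\<close>, and the slope of \<open>f\<close> relative to \<open>M\<close> at \<open>\<theta> (k + 1)\<close> is at most a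
  multiple of \<open>d k\<close>. A Kurdyka-Lojasiewicz inequality then makes the step lengths summable.

  The inequality is obtained without derivatives or stratifications. O-minimality provides a definable
  curve that passes through a point of least slope on every level of \<open>f\<close> near the limit value. Its
  coordinates are monotone, hence it has finite length, and this length is the desingularizing function.\<close>

section \<open>Definable predicates\<close>

text \<open>The conditional log-partition function is strictly convex only along \<open>V\<close>,
  so the iteration controls \<open>P (\<theta> k)\<close> but not \<open>\<theta> k\<close>, which
  may drift orthogonally to \<open>V\<close>. The descent and the linear term of the slope estimate
  survive this, because both are covariances under the fibre measure and these see only projected
  increments. \<open>M\<close> is any closed definable set, without convexity or manifold structure.
  Slopes are therefore comparisons of values on \<open>M\<close>, and their quadratic error comes
  from the curvature of the conditional log-partition function. Along the selected curve that error
  disappears under subdivision. The curve may jump: a jump adds to the variation on the right of the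
  inequality, while the curve is parametrized by the value of \<open>f\<close>, which does not jump.
  Only levels above the limit value occur, because \<open>f\<close> decreases along the iteration.
  The closure of the orbit is compact but not known to be definable. A finite union of boxes around
  it is both, and the constants of the estimates are taken on its convex hull.\<close>

definition definable_pred :: "(nat \<Rightarrow> real list set set) \<Rightarrow> nat \<Rightarrow> (real list \<Rightarrow> bool) \<Rightarrow> bool" where
  "definable_pred S m \<phi> \<longleftrightarrow> {xs. length xs = m \<and> \<phi> xs} \<in> S m"

lemma definable_pred_cong:
  assumes "\<And>xs. length xs = m \<Longrightarrow> \<phi> xs \<longleftrightarrow> \<psi> xs"
  shows "definable_pred S m \<phi> \<longleftrightarrow> definable_pred S m \<psi>"
proof -
  have "{xs. length xs = m \<and> \<phi> xs} = {xs. length xs = m \<and> \<psi> xs}"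
    using assms by auto
  then show ?thesis by (simp add: definable_pred_def)
qed

lemma poly_funs_sum:
  assumes "finite I" "\<And>i. i \<in> I \<Longrightarrow> p i \<in> poly_funs m"
  shows "(\<lambda>xs. \<Sum>i\<in>I. p i xs) \<in> poly_funs m"
  using assms
proof (induction I)
  case empty
  then show ?case using poly_funs.const[of 0 m] by simp
next
  case (insert i I)
  then show ?case using poly_funs.add[of "p i" m "\<lambda>xs. \<Sum>i\<in>I. p i xs"] by simp
qed

lemma poly_funs_diff:
  assumes "p \<in> poly_funs m" "q \<in> poly_funs m"
  shows "(\<lambda>xs. p xs - q xs) \<in> poly_funs m"
proof -
  have "(\<lambda>xs. p xs + (- 1) * q xs) \<in> poly_funs m"
    by (intro poly_funs.add poly_funs.mult poly_funs.const assms)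
  then show ?thesis by simp
qed

lemma poly_funs_power2:
  assumes "p \<in> poly_funs m"
  shows "(\<lambda>xs. (p xs)\<^sup>2) \<in> poly_funs m"
  unfolding power2_eq_square by (intro poly_funs.mult assms)

lemmas poly_funs_intros =
  poly_funs.const poly_funs.coord poly_funs.add poly_funs.mult
  poly_funs_diff poly_funs_sum poly_funs_power2

text \<open>This is why quantified variables are always appended at the end of the list: the free
  variables keep their indices.\<close>

lemma poly_funs_append:
  assumes "p \<in> poly_funs m" "length xs = m"
  shows "p (xs @ ys) = p xs"
  using assms by (induction rule: poly_funs.induct) (auto simp: nth_append)

lemma poly_funs_mono:
  assumes "p \<in> poly_funs m" "m \<le> k"
  shows "p \<in> poly_funs k"
  using assms
proof (induction rule: poly_funs.induct)
  case (coord i)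
  then show ?case by (intro poly_funs.coord) simp
qed (assumption | rule poly_funs.const poly_funs.add poly_funs.mult)+

locale o_minimal_structure =
  fixes S :: "nat \<Rightarrow> real list set set"
  assumes o_minimal: "o_minimal S"
begin

lemmas o_minimal_conj = o_minimal[unfolded o_minimal_def]
lemmas S_subset = o_minimal_conj[THEN conjunct1, rule_format]
lemmas S_empty = o_minimal_conj[THEN conjunct2, THEN conjunct1, rule_format]
lemmas S_Un = o_minimal_conj[THEN conjunct2, THEN conjunct2, THEN conjunct1, rule_format]
lemmas S_compl = o_minimal_conj[THEN conjunct2, THEN conjunct2, THEN conjunct2, THEN conjunct1, rule_format]
lemmas S_Cons = o_minimal_conj[THEN conjunct2, THEN conjunct2, THEN conjunct2, THEN conjunct2, THEN conjunct1, rule_format]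
lemmas S_butlast = o_minimal_conj[THEN conjunct2, THEN conjunct2, THEN conjunct2, THEN conjunct2, THEN conjunct2, THEN conjunct2, THEN conjunct1, rule_format]
lemmas S_zero = o_minimal_conj[THEN conjunct2, THEN conjunct2, THEN conjunct2, THEN conjunct2, THEN conjunct2, THEN conjunct2, THEN conjunct2, THEN conjunct1, rule_format]
lemmas S_1 = o_minimal_conj[THEN conjunct2, THEN conjunct2, THEN conjunct2, THEN conjunct2, THEN conjunct2, THEN conjunct2, THEN conjunct2, THEN conjunct2, rule_format]

lemma S_length: "A \<in> S m \<Longrightarrow> xs \<in> A \<Longrightarrow> length xs = m"
  using S_subset by fast

lemma definable_pred_not: "definable_pred S m \<phi> \<Longrightarrow> definable_pred S m (\<lambda>xs. \<not> \<phi> xs)"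
proof -
  assume "definable_pred S m \<phi>"
  then have "{xs. length xs = m} - {xs. length xs = m \<and> \<phi> xs} \<in> S m"
    unfolding definable_pred_def by (rule S_compl)
  also have "{xs. length xs = m} - {xs. length xs = m \<and> \<phi> xs} = {xs. length xs = m \<and> \<not> \<phi> xs}"
    by blast
  finally show ?thesis unfolding definable_pred_def .
qed

lemma definable_pred_disj: "definable_pred S m \<phi> \<Longrightarrow> definable_pred S m \<psi> \<Longrightarrow> definable_pred S m (\<lambda>xs. \<phi> xs \<or> \<psi> xs)"
proof -
  assume "definable_pred S m \<phi>" "definable_pred S m \<psi>"
  then have "{xs. length xs = m \<and> \<phi> xs} \<union> {xs. length xs = m \<and> \<psi> xs} \<in> S m"
    unfolding definable_pred_def by (rule S_Un)
  also have "{xs. length xs = m \<and> \<phi> xs} \<union> {xs. length xs = m \<and> \<psi> xs}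
    = {xs. length xs = m \<and> (\<phi> xs \<or> \<psi> xs)}"
    by blast
  finally show ?thesis unfolding definable_pred_def .
qed

lemma definable_pred_conj:
  assumes "definable_pred S m \<phi>" "definable_pred S m \<psi>"
  shows "definable_pred S m (\<lambda>xs. \<phi> xs \<and> \<psi> xs)"
  using definable_pred_not[OF definable_pred_disj[OF definable_pred_not[OF assms(1)] definable_pred_not[OF assms(2)]]] by simp

lemma definable_pred_False: "definable_pred S m (\<lambda>_. False)"
  unfolding definable_pred_def using S_empty by simp

lemma definable_pred_True: "definable_pred S m (\<lambda>_. True)"
  using definable_pred_not[OF definable_pred_False] by simp

lemma definable_pred_all_less:
  assumes "\<And>i. i < (n::nat) \<Longrightarrow> definable_pred S m (\<phi> i)"
  shows "definable_pred S m (\<lambda>xs. \<forall>i<n. \<phi> i xs)"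
  using assms
proof (induction n)
  case 0
  then show ?case using definable_pred_True by simp
next
  case (Suc n)
  then show ?case by (simp add: All_less_Suc definable_pred_conj)
qed

text \<open>Projecting away the last coordinate is existential quantification over it; the witness
  for a list in the set is its last entry.\<close>

lemma definable_pred_ex:
  assumes "definable_pred S (Suc m) \<phi>"
  shows "definable_pred S m (\<lambda>xs. \<exists>x. \<phi> (xs @ [x]))"
proof -
  have "butlast ` {xs. length xs = Suc m \<and> \<phi> xs} = {xs. length xs = m \<and> (\<exists>x. \<phi> (xs @ [x]))}"
  proof safe
    fix xs :: "real list" assume "length xs = Suc m" "\<phi> xs"
    then show "\<exists>x. \<phi> (butlast xs @ [x])"
      by (intro exI[of _ "last xs"]) (metis append_butlast_last_id list.size(3) nat.distinct(1))
  next
    fix xs x assume "\<phi> (xs @ [x])" "m = length xs"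
    then show "xs \<in> butlast ` {xsa. length xsa = Suc (length xs) \<and> \<phi> xsa}"
      by (intro image_eqI[of _ _ "xs @ [x]"]) auto
  qed auto
  then show ?thesis using S_butlast assms unfolding definable_pred_def by metis
qed

lemma definable_pred_ex_append:
  assumes "definable_pred S (m + k) \<phi>"
  shows "definable_pred S m (\<lambda>xs. \<exists>ys. length ys = k \<and> \<phi> (xs @ ys))"
  using assms
proof (induction k arbitrary: \<phi>)
  case 0
  then show ?case by simp
next
  case (Suc k)
  from Suc.IH[OF definable_pred_ex] Suc.prems
  have "definable_pred S m (\<lambda>xs. \<exists>ys. length ys = k \<and> (\<exists>x. \<phi> ((xs @ ys) @ [x])))"
    by simp
  then show ?case
  proof (rule definable_pred_cong[THEN iffD1, rotated])
    fix xs :: "real list"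
    show "(\<exists>ys. length ys = k \<and> (\<exists>x. \<phi> ((xs @ ys) @ [x]))) \<longleftrightarrow> (\<exists>ys. length ys = Suc k \<and> \<phi> (xs @ ys))"
      unfolding length_Suc_conv_rev append_assoc by blast
  qed
qed

lemma definable_pred_eq:
  assumes "p \<in> poly_funs m" "q \<in> poly_funs m"
  shows "definable_pred S m (\<lambda>xs. p xs = q xs)"
  using S_zero[OF poly_funs_diff[OF assms]] unfolding definable_pred_def by simp

text \<open>The axioms provide only zero sets of polynomials. The order comes from the squares: a
  real number is nonnegative iff it equals \<open>x * x\<close> for some \<open>x\<close>.\<close>

lemma definable_pred_le:
  assumes p: "p \<in> poly_funs m" and q: "q \<in> poly_funs m"
  shows "definable_pred S m (\<lambda>xs. p xs \<le> q xs)"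
proof -
  have "definable_pred S (Suc m) (\<lambda>zs. q zs - p zs = zs ! m * zs ! m)"
    by (intro definable_pred_eq poly_funs_intros poly_funs_mono[OF p] poly_funs_mono[OF q]) auto
  from definable_pred_ex[OF this] show ?thesis
  proof (rule definable_pred_cong[THEN iffD1, rotated])
    fix xs :: "real list" assume xs: "length xs = m"
    have "(\<exists>x. q xs - p xs = x * x) \<longleftrightarrow> p xs \<le> q xs"
      by (metis diff_ge_0_iff_ge real_sqrt_mult_self abs_of_nonneg zero_le_square)
    then show "(\<exists>x. q (xs @ [x]) - p (xs @ [x]) = (xs @ [x]) ! m * (xs @ [x]) ! m) \<longleftrightarrow> p xs \<le> q xs"
      using poly_funs_append[OF p xs] poly_funs_append[OF q xs] xs by (simp add: nth_append)
  qed
qed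

lemma definable_pred_less:
  assumes "p \<in> poly_funs m" "q \<in> poly_funs m"
  shows "definable_pred S m (\<lambda>xs. p xs < q xs)"
  using definable_pred_not[OF definable_pred_le[OF assms(2,1)]] by (simp add: not_le)

lemma definable_pred_drop:
  assumes "A \<in> S k"
  shows "definable_pred S (m + k) (\<lambda>zs. drop m zs \<in> A)"
proof (induction m)
  case 0
  have "{xs. length xs = k \<and> xs \<in> A} = A" using S_length[OF assms] by auto
  then show ?case using assms by (simp add: definable_pred_def)
next
  case (Suc m)
  then have "{x # xs | x xs. xs \<in> {xs. length xs = m + k \<and> drop m xs \<in> A}} \<in> S (Suc (m + k))"
    unfolding definable_pred_def by (rule S_Cons)
  also have "{x # xs | x xs. xs \<in> {xs. length xs = m + k \<and> drop m xs \<in> A}}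
     = {xs. length xs = Suc (m + k) \<and> drop (Suc m) xs \<in> A}"
    by (auto simp: length_Suc_conv)
  finally show ?case by (simp add: definable_pred_def)
qed

text \<open>The values of the polynomials are introduced as new quantified variables placed after
  \<open>xs\<close>, tied to \<open>xs\<close> by polynomial equations. With coordinate functions
  for \<open>ps\<close> this permutes, repeats or skips variables.\<close>

lemma definable_pred_subst:
  assumes A: "A \<in> S k" and ps: "length ps = k" "set ps \<subseteq> poly_funs m"
  shows "definable_pred S m (\<lambda>xs. map (\<lambda>p. p xs) ps \<in> A)"
proof -
  have p: "ps ! i \<in> poly_funs m" if "i < k" for i
    using ps that by auto
  have "definable_pred S (m + k) (\<lambda>zs. drop m zs \<in> A \<and> (\<forall>i<k. zs ! (m + i) = (ps ! i) zs))"
    by (intro definable_pred_conj definable_pred_drop A definable_pred_all_less definable_pred_eq poly_funs.coord)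
       (auto intro: poly_funs_mono[OF p])
  from definable_pred_ex_append[OF this] show ?thesis
  proof (rule definable_pred_cong[THEN iffD1, rotated])
    fix xs :: "real list" assume xs: "length xs = m"
    have *: "(ps ! i) (xs @ ys) = (ps ! i) xs" if "i < k" for i ys
      using poly_funs_append[OF p xs] that .
    have "ys = map (\<lambda>p. p xs) ps \<longleftrightarrow> length ys = k \<and> (\<forall>i<k. ys ! i = (ps ! i) xs)" for ys
      using ps by (auto simp: list_eq_iff_nth_eq)
    then show "(\<exists>ys. length ys = k \<and> drop m (xs @ ys) \<in> A \<and>
        (\<forall>i<k. (xs @ ys) ! (m + i) = (ps ! i) (xs @ ys))) \<longleftrightarrow> map (\<lambda>p. p xs) ps \<in> A"
      using xs * by (simp add: nth_append cong: conj_cong) metis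
  qed
qed

lemma definable_pred_block:
  assumes A: "A \<in> S k" and "j + k \<le> m"
  shows "definable_pred S m (\<lambda>xs. take k (drop j xs) \<in> A)"
proof -
  have "definable_pred S m (\<lambda>xs. map (\<lambda>p. p xs) (map (\<lambda>i xs. xs ! (j + i)) [0..<k]) \<in> A)"
    using assms by (intro definable_pred_subst) (auto intro: poly_funs.coord)
  then show ?thesis
  proof (rule definable_pred_cong[THEN iffD1, rotated])
    fix xs :: "real list" assume "length xs = m"
    then have "map (\<lambda>p. p xs) (map (\<lambda>i xs. xs ! (j + i)) [0..<k]) = take k (drop j xs)"
      using assms by (auto simp: list_eq_iff_nth_eq)
    then show "(map (\<lambda>p. p xs) (map (\<lambda>i xs. xs ! (j + i)) [0..<k]) \<in> A) \<longleftrightarrow> (take k (drop j xs) \<in> A)"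
      by simp
  qed
qed

section \<open>Definable functions of one variable\<close>

text \<open>If points of \<open>I\<close> come arbitrarily close to \<open>x\<close> from the right,
  convexity fills the gap between them and any fixed point \<open>b\<close> of \<open>I\<close>
  beyond \<open>x\<close>.\<close>

lemma eventually_interval_at_right:
  assumes "is_interval (I :: real set)"
  shows "eventually (\<lambda>y. y \<in> I) (at_right x) \<or> eventually (\<lambda>y. y \<notin> I) (at_right x)"
proof (cases "\<exists>z>x. \<forall>y. x < y \<and> y < z \<longrightarrow> y \<notin> I")
  case True
  then show ?thesis unfolding eventually_at_right_field by blast
next
  case False
  then obtain b where b: "b > x" "b \<in> I" by (meson gt_ex)
  have "y \<in> I" if "x < y" "y < b" for y
  proof -
    from False that obtain z where "x < z" "z < y" "z \<in> I" by blast
    then show ?thesis using assms b that unfolding is_interval_1 by (meson less_le)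
  qed
  then show ?thesis using b unfolding eventually_at_right_field by blast
qed

lemma eventually_interval_at_left:
  assumes "is_interval (I :: real set)"
  shows "eventually (\<lambda>y. y \<in> I) (at_left x) \<or> eventually (\<lambda>y. y \<notin> I) (at_left x)"
proof -
  have "y \<in> uminus ` I \<longleftrightarrow> - y \<in> I" for y
    by (metis (no_types) image_iff minus_minus)
  then show ?thesis
    using eventually_interval_at_right[of "uminus ` I" "- x"] assms
    unfolding eventually_at_left_to_right by simp
qed

text \<open>The axiom on \<open>S 1\<close> enters the proof here and nowhere else. Each of finitely
  many intervals settles on either side of \<open>x\<close>, hence so does their union.\<close>

lemma eventually_definable_pred:
  assumes "definable_pred S 1 (\<lambda>xs. Q (xs ! 0))"
  shows "eventually Q (at_right x) \<or> eventually (\<lambda>y. \<not> Q y) (at_right x)"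
    and "eventually Q (at_left x) \<or> eventually (\<lambda>y. \<not> Q y) (at_left x)"
proof -
  have "{xs. length xs = 1 \<and> Q (xs ! 0)} = (\<lambda>x. [x]) ` {x. Q x}"
    by (auto simp: length_Suc_conv)
  then obtain F where F: "finite F" "\<forall>I\<in>F. is_interval I" "(\<lambda>x. [x]) ` {x. Q x} = (\<lambda>x. [x]) ` \<Union>F"
    using assms S_1 unfolding definable_pred_def by simp metis
  have "{x. Q x} = \<Union>F"
    using F(3) by (subst (asm) inj_image_eq_iff) (auto simp: inj_on_def)
  then have Q: "Q x \<longleftrightarrow> (\<exists>I\<in>F. x \<in> I)" for x
    unfolding set_eq_iff mem_Collect_eq Union_iff by (rule spec)
  have *: "eventually (\<lambda>y. \<exists>I\<in>F. y \<in> I) G \<or> eventually (\<lambda>y. \<not> (\<exists>I\<in>F. y \<in> I)) G"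
    if "\<And>I. I \<in> F \<Longrightarrow> eventually (\<lambda>y. y \<in> I) G \<or> eventually (\<lambda>y. y \<notin> I) G" for G
    using F(1) that
  proof (induction F)
    case (insert I F)
    have IH: "eventually (\<lambda>y. \<exists>I\<in>F. y \<in> I) G \<or> eventually (\<lambda>y. \<not> (\<exists>I\<in>F. y \<in> I)) G"
      using insert.prems by (intro insert.IH) simp
    have I: "eventually (\<lambda>y. y \<in> I) G \<or> eventually (\<lambda>y. y \<notin> I) G"
      using insert.prems by simp
    show ?case
    proof (cases "eventually (\<lambda>y. y \<in> I) G \<or> eventually (\<lambda>y. \<exists>I\<in>F. y \<in> I) G")
      case True
      then have "eventually (\<lambda>y. \<exists>J\<in>insert I F. y \<in> J) G"
        by (elim disjE; elim eventually_mono) simp_all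
      then show ?thesis ..
    next
      case False
      with I IH have "eventually (\<lambda>y. y \<notin> I) G" "eventually (\<lambda>y. \<not> (\<exists>I\<in>F. y \<in> I)) G"
        by simp_all
      then have "eventually (\<lambda>y. \<not> (\<exists>J\<in>insert I F. y \<in> J)) G"
        by eventually_elim simp
      then show ?thesis ..
    qed
  qed simp
  show "eventually Q (at_right x) \<or> eventually (\<lambda>y. \<not> Q y) (at_right x)"
    unfolding Q by (rule *, rule eventually_interval_at_right) (use F(2) in blast)
  show "eventually Q (at_left x) \<or> eventually (\<lambda>y. \<not> Q y) (at_left x)"
    unfolding Q by (rule *, rule eventually_interval_at_left) (use F(2) in blast)
qed

end

text \<open>The hypotheses compare \<open>x\<close> only with points on one side of it. Transitivity
  through \<open>x\<close> glues them to a relation between both ends of any short interval around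
  \<open>x\<close>, which is what bisection asks for.\<close>

lemma Bolzano_one_sided:
  fixes P :: "real \<Rightarrow> real \<Rightarrow> bool"
  assumes "a < b"
    and trans: "\<And>x y z. a \<le> x \<Longrightarrow> x < y \<Longrightarrow> y < z \<Longrightarrow> z \<le> b \<Longrightarrow> P x y \<Longrightarrow> P y z \<Longrightarrow> P x z"
    and left: "\<And>x. a < x \<Longrightarrow> x \<le> b \<Longrightarrow> eventually (\<lambda>s. a \<le> s \<longrightarrow> P s x) (at_left x)"
    and right: "\<And>x. a \<le> x \<Longrightarrow> x < b \<Longrightarrow> eventually (\<lambda>t. t \<le> b \<longrightarrow> P x t) (at_right x)"
  shows "P a b"
proof -
  \<comment> \<open>Vacuous for \<open>s = t\<close> and outside \<open>[a, b]\<close>, so that the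
    gluing point may be an endpoint of the short interval.\<close>
  define Q where "Q s t \<longleftrightarrow> (a \<le> s \<and> s < t \<and> t \<le> b \<longrightarrow> P s t)" for s t
  have "Q a b"
    using less_imp_le[OF \<open>a < b\<close>]
  proof (induction rule: Bolzano)
    case (trans x y z)
    then show ?case
      using assms(2)[of x y z] unfolding Q_def by (cases "x = y"; cases "y = z") auto
  next
    case (local x)
    obtain c where c: "c < x" "\<And>s. c < s \<Longrightarrow> s < x \<Longrightarrow> a \<le> s \<Longrightarrow> P s x"
    proof (cases "a < x")
      case True
      then show ?thesis
        using left[of x] local that unfolding eventually_at_left_field by auto
    next
      case False
      then show ?thesis using that[of "x - 1"] by auto
    qed
    obtain d where d: "x < d" "\<And>t. x < t \<Longrightarrow> t < d \<Longrightarrow> t \<le> b \<Longrightarrow> P x t"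
    proof (cases "x < b")
      case True
      then show ?thesis
        using right[of x] local that unfolding eventually_at_right_field by auto
    next
      case False
      then show ?thesis using that[of "x + 1"] by auto
    qed
    show ?case
    proof (intro exI[of _ "min (x - c) (d - x)"] conjI allI impI)
      show "0 < min (x - c) (d - x)" using c d by simp
      fix s t assume st: "s \<le> x \<and> x \<le> t \<and> t - s < min (x - c) (d - x)"
      show "Q s t" unfolding Q_def
      proof
        assume ab: "a \<le> s \<and> s < t \<and> t \<le> b"
        have d': "t - s < x - c" "t - s < d - x" "s \<le> x" "x \<le> t" using st by simp_all
        have l: "P s x" if "s < x" by (rule c(2)) (use d' ab that in linarith)+
        have r: "P x t" if "x < t" by (rule d(2)) (use d' ab that in linarith)+
        consider "s = x" "x < t" | "s < x" "x = t" | "s < x" "x < t"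
          using d' ab by linarith
        then show "P s t"
        proof cases
          case 3
          then show ?thesis using assms(2)[of s x t] l r ab by simp
        qed (use l r in simp_all)
      qed
    qed
  qed
  then show ?thesis using \<open>a < b\<close> unfolding Q_def by auto
qed

text \<open>A rational interval contains at most one point that is such a minimum over the whole
  interval: of two points \<open>x < y\<close>, the first gives \<open>g x \<le> g y\<close> and the
  second, by strictness on its left, \<open>g y < g x\<close>.\<close>

lemma countable_leftmost_minima:
  fixes g :: "real \<Rightarrow> real"
  shows "countable {x. eventually (\<lambda>y. g x < g y) (at_left x) \<and> eventually (\<lambda>y. g x \<le> g y) (at_right x)}"
    (is "countable ?A")
proof -
  define B where "B a b = {x. a < x \<and> x < b \<and> (\<forall>y. a < y \<and> y < x \<longrightarrow> g x < g y) \<and>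
    (\<forall>y. x < y \<and> y < b \<longrightarrow> g x \<le> g y)}" for a b
  have "countable (B a b)" for a b
  proof -
    have "x = y" if "x \<in> B a b" "y \<in> B a b" for x y
      using that unfolding B_def by (cases x y rule: linorder_cases) (auto simp: not_less[symmetric])
    then have "B a b \<subseteq> {SOME x. x \<in> B a b}"
      by (metis insertI1 someI_ex subsetI)
    then show ?thesis by (rule countable_subset) simp
  qed
  then have "countable (\<Union>a\<in>\<rat>. \<Union>b\<in>\<rat>. B a b)"
    by (intro countable_UN countable_rat)
  moreover have "?A \<subseteq> (\<Union>a\<in>\<rat>. \<Union>b\<in>\<rat>. B a b)"
  proof
    fix x assume "x \<in> ?A"
    then obtain a b where "a < x" "\<forall>y>a. y < x \<longrightarrow> g x < g y" "b > x" "\<forall>y>x. y < b \<longrightarrow> g x \<le> g y"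
      unfolding eventually_at_left_field eventually_at_right_field by auto
    moreover obtain a' where "a' \<in> \<rat>" "a < a'" "a' < x" using Rats_dense_in_real[OF \<open>a < x\<close>] by blast
    moreover obtain b' where "b' \<in> \<rat>" "x < b'" "b' < b" using Rats_dense_in_real[OF \<open>b > x\<close>] by blast
    ultimately have "x \<in> B a' b'" unfolding B_def by auto
    then show "x \<in> (\<Union>a\<in>\<rat>. \<Union>b\<in>\<rat>. B a b)" using \<open>a' \<in> \<rat>\<close> \<open>b' \<in> \<rat>\<close> by blast
  qed
  ultimately show ?thesis by (rule countable_subset[rotated])
qed

lemma countable_rightmost_maxima:
  fixes g :: "real \<Rightarrow> real"
  shows "countable {x. eventually (\<lambda>y. g y \<le> g x) (at_left x) \<and> eventually (\<lambda>y. g y < g x) (at_right x)}"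
    (is "countable ?A")
proof -
  have "countable (uminus ` {x. eventually (\<lambda>y. - g (- x) < - g (- y)) (at_left x) \<and>
      eventually (\<lambda>y. - g (- x) \<le> - g (- y)) (at_right x)})"
    using countable_leftmost_minima[of "\<lambda>x. - g (- x)"] by (rule countable_image)
  moreover have "?A \<subseteq> uminus ` {x. eventually (\<lambda>y. - g (- x) < - g (- y)) (at_left x) \<and>
      eventually (\<lambda>y. - g (- x) \<le> - g (- y)) (at_right x)}"
  proof
    fix x assume "x \<in> ?A"
    then show "x \<in> uminus ` {x. eventually (\<lambda>y. - g (- x) < - g (- y)) (at_left x) \<and>
      eventually (\<lambda>y. - g (- x) \<le> - g (- y)) (at_right x)}"
      by (intro image_eqI[of _ _ "- x"])
         (simp_all add: eventually_at_left_to_right)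
  qed
  ultimately show ?thesis by (rule countable_subset[rotated])
qed

lemma uncountable_eventually_at_right:
  assumes "eventually P (at_right (a :: real))"
  shows "\<not> countable {x. P x}"
proof -
  obtain b where "b > a" "\<And>x. a < x \<Longrightarrow> x < b \<Longrightarrow> P x"
    using assms unfolding eventually_at_right_field by auto
  then have "{a<..<b} \<subseteq> {x. P x}" by auto
  then show ?thesis using uncountable_open_interval \<open>b > a\<close> countable_subset by blast
qed

lemma ex_length_2: "(\<exists>ys. length ys = 2 \<and> P ys) \<longleftrightarrow> (\<exists>a b. P [a, b])"
  by (auto simp: numeral_2_eq_2 length_Suc_conv)

section \<open>Monotonicity of definable functions near 0\<close>

context o_minimal_structure
begin

definition definable_curve :: "real \<Rightarrow> (real \<Rightarrow> real) \<Rightarrow> bool" where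
  "definable_curve e g \<longleftrightarrow> {[t, g t] | t. 0 < t \<and> t < e} \<in> S 2"

text \<open>Constant polynomials make every real number available as a parameter, so the sublevel
  and superlevel sets of \<open>g\<close> at the value \<open>g x\<close> are definable and settle
  on each side of \<open>x\<close>.\<close>

lemma definable_curve_dichotomy:
  assumes g: "definable_curve e g" and x: "0 < x" "x < e"
  shows "eventually (\<lambda>y. g y \<le> g x) (at_left x) \<or> eventually (\<lambda>y. g x < g y) (at_left x)"
    and "eventually (\<lambda>y. g x \<le> g y) (at_right x) \<or> eventually (\<lambda>y. g y < g x) (at_right x)"
proof -
  define G where "G = {[t, g t] | t. 0 < t \<and> t < e}"
  have G: "G \<in> S 2" using g by (simp add: G_def definable_curve_def)
  have 1: "definable_pred S 2 (\<lambda>xs. xs \<in> G \<and> xs ! 1 \<le> g x)" "definable_pred S 2 (\<lambda>xs. xs \<in> G \<and> g x \<le> xs ! 1)"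
    using definable_pred_block[OF G, of 0 2]
    by (intro definable_pred_conj definable_pred_le poly_funs.const poly_funs.coord;
        auto intro: definable_pred_cong[THEN iffD1, rotated])+
  have "definable_pred S 1 (\<lambda>xs. \<exists>u. xs @ [u] \<in> G \<and> (xs @ [u]) ! 1 \<le> g x)"
    "definable_pred S 1 (\<lambda>xs. \<exists>u. xs @ [u] \<in> G \<and> g x \<le> (xs @ [u]) ! 1)"
    by (rule definable_pred_ex, use 1 in \<open>simp add: numeral_2_eq_2\<close>)+
  moreover have "(\<exists>u. xs @ [u] \<in> G \<and> (xs @ [u]) ! 1 \<le> g x) \<longleftrightarrow> 0 < xs ! 0 \<and> xs ! 0 < e \<and> g (xs ! 0) \<le> g x"
    "(\<exists>u. xs @ [u] \<in> G \<and> g x \<le> (xs @ [u]) ! 1) \<longleftrightarrow> 0 < xs ! 0 \<and> xs ! 0 < e \<and> g x \<le> g (xs ! 0)"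
    if "length xs = 1" for xs :: "real list"
    using that by (auto simp: G_def length_Suc_conv)
  ultimately have 2: "definable_pred S 1 (\<lambda>xs. 0 < xs ! 0 \<and> xs ! 0 < e \<and> g (xs ! 0) \<le> g x)"
    "definable_pred S 1 (\<lambda>xs. 0 < xs ! 0 \<and> xs ! 0 < e \<and> g x \<le> g (xs ! 0))"
    by (auto cong: definable_pred_cong)
  have l: "eventually (\<lambda>y. 0 < y \<and> y < e) (at_left x)"
    unfolding eventually_at_left_field using x by (intro exI[of _ 0]) auto
  have r: "eventually (\<lambda>y. 0 < y \<and> y < e) (at_right x)"
    unfolding eventually_at_right_field using x by (intro exI[of _ e]) auto
  show "eventually (\<lambda>y. g y \<le> g x) (at_left x) \<or> eventually (\<lambda>y. g x < g y) (at_left x)"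
    using eventually_definable_pred(2)[OF 2(1), of x]
  proof
    assume "\<forall>\<^sub>F y in at_left x. 0 < y \<and> y < e \<and> g y \<le> g x"
    then show ?thesis by (auto elim: eventually_mono)
  next
    assume "\<forall>\<^sub>F y in at_left x. \<not> (0 < y \<and> y < e \<and> g y \<le> g x)"
    with l have "\<forall>\<^sub>F y in at_left x. g x < g y" by eventually_elim auto
    then show ?thesis ..
  qed
  show "eventually (\<lambda>y. g x \<le> g y) (at_right x) \<or> eventually (\<lambda>y. g y < g x) (at_right x)"
    using eventually_definable_pred(1)[OF 2(2), of x]
  proof
    assume "\<forall>\<^sub>F y in at_right x. 0 < y \<and> y < e \<and> g x \<le> g y"
    then show ?thesis by (auto elim: eventually_mono)
  next
    assume "\<forall>\<^sub>F y in at_right x. \<not> (0 < y \<and> y < e \<and> g x \<le> g y)"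
    with r have "\<forall>\<^sub>F y in at_right x. g y < g x" by eventually_elim auto
    then show ?thesis ..
  qed
qed

text \<open>How \<open>g\<close> compares with \<open>g x\<close> on one side of \<open>x\<close> is
  itself a first-order condition on \<open>x\<close> (some radius works for all \<open>y\<close>),
  hence it settles as \<open>x\<close> decreases to 0.\<close>

lemma definable_curve_types:
  assumes g: "definable_curve e g" and "0 < e"
  shows "(\<forall>\<^sub>F x in at_right 0. \<forall>\<^sub>F y in at_left x. g y \<le> g x) \<or>
         (\<forall>\<^sub>F x in at_right 0. \<forall>\<^sub>F y in at_left x. g x < g y)" (is ?L)
    and "(\<forall>\<^sub>F x in at_right 0. \<forall>\<^sub>F y in at_right x. g x \<le> g y) \<or>
         (\<forall>\<^sub>F x in at_right 0. \<forall>\<^sub>F y in at_right x. g y < g x)" (is ?R)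
proof -
  define G where "G = {[t, g t] | t. 0 < t \<and> t < e}"
  have G: "G \<in> S 2" using g by (simp add: G_def definable_curve_def)
  have Gi: "[t, u] \<in> G \<longleftrightarrow> 0 < t \<and> t < e \<and> u = g t" for t u
    by (auto simp: G_def)
  have three: "3 = 1 + (2 :: nat)" by simp
  have near: "\<forall>\<^sub>F x in at_right 0. 0 < x \<and> x < e"
    unfolding eventually_at_right_field using \<open>0 < e\<close> by auto
  \<comment> \<open>variables: \<open>x\<close>, \<open>g x\<close>, the radius \<open>d\<close>, \<open>y\<close>, \<open>g y\<close>\<close>
  have "definable_pred S (3 + 2) (\<lambda>xs. take 2 (drop 3 xs) \<in> G \<and> xs ! 0 - xs ! 2 < xs ! 3 \<and> xs ! 3 < xs ! 0 \<and> xs ! 1 < xs ! 4)"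
    by (intro definable_pred_conj definable_pred_block[OF G] definable_pred_less poly_funs_diff poly_funs.coord) auto
  note 1 = definable_pred_ex_append[OF this]
  have "definable_pred S 3 (\<lambda>xs. take 2 (drop 0 xs) \<in> G \<and> 0 < xs ! 2 \<and> \<not> (\<exists>ys. length ys = 2 \<and>
     (take 2 (drop 3 (xs @ ys)) \<in> G \<and> (xs @ ys) ! 0 - (xs @ ys) ! 2 < (xs @ ys) ! 3 \<and>
      (xs @ ys) ! 3 < (xs @ ys) ! 0 \<and> (xs @ ys) ! 1 < (xs @ ys) ! 4)))"
    by (intro definable_pred_conj definable_pred_block[OF G] definable_pred_less poly_funs_diff poly_funs.coord poly_funs.const definable_pred_not[OF 1]) simp_all
  note 2 = definable_pred_ex_append[OF this[unfolded three]]
  have L: "definable_pred S 1 (\<lambda>xs. 0 < xs ! 0 \<and> xs ! 0 < e \<and> (\<exists>d>0. \<forall>y. 0 < y \<and> y < e \<and> xs ! 0 - d < y \<and> y < xs ! 0 \<longrightarrow> g y \<le> g (xs ! 0)))"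
  proof (rule definable_pred_cong[THEN iffD1, OF _ 2], unfold ex_length_2, goal_cases)
    case (1 xs)
    then obtain x where xs: "xs = [x]" by (auto simp: length_Suc_conv)
    show ?case unfolding xs by (simp add: Gi not_less imp_conv_disj)
  qed
  have "definable_pred S (3 + 2) (\<lambda>xs. take 2 (drop 3 xs) \<in> G \<and> xs ! 0 < xs ! 3 \<and> xs ! 3 < xs ! 0 + xs ! 2 \<and> xs ! 4 < xs ! 1)"
    by (intro definable_pred_conj definable_pred_block[OF G] definable_pred_less poly_funs.add poly_funs.coord) auto
  note 1 = definable_pred_ex_append[OF this]
  have "definable_pred S 3 (\<lambda>xs. take 2 (drop 0 xs) \<in> G \<and> 0 < xs ! 2 \<and> \<not> (\<exists>ys. length ys = 2 \<and>
     (take 2 (drop 3 (xs @ ys)) \<in> G \<and> (xs @ ys) ! 0 < (xs @ ys) ! 3 \<and>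
      (xs @ ys) ! 3 < (xs @ ys) ! 0 + (xs @ ys) ! 2 \<and> (xs @ ys) ! 4 < (xs @ ys) ! 1)))"
    by (intro definable_pred_conj definable_pred_block[OF G] definable_pred_less poly_funs_diff poly_funs.coord poly_funs.const definable_pred_not[OF 1]) simp_all
  note 2 = definable_pred_ex_append[OF this[unfolded three]]
  have R: "definable_pred S 1 (\<lambda>xs. 0 < xs ! 0 \<and> xs ! 0 < e \<and> (\<exists>d>0. \<forall>y. 0 < y \<and> y < e \<and> xs ! 0 < y \<and> y < xs ! 0 + d \<longrightarrow> g (xs ! 0) \<le> g y))"
  proof (rule definable_pred_cong[THEN iffD1, OF _ 2], unfold ex_length_2, goal_cases)
    case (1 xs)
    then obtain x where xs: "xs = [x]" by (auto simp: length_Suc_conv)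
    show ?case unfolding xs by (simp add: Gi not_less imp_conv_disj)
  qed
  have l: "(\<exists>d>0. \<forall>y. 0 < y \<and> y < e \<and> x - d < y \<and> y < x \<longrightarrow> g y \<le> g x) \<longleftrightarrow> (\<forall>\<^sub>F y in at_left x. g y \<le> g x)"
    if "0 < x" "x < e" for x
  proof
    assume "\<exists>d>0. \<forall>y. 0 < y \<and> y < e \<and> x - d < y \<and> y < x \<longrightarrow> g y \<le> g x"
    then obtain d where "d > 0" "\<forall>y. 0 < y \<and> y < e \<and> x - d < y \<and> y < x \<longrightarrow> g y \<le> g x" by blast
    then show "\<forall>\<^sub>F y in at_left x. g y \<le> g x"
      unfolding eventually_at_left_field using that by (intro exI[of _ "max 0 (x - d)"]) auto
  next
    assume "\<forall>\<^sub>F y in at_left x. g y \<le> g x"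
    then obtain b where "b < x" "\<forall>y>b. y < x \<longrightarrow> g y \<le> g x"
      unfolding eventually_at_left_field by auto
    then show "\<exists>d>0. \<forall>y. 0 < y \<and> y < e \<and> x - d < y \<and> y < x \<longrightarrow> g y \<le> g x"
      by (intro exI[of _ "x - b"]) auto
  qed
  have r: "(\<exists>d>0. \<forall>y. 0 < y \<and> y < e \<and> x < y \<and> y < x + d \<longrightarrow> g x \<le> g y) \<longleftrightarrow> (\<forall>\<^sub>F y in at_right x. g x \<le> g y)"
    if "0 < x" "x < e" for x
  proof
    assume "\<exists>d>0. \<forall>y. 0 < y \<and> y < e \<and> x < y \<and> y < x + d \<longrightarrow> g x \<le> g y"
    then obtain d where "d > 0" "\<forall>y. 0 < y \<and> y < e \<and> x < y \<and> y < x + d \<longrightarrow> g x \<le> g y" by blast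
    then show "\<forall>\<^sub>F y in at_right x. g x \<le> g y"
      unfolding eventually_at_right_field using that by (intro exI[of _ "min e (x + d)"]) auto
  next
    assume "\<forall>\<^sub>F y in at_right x. g x \<le> g y"
    then obtain b where "x < b" "\<forall>y>x. y < b \<longrightarrow> g x \<le> g y"
      unfolding eventually_at_right_field by auto
    then show "\<exists>d>0. \<forall>y. 0 < y \<and> y < e \<and> x < y \<and> y < x + d \<longrightarrow> g x \<le> g y"
      by (intro exI[of _ "b - x"]) auto
  qed
  show ?L
    using eventually_definable_pred(1)[OF L, of 0]
  proof
    assume *: "\<forall>\<^sub>F x in at_right 0. 0 < x \<and> x < e \<and> (\<exists>d>0. \<forall>y. 0 < y \<and> y < e \<and> x - d < y \<and> y < x \<longrightarrow> g y \<le> g x)"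
    then have "\<forall>\<^sub>F x in at_right 0. \<forall>\<^sub>F y in at_left x. g y \<le> g x"
      by (rule eventually_mono) (use l in blast)
    then show ?thesis ..
  next
    assume "\<forall>\<^sub>F x in at_right 0. \<not> (0 < x \<and> x < e \<and> (\<exists>d>0. \<forall>y. 0 < y \<and> y < e \<and> x - d < y \<and> y < x \<longrightarrow> g y \<le> g x))"
    with near have "\<forall>\<^sub>F x in at_right 0. \<forall>\<^sub>F y in at_left x. g x < g y"
      by eventually_elim (use l definable_curve_dichotomy(1)[OF g] in blast)
    then show ?thesis ..
  qed
  show ?R
    using eventually_definable_pred(1)[OF R, of 0]
  proof
    assume *: "\<forall>\<^sub>F x in at_right 0. 0 < x \<and> x < e \<and> (\<exists>d>0. \<forall>y. 0 < y \<and> y < e \<and> x < y \<and> y < x + d \<longrightarrow> g x \<le> g y)"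
    then have "\<forall>\<^sub>F x in at_right 0. \<forall>\<^sub>F y in at_right x. g x \<le> g y"
      by (rule eventually_mono) (use r in blast)
    then show ?thesis ..
  next
    assume "\<forall>\<^sub>F x in at_right 0. \<not> (0 < x \<and> x < e \<and> (\<exists>d>0. \<forall>y. 0 < y \<and> y < e \<and> x < y \<and> y < x + d \<longrightarrow> g x \<le> g y))"
    with near have "\<forall>\<^sub>F x in at_right 0. \<forall>\<^sub>F y in at_right x. g y < g x"
      by eventually_elim (use r definable_curve_dichotomy(2)[OF g] in blast)
    then show ?thesis ..
  qed
qed

text \<open>Of the four combinations of one-sided types, two would make every small \<open>x\<close>
  a one-sidedly strict local extremum, which is possible only for countably many points. The other
  two are local monotonicity at each point, and \<open>Bolzano_one_sided\<close> makes it global.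
  Weak monotonicity is all that a length estimate asks for.\<close>

lemma definable_curve_monotone:
  assumes g: "definable_curve e g" and "0 < e"
  shows "\<exists>d>0. mono_on {0<..<d} g \<or> antimono_on {0<..<d} g"
proof -
  have no: False if "\<forall>\<^sub>F x in at_right 0. P x" "countable {x. P x}" for P :: "real \<Rightarrow> bool"
    using uncountable_eventually_at_right that by blast
  have ty: "(\<forall>\<^sub>F x in at_right 0. (\<forall>\<^sub>F y in at_left x. g y \<le> g x) \<and> (\<forall>\<^sub>F y in at_right x. g x \<le> g y)) \<or>
        (\<forall>\<^sub>F x in at_right 0. (\<forall>\<^sub>F y in at_left x. g x \<le> g y) \<and> (\<forall>\<^sub>F y in at_right x. g y \<le> g x))"
    using definable_curve_types[OF assms]
  proof (elim disjE)
    assume 1: "\<forall>\<^sub>F x in at_right 0. \<forall>\<^sub>F y in at_left x. g y \<le> g x"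
      and 2: "\<forall>\<^sub>F x in at_right 0. \<forall>\<^sub>F y in at_right x. g x \<le> g y"
    from eventually_conj[OF 1 2] show ?thesis ..
  next
    assume 1: "\<forall>\<^sub>F x in at_right 0. \<forall>\<^sub>F y in at_left x. g y \<le> g x"
      and 2: "\<forall>\<^sub>F x in at_right 0. \<forall>\<^sub>F y in at_right x. g y < g x"
    from no[OF eventually_conj[OF 1 2] countable_rightmost_maxima] show ?thesis ..
  next
    assume 1: "\<forall>\<^sub>F x in at_right 0. \<forall>\<^sub>F y in at_left x. g x < g y"
      and 2: "\<forall>\<^sub>F x in at_right 0. \<forall>\<^sub>F y in at_right x. g x \<le> g y"
    from no[OF eventually_conj[OF 1 2] countable_leftmost_minima] show ?thesis ..
  next
    assume 1: "\<forall>\<^sub>F x in at_right 0. \<forall>\<^sub>F y in at_left x. g x < g y"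
      and 2: "\<forall>\<^sub>F x in at_right 0. \<forall>\<^sub>F y in at_right x. g y < g x"
    from eventually_conj[OF 1 2] show ?thesis
      by (intro disjI2) (auto elim!: eventually_mono intro: less_imp_le)
  qed
  have mono: "\<exists>d>0. mono_on {0<..<d} f"
    if "\<forall>\<^sub>F x in at_right 0. (\<forall>\<^sub>F y in at_left x. f y \<le> f x) \<and> (\<forall>\<^sub>F y in at_right x. f x \<le> f y)"
    for f :: "real \<Rightarrow> real"
  proof -
    from that obtain d where d: "d > 0" "\<And>x. 0 < x \<Longrightarrow> x < d \<Longrightarrow> (\<forall>\<^sub>F y in at_left x. f y \<le> f x)"
      "\<And>x. 0 < x \<Longrightarrow> x < d \<Longrightarrow> (\<forall>\<^sub>F y in at_right x. f x \<le> f y)"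
      unfolding eventually_at_right_field[of _ 0] by auto
    have "f a \<le> f b" if "0 < a" "a < b" "b < d" for a b
      using that(2)
    proof (rule Bolzano_one_sided[of a b "\<lambda>a b. f a \<le> f b"])
      fix x assume "a < x" "x \<le> b"
      then show "\<forall>\<^sub>F s in at_left x. a \<le> s \<longrightarrow> f s \<le> f x"
        using d(2)[of x] that by (auto elim: eventually_mono)
    next
      fix x assume "a \<le> x" "x < b"
      then show "\<forall>\<^sub>F s in at_right x. s \<le> b \<longrightarrow> f x \<le> f s"
        using d(3)[of x] that by (auto elim: eventually_mono)
    qed auto
    then have "mono_on {0<..<d} f"
      by (intro mono_onI) (auto simp: le_less)
    then show ?thesis using d(1) by blast
  qed
  from ty show ?thesis
  proof
    assume "\<forall>\<^sub>F x in at_right 0. (\<forall>\<^sub>F y in at_left x. g y \<le> g x) \<and> (\<forall>\<^sub>F y in at_right x. g x \<le> g y)"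
    from mono[OF this] show ?thesis by blast
  next
    assume "\<forall>\<^sub>F x in at_right 0. (\<forall>\<^sub>F y in at_left x. g x \<le> g y) \<and> (\<forall>\<^sub>F y in at_right x. g y \<le> g x)"
    then have "\<exists>d>0. mono_on {0<..<d} (\<lambda>x. - g x)" by (intro mono) simp
    then show ?thesis by (auto simp: monotone_on_def)
  qed
qed

end

section \<open>Definable selection\<close>

text \<open>Over a fine subdivision the squares of small increments of \<open>G\<close> are
  negligible against the increments themselves. \<open>G\<close> may be discontinuous: where it
  jumps, the increment stays large while \<open>y - x\<close> becomes small, so the inequality is
  trivial there. Both cases cost an extra slope \<open>h\<close>, which finally tends to 0.\<close>

lemma quadratic_error_vanishes:
  fixes G :: "real \<Rightarrow> real"
  assumes "a < b" and mono: "mono_on {a..b} G" and "0 \<le> s" "0 \<le> C"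
    and le: "\<And>x y. a \<le> x \<Longrightarrow> x < y \<Longrightarrow> y \<le> b \<Longrightarrow> y - x \<le> s * (G y - G x) + C * (G y - G x)\<^sup>2"
  shows "b - a \<le> s * (G b - G a)"
proof -
  have G: "G x \<le> G y" if "a \<le> x" "x \<le> y" "y \<le> b" for x y
    using mono_onD[OF mono, of x y] that by auto
  have *: "b - a \<le> (s + h) * (G b - G a)" if "h > 0" for h
  proof -
    \<comment> \<open>Threshold between small increments and jumps: \<open>C * k \<le> h\<close>
      turns the quadratic error of an increment up to \<open>k\<close> into \<open>h\<close> times
      the increment. The summand 1 covers \<open>C = 0\<close>.\<close>
    define k where "k = h / (C + 1)"
    have k: "k > 0" "C * k \<le> h"
      using \<open>h > 0\<close> \<open>0 \<le> C\<close> by (simp_all add: k_def field_simps)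
    have small: "y - x \<le> (s + h) * (G y - G x)"
      if "a \<le> x" "x < y" "y \<le> b" "G y - G x \<le> k \<or> y - x \<le> h * k" for x y
    proof -
      define u where "u = G y - G x"
      have u: "0 \<le> u" using G[of x y] that by (simp add: u_def)
      show ?thesis
      proof (cases "u \<le> k")
        case True
        then have "C * u\<^sup>2 \<le> h * u"
          using mult_right_mono[of "C * u" h u] mult_left_mono[of u k C] k u \<open>0 \<le> C\<close>
          by (simp add: power2_eq_square mult.assoc)
        then show ?thesis using le[of x y] that by (simp add: u_def algebra_simps)
      next
        case False
        then have "y - x \<le> h * k" "h * k \<le> h * u" using that \<open>h > 0\<close> by (auto simp: u_def)
        moreover have "0 \<le> s * u" using u \<open>0 \<le> s\<close> by simp
        ultimately show ?thesis by (simp add: u_def[symmetric] algebra_simps)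
      qed
    qed
    have hk: "0 < h * k" using k \<open>h > 0\<close> by simp
    show ?thesis
      using \<open>a < b\<close>
    proof (rule Bolzano_one_sided[of a b "\<lambda>x y. y - x \<le> (s + h) * (G y - G x)"])
      fix x y z assume "y - x \<le> (s + h) * (G y - G x)" "z - y \<le> (s + h) * (G z - G y)"
      then show "z - x \<le> (s + h) * (G z - G x)" by (simp add: algebra_simps)
    next
      fix x assume x: "a < x" "x \<le> b"
      show "\<forall>\<^sub>F y in at_left x. a \<le> y \<longrightarrow> x - y \<le> (s + h) * (G x - G y)"
      proof (cases "\<exists>c. a \<le> c \<and> c < x \<and> G x - G c \<le> k")
        case True
        then obtain c where c: "a \<le> c" "c < x" "G x - G c \<le> k" by blast
        then have "x - y \<le> (s + h) * (G x - G y)" if "c < y" "y < x" for y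
          using small[of y x] G[of c y] that x by simp
        then show ?thesis unfolding eventually_at_left_field using c by blast
      next
        case False
        \<comment> \<open>Here \<open>G\<close> jumps by more than \<open>k\<close> at
          \<open>x\<close> from the left, and \<open>small\<close> applies through its alternative
          on the length of the interval.\<close>
        have "x - y \<le> (s + h) * (G x - G y)" if "x - h * k < y" "y < x" "a \<le> y" for y
          using small[of y x] that x by simp
        then show ?thesis unfolding eventually_at_left_field
          using hk by (intro exI[of _ "x - h * k"]) simp
      qed
    next
      fix x assume x: "a \<le> x" "x < b"
      show "\<forall>\<^sub>F y in at_right x. y \<le> b \<longrightarrow> y - x \<le> (s + h) * (G y - G x)"
      proof (cases "\<exists>c. c \<le> b \<and> x < c \<and> G c - G x \<le> k")
        case True
        then obtain c where c: "c \<le> b" "x < c" "G c - G x \<le> k" by blast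
        then have "y - x \<le> (s + h) * (G y - G x)" if "x < y" "y < c" for y
          using small[of x y] G[of y c] that x by simp
        then show ?thesis unfolding eventually_at_right_field using c by blast
      next
        case False
        have "y - x \<le> (s + h) * (G y - G x)" if "y < x + h * k" "x < y" "y \<le> b" for y
          using small[of x y] that x by simp
        then show ?thesis unfolding eventually_at_right_field
          using hk by (intro exI[of _ "x + h * k"]) simp
      qed
    qed
  qed
  show ?thesis
  proof (rule field_le_epsilon)
    fix e :: real assume "e > 0"
    define u where "u = G b - G a"
    have u: "0 \<le> u" using G[of a b] \<open>a < b\<close> by (simp add: u_def)
    have "b - a \<le> (s + e / (u + 1)) * u"
      using *[of "e / (u + 1)"] u \<open>e > 0\<close> by (simp add: u_def)
    also have "\<dots> = s * u + e * (u / (u + 1))" by (simp add: algebra_simps)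
    also have "\<dots> \<le> s * u + e * 1"
      using u \<open>e > 0\<close> by (intro add_left_mono mult_left_mono) auto
    finally show "b - a \<le> s * (G b - G a) + e" by (simp add: u_def)
  qed
qed

context o_minimal_structure
begin

lemma definable_pred_mem: "A \<in> S m \<Longrightarrow> definable_pred S m (\<lambda>xs. xs \<in> A)"
proof -
  assume A: "A \<in> S m"
  have "{xs. length xs = m \<and> xs \<in> A} = A" using S_length[OF A] by auto
  then show ?thesis using A by (simp add: definable_pred_def)
qed

lemma definable_pred_nths:
  assumes "A \<in> S k" "length js = k" "set js \<subseteq> {..<m}"
  shows "definable_pred S m (\<lambda>xs. map (\<lambda>j. xs ! j) js \<in> A)"
proof -
  have "definable_pred S m (\<lambda>xs. map (\<lambda>p. p xs) (map (\<lambda>j xs. xs ! j) js) \<in> A)"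
    using assms by (intro definable_pred_subst) (auto intro: poly_funs.coord)
  then show ?thesis by (simp add: comp_def)
qed

text \<open>Definable choice by successive minimization: each function in \<open>es\<close> is
  minimized over the set left by its predecessors. Continuity keeps that set compact and nonempty,
  and the minimal value is definable in \<open>t\<close>. The points live in an arbitrary metric
  space, so definability is stated for their images under \<open>es\<close>; each round consumes one
  coordinate of that image. Only the first function is minimized over all of
  \<open>C t\<close>.\<close>

lemma lexicographic_selection:
  fixes C :: "real \<Rightarrow> 'a :: metric_space set"
  assumes "\<And>t. 0 < t \<Longrightarrow> t < d \<Longrightarrow> compact (C t) \<and> C t \<noteq> {}"
    and "\<And>t e. 0 < t \<Longrightarrow> t < d \<Longrightarrow> e \<in> set es \<Longrightarrow> continuous_on (C t) e"
    and "{t # map (\<lambda>e. e v) es | t v. 0 < t \<and> t < d \<and> v \<in> C t} \<in> S (Suc (length es))"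
  shows "\<exists>\<gamma>. (\<forall>t. 0 < t \<and> t < d \<longrightarrow> \<gamma> t \<in> C t \<and> (es \<noteq> [] \<longrightarrow> (\<forall>v\<in>C t. hd es (\<gamma> t) \<le> hd es v))) \<and>
    (\<forall>e\<in>set es. definable_curve d (\<lambda>t. e (\<gamma> t)))"
  using assms
proof (induction es arbitrary: C)
  case Nil
  then have "\<forall>t. \<exists>v. 0 < t \<and> t < d \<longrightarrow> v \<in> C t" by blast
  then show ?case by simp metis
next
  case (Cons e es)
  define k where "k = length es"
  define F where "F = {t # map (\<lambda>e. e v) (e # es) | t v. 0 < t \<and> t < d \<and> v \<in> C t}"
  have F: "F \<in> S (Suc (Suc k))" using Cons.prems(3) by (simp add: F_def k_def)
  have Fi: "t # u # ys \<in> F \<longleftrightarrow> 0 < t \<and> t < d \<and> (\<exists>v\<in>C t. u = e v \<and> ys = map (\<lambda>e. e v) es)" for t u ys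
    unfolding F_def by auto
  have "\<forall>t. \<exists>v. 0 < t \<and> t < d \<longrightarrow> v \<in> C t \<and> (\<forall>w\<in>C t. e v \<le> e w)"
    using continuous_attains_inf[of "C _" e] Cons.prems(1,2) by (metis list.set_intros(1))
  then obtain v0 where v0: "\<And>t. 0 < t \<Longrightarrow> t < d \<Longrightarrow> v0 t \<in> C t \<and> (\<forall>w\<in>C t. e (v0 t) \<le> e w)"
    by metis
  define m where "m t = e (v0 t)" for t
  define C' where "C' t = {v \<in> C t. e v = m t}" for t
  \<comment> \<open>The graph of the minimum value. The minimizers \<open>v0\<close> are chosen
    arbitrarily, but \<open>m\<close> does not depend on the choice.\<close>
  define H where "H = {[t, m t] | t. 0 < t \<and> t < d}"
  have Hi: "[t, u] \<in> H \<longleftrightarrow> 0 < t \<and> t < d \<and> u = m t" for t u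
    unfolding H_def by auto
  have "definable_pred S (2 + k) (\<lambda>xs. xs \<in> F)" using definable_pred_mem[OF F] by simp
  note 1 = definable_pred_ex_append[OF this]
  \<comment> \<open>Index 0 holds \<open>t\<close>, index 1 the candidate \<open>u\<close>, index 2
    a competing value. The list of indices skips \<open>u\<close>, so this says that a value below
    \<open>u\<close> is attained.\<close>
  have "definable_pred S (2 + Suc k) (\<lambda>zs. map (\<lambda>j. zs ! j) (0 # [2..<3 + k]) \<in> F \<and> zs ! 2 < zs ! 1)"
    by (intro definable_pred_conj definable_pred_nths[OF F] definable_pred_less poly_funs.coord) auto
  note 2 = definable_pred_ex_append[OF this]
  have "definable_pred S 2 (\<lambda>xs. xs \<in> H)"
  proof (rule definable_pred_cong[THEN iffD1, OF _ definable_pred_conj[OF 1 definable_pred_not[OF 2]]])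
    fix xs :: "real list" assume "length xs = 2"
    then obtain t u where xs: "xs = [t, u]" by (auto simp: numeral_2_eq_2 length_Suc_conv)
    have 1: "(\<exists>ys. length ys = k \<and> xs @ ys \<in> F) \<longleftrightarrow> 0 < t \<and> t < d \<and> (\<exists>v\<in>C t. u = e v)"
      unfolding xs by (auto simp: Fi k_def) (metis length_map)
    have upt: "map (\<lambda>j. (xs @ ys) ! j) (0 # [2..<3 + k]) = t # ys" if "length ys = Suc k" for ys
      using that by (intro nth_equalityI) (auto simp: xs nth_Cons' nth_append simp del: upt_Suc)
    have "(\<exists>ys. length ys = Suc k \<and> map (\<lambda>j. (xs @ ys) ! j) (0 # [2..<3 + k]) \<in> F \<and>
        (xs @ ys) ! 2 < (xs @ ys) ! 1)
      \<longleftrightarrow> (\<exists>ys. length ys = Suc k \<and> t # ys \<in> F \<and> ys ! 0 < u)"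
      using upt by (simp add: xs cong: conj_cong del: upt_Suc)
    also have "\<dots> \<longleftrightarrow> (\<exists>w ys. length ys = k \<and> t # w # ys \<in> F \<and> w < u)"
      by (simp only: length_Suc_conv) force
    also have "\<dots> \<longleftrightarrow> 0 < t \<and> t < d \<and> (\<exists>v\<in>C t. e v < u)"
      by (auto simp: Fi k_def) (metis length_map)
    finally have 2: "(\<exists>ys. length ys = Suc k \<and> map (\<lambda>j. (xs @ ys) ! j) (0 # [2..<3 + k]) \<in> F \<and>
        (xs @ ys) ! 2 < (xs @ ys) ! 1) \<longleftrightarrow> 0 < t \<and> t < d \<and> (\<exists>v\<in>C t. e v < u)" .
    show "((\<exists>ys. length ys = k \<and> xs @ ys \<in> F) \<and> \<not> (\<exists>ys. length ys = Suc k \<and>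
        map (\<lambda>j. (xs @ ys) ! j) (0 # [2..<3 + k]) \<in> F \<and> (xs @ ys) ! 2 < (xs @ ys) ! 1)) \<longleftrightarrow> xs \<in> H"
      unfolding 1 2 unfolding xs Hi m_def using v0[of t] by (force simp: not_less)
  qed
  then have "{xs. length xs = 2 \<and> xs \<in> H} \<in> S 2" by (simp add: definable_pred_def)
  moreover have "{xs. length xs = 2 \<and> xs \<in> H} = H" by (auto simp: H_def)
  ultimately have H: "H \<in> S 2" by simp
  \<comment> \<open>The value of \<open>e\<close> is quantified away in the last position; the index
    list moves it back to second place, where \<open>F\<close> expects it.\<close>
  have "definable_pred S (Suc (Suc k)) (\<lambda>zs. map (\<lambda>j. zs ! j) (0 # Suc k # [1..<Suc k]) \<in> F \<and> map (\<lambda>j. zs ! j) [0, Suc k] \<in> H)"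
    by (intro definable_pred_conj definable_pred_nths[OF F] definable_pred_nths[OF H]) auto
  note 3 = definable_pred_ex[OF this]
  have "definable_pred S (Suc k) (\<lambda>xs. xs \<in> {t # map (\<lambda>e. e v) es | t v. 0 < t \<and> t < d \<and> v \<in> C' t})"
  proof (rule definable_pred_cong[THEN iffD1, OF _ 3])
    fix xs :: "real list" assume "length xs = Suc k"
    then obtain t ys where xs: "xs = t # ys" "length ys = k" by (auto simp: length_Suc_conv)
    have *: "map (\<lambda>j. (xs @ [u]) ! j) (0 # Suc k # [1..<Suc k]) = t # u # ys" for u
      using xs(2) by (intro nth_equalityI) (auto simp: xs nth_Cons' nth_append simp del: upt_Suc)
    have **: "map (\<lambda>j. (xs @ [u]) ! j) [0, Suc k] = [t, u]" for u
      using xs(2) by (simp add: xs nth_append)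
    show "(\<exists>u. map (\<lambda>j. (xs @ [u]) ! j) (0 # Suc k # [1..<Suc k]) \<in> F \<and>
        map (\<lambda>j. (xs @ [u]) ! j) [0, Suc k] \<in> H) \<longleftrightarrow>
        xs \<in> {t # map (\<lambda>e. e v) es | t v. 0 < t \<and> t < d \<and> v \<in> C' t}"
      unfolding * ** Fi Hi by (auto simp: xs C'_def; metis)
  qed
  then have "{xs. length xs = Suc k \<and> xs \<in> {t # map (\<lambda>e. e v) es | t v. 0 < t \<and> t < d \<and> v \<in> C' t}} \<in> S (Suc k)"
    by (simp add: definable_pred_def)
  moreover have "{xs. length xs = Suc k \<and> xs \<in> {t # map (\<lambda>e. e v) es | t v. 0 < t \<and> t < d \<and> v \<in> C' t}}
    = {t # map (\<lambda>e. e v) es | t v. 0 < t \<and> t < d \<and> v \<in> C' t}" by (auto simp: k_def)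
  ultimately have F': "{t # map (\<lambda>e. e v) es | t v. 0 < t \<and> t < d \<and> v \<in> C' t} \<in> S (Suc (length es))"
    by (simp add: k_def)
  have sub: "C' t \<subseteq> C t" for t by (auto simp: C'_def)
  have comp: "compact (C' t) \<and> C' t \<noteq> {}" if t: "0 < t" "t < d" for t
  proof
    have "C' t = C t \<inter> e -` {m t}" by (auto simp: C'_def)
    then have "closedin (top_of_set (C t)) (C' t)"
      using continuous_closedin_preimage[of "C t" e "{m t}"] Cons.prems(2)[OF t] by simp
    then show "compact (C' t)" using Cons.prems(1)[OF t] closedin_compact by blast
    show "C' t \<noteq> {}" using v0[OF t] by (auto simp: C'_def m_def)
  qed
  have "continuous_on (C' t) e'" if "0 < t" "t < d" "e' \<in> set es" for t e'
    using Cons.prems(2)[of t e'] that by (auto intro: continuous_on_subset[OF _ sub])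
  from Cons.IH[OF comp this F'] obtain \<gamma> where
    \<gamma>: "\<And>t. 0 < t \<Longrightarrow> t < d \<Longrightarrow> \<gamma> t \<in> C' t" "\<forall>e\<in>set es. definable_curve d (\<lambda>t. e (\<gamma> t))"
    by blast
  have \<gamma>e: "e (\<gamma> t) = m t" if "0 < t" "t < d" for t
    using \<gamma>(1)[OF that] by (simp add: C'_def)
  have "{[t, e (\<gamma> t)] | t. 0 < t \<and> t < d} = H"
    using \<gamma>e unfolding H_def by auto
  then have "definable_curve d (\<lambda>t. e (\<gamma> t))" using H by (simp add: definable_curve_def)
  moreover have "\<gamma> t \<in> C t \<and> (\<forall>v\<in>C t. e (\<gamma> t) \<le> e v)" if "0 < t" "t < d" for t
    using \<gamma>(1)[OF that] \<gamma>e[OF that] v0[OF that] by (auto simp: C'_def m_def)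
  ultimately show ?case using \<gamma>(2) by (intro exI[of _ \<gamma>]) auto
qed

end

section \<open>Definability of the slope\<close>

lemma length_coords [simp]: "length (coords (v :: real ^ 'n::finite)) = CARD('n)"
  by (simp add: coords_def)

lemma bij_coord_index:
  "bij_betw (from_nat_into (UNIV :: 'n::finite set)) {..<CARD('n)} UNIV"
  by (rule bij_betw_from_nat_into_finite) simp

lemma nth_coords:
  "i < CARD('n) \<Longrightarrow> coords (v :: real ^ 'n::finite) ! i = v $ from_nat_into UNIV i"
  by (simp add: coords_def)

lemma sum_coords:
  fixes v :: "real ^ 'n::finite"
  shows "(\<Sum>i<CARD('n). h (coords v ! i)) = (\<Sum>j\<in>UNIV. h (v $ j))"
proof -
  have "(\<Sum>j\<in>UNIV. h (v $ j)) = (\<Sum>i<CARD('n). h (v $ from_nat_into UNIV i))"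
    by (rule sum.reindex_bij_betw[OF bij_coord_index, symmetric])
  then show ?thesis by (simp add: nth_coords)
qed

lemma coords_diff_nth:
  fixes v w :: "real ^ 'n::finite"
  shows "i < CARD('n) \<Longrightarrow> coords (v - w) ! i = coords v ! i - coords w ! i"
  by (simp add: nth_coords)

lemma norm_coords:
  fixes v w :: "real ^ 'n::finite"
  shows "(norm (v - w))\<^sup>2 = (\<Sum>i<CARD('n). (coords v ! i - coords w ! i)\<^sup>2)"
proof -
  have "(norm (v - w))\<^sup>2 = (\<Sum>j\<in>UNIV. ((v - w) $ j)\<^sup>2)"
    unfolding power2_norm_eq_inner inner_vec_def by (simp add: power2_eq_square)
  also have "\<dots> = (\<Sum>i<CARD('n). (coords (v - w) ! i)\<^sup>2)"
    by (rule sum_coords[symmetric])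
  finally show ?thesis by (simp add: coords_diff_nth)
qed

lemma norm_le_sum_coords:
  fixes v w :: "real ^ 'n::finite"
  shows "norm (v - w) \<le> (\<Sum>i<CARD('n). \<bar>coords v ! i - coords w ! i\<bar>)"
proof -
  have "norm (v - w) \<le> (\<Sum>j\<in>UNIV. \<bar>(v - w) $ j\<bar>)"
    by (rule norm_le_l1_cart)
  also have "\<dots> = (\<Sum>i<CARD('n). \<bar>coords (v - w) ! i\<bar>)"
    by (rule sum_coords[symmetric])
  finally show ?thesis by (simp add: coords_diff_nth)
qed

lemma inj_coords: "inj coords"
proof (rule injI)
  fix v w :: "real ^ 'n" assume "coords v = coords w"
  then have "(norm (v - w))\<^sup>2 = 0" by (simp add: norm_coords)
  then show "v = w" by simp
qed

lemma coords_image_iff [simp]: "coords v \<in> coords ` A \<longleftrightarrow> v \<in> A"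
  by (rule inj_image_mem_iff[OF inj_coords])

text \<open>\<open>s\<close> bounds the slope of \<open>f\<close> at \<open>v\<close> relative to \<open>X\<close>, up to a quadratic error. This replaces the
  norm of a subgradient and is first-order definable without derivatives.\<close>

definition slope_le :: "real \<Rightarrow> ('a::real_normed_vector \<Rightarrow> real) \<Rightarrow> 'a set \<Rightarrow> 'a \<Rightarrow> real \<Rightarrow> bool" where
  "slope_le C f X v s \<longleftrightarrow> (\<forall>w\<in>X. f v - f w \<le> s * norm (v - w) + C * (norm (v - w))\<^sup>2)"

text \<open>Each test point \<open>w\<close> contributes one condition that is closed in
  \<open>(s, v)\<close> jointly. The cut-off at 1 keeps \<open>s\<close> bounded, so a least slope
  on a nonempty level set is attained.\<close>

lemma closed_slope_le:
  assumes "compact X" "continuous_on X f"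
  shows "compact {(s, v). 0 \<le> s \<and> s \<le> 1 \<and> v \<in> X \<and> f v = c \<and> slope_le C f X v s}"
proof -
  let ?K = "{0..1::real} \<times> X"
  have K: "compact ?K" by (intro compact_Times assms) simp
  have f: "continuous_on ?K (\<lambda>p. f (snd p))"
    by (rule continuous_on_compose2[OF assms(2)]) (auto intro!: continuous_intros)
  have "closedin (top_of_set ?K) (?K \<inter> (\<lambda>p. f (snd p)) -` {c})"
    by (rule continuous_closedin_preimage[OF f]) simp
  moreover have "closedin (top_of_set ?K)
    (?K \<inter> (\<lambda>p. f (snd p) - f w - fst p * norm (snd p - w) - C * (norm (snd p - w))\<^sup>2) -` {..0})" for w
    by (rule continuous_closedin_preimage) (intro continuous_intros f, simp)
  ultimately have "closedin (top_of_set ?K) (\<Inter> (insert (?K \<inter> (\<lambda>p. f (snd p)) -` {c})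
     ((\<lambda>w. ?K \<inter> (\<lambda>p. f (snd p) - f w - fst p * norm (snd p - w) - C * (norm (snd p - w))\<^sup>2) -` {..0}) ` X)))"
    by (intro closedin_Inter) auto
  then have "compact (\<Inter> (insert (?K \<inter> (\<lambda>p. f (snd p)) -` {c})
     ((\<lambda>w. ?K \<inter> (\<lambda>p. f (snd p) - f w - fst p * norm (snd p - w) - C * (norm (snd p - w))\<^sup>2) -` {..0}) ` X)))"
    using K closedin_compact by blast
  also have "\<Inter> (insert (?K \<inter> (\<lambda>p. f (snd p)) -` {c})
     ((\<lambda>w. ?K \<inter> (\<lambda>p. f (snd p) - f w - fst p * norm (snd p - w) - C * (norm (snd p - w))\<^sup>2) -` {..0}) ` X))
     = {(s, v). 0 \<le> s \<and> s \<le> 1 \<and> v \<in> X \<and> f v = c \<and> slope_le C f X v s}"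
    by (auto simp: slope_le_def algebra_simps)
  finally show ?thesis .
qed

context o_minimal_structure
begin

text \<open>The defining condition quantifies only over points of \<open>X\<close>, so its failure
  is an existential statement about one violating \<open>w\<close>.\<close>

lemma definable_slope:
  fixes f :: "real ^ 'n::finite \<Rightarrow> real"
  assumes f: "definable_fun_on S D f" and X: "definable_set S X" "X \<subseteq> D"
  shows "{t # s # coords v | t s v. 0 \<le> s \<and> s \<le> 1 \<and> v \<in> X \<and> f v = c + t \<and> slope_le C f X v s}
    \<in> S (Suc (Suc CARD('n)))"
proof -
  let ?n = "CARD('n)"
  define A where "A = coords ` X"
  define G where "G = (\<lambda>v. coords v @ [f v]) ` D"
  have A: "A \<in> S ?n" and G: "G \<in> S (Suc ?n)"
    using f X(1) by (simp_all add: A_def G_def definable_set_def definable_fun_on_def)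
  have Gi: "coords v @ [u] \<in> G \<longleftrightarrow> u = f v" if "v \<in> X" for v u
    using that X(2) inj_coords by (auto simp: G_def inj_def)
  \<comment> \<open>The variables are \<open>t\<close>, \<open>s\<close>, the coordinates of
    \<open>v\<close>, those of \<open>w\<close>, then \<open>f w\<close> and
    \<open>norm (v - w)\<close>. The value is read off from the graph of \<open>f\<close>; the norm,
    not being polynomial, is the nonnegative root of the sum of squares.\<close>
  define bad where "bad zs \<longleftrightarrow> map (\<lambda>j. zs ! j) [?n + 2..<?n + 2 + ?n] \<in> A \<and>
      map (\<lambda>j. zs ! j) [?n + 2..<?n + 2 + Suc ?n] \<in> G \<and> 0 \<le> zs ! (?n + 2 + Suc ?n) \<and>
      (zs ! (?n + 2 + Suc ?n))\<^sup>2 = (\<Sum>i<?n. (zs ! (2 + i) - zs ! (?n + 2 + i))\<^sup>2) \<and>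
      zs ! 1 * zs ! (?n + 2 + Suc ?n) + C * (zs ! (?n + 2 + Suc ?n))\<^sup>2 < c + zs ! 0 - zs ! (?n + 2 + ?n)"
    for zs :: "real list"
  have "definable_pred S ((?n + 2) + (?n + 2)) bad"
    unfolding bad_def
    by (intro definable_pred_conj definable_pred_nths[OF A] definable_pred_nths[OF G] definable_pred_le definable_pred_eq definable_pred_less poly_funs_intros;
        auto simp del: upt_Suc)
  note 1 = definable_pred_ex_append[OF this]
  have "definable_pred S (?n + 2) (\<lambda>xs. (map (\<lambda>j. xs ! j) [2..<2 + ?n] \<in> A \<and>
      map (\<lambda>p. p xs) (map (\<lambda>j xs. xs ! j) [2..<2 + ?n] @ [\<lambda>xs. c + xs ! 0]) \<in> G \<and>
      0 \<le> xs ! 1 \<and> xs ! 1 \<le> 1) \<and> \<not> (\<exists>ys. length ys = ?n + 2 \<and> bad (xs @ ys)))"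
    by (intro definable_pred_conj definable_pred_not[OF 1] definable_pred_nths[OF A] definable_pred_subst[OF G] definable_pred_le poly_funs.const poly_funs.coord;
        auto intro!: poly_funs.add poly_funs.coord poly_funs.const simp del: upt_Suc)
  then have "definable_pred S (?n + 2) (\<lambda>xs. xs \<in> {t # s # coords v | t s v. 0 \<le> s \<and> s \<le> 1 \<and> v \<in> X \<and> f v = c + t \<and> slope_le C f X v s})"
  proof (rule definable_pred_cong[THEN iffD1, rotated])
    fix xs :: "real list" assume "length xs = ?n + 2"
    then obtain t s vs where xs: "xs = t # s # vs" and vs: "length vs = ?n"
      by (auto simp: length_Suc_conv numeral_2_eq_2)
    have v: "map (\<lambda>j. xs ! j) [2..<2 + ?n] = vs"
      using vs by (intro nth_equalityI) (simp_all add: xs del: upt_Suc)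
    have v': "map (\<lambda>p. p xs) (map (\<lambda>j xs. xs ! j) [2..<2 + ?n] @ [\<lambda>xs. c + xs ! 0]) = vs @ [c + t]"
      using v by (simp add: xs comp_def del: upt_Suc)
    have bad: "(\<exists>ys. length ys = ?n + 2 \<and> bad (xs @ ys)) \<longleftrightarrow> \<not> slope_le C f X v s"
      if vX: "v \<in> X" "f v = c + t" "vs = coords v" for v
    proof -
      have "bad (xs @ coords w @ [u, e]) \<longleftrightarrow> w \<in> X \<and> u = f w \<and> e = norm (v - w) \<and>
          s * e + C * e\<^sup>2 < f v - u" for w u e
      proof -
        have 1: "map (\<lambda>j. (xs @ coords w @ [u, e]) ! j) [?n + 2..<?n + 2 + ?n] = coords w"
          using vs by (intro nth_equalityI) (simp_all add: xs nth_append del: upt_Suc)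
        have "[?n + 2..<?n + 2 + Suc ?n] = [?n + 2..<?n + 2 + ?n] @ [?n + 2 + ?n]" by simp
        then have "map (\<lambda>j. (xs @ coords w @ [u, e]) ! j) [?n + 2..<?n + 2 + Suc ?n] = coords w @ [u]"
          using 1 vs by (simp add: xs nth_append del: upt_Suc)
        note 1 this
        moreover have "(\<Sum>i<?n. ((xs @ coords w @ [u, e]) ! (2 + i) - (xs @ coords w @ [u, e]) ! (?n + 2 + i))\<^sup>2)
          = (norm (v - w))\<^sup>2"
          unfolding norm_coords using vs by (intro sum.cong) (auto simp: xs nth_append vX(3))
        ultimately have "bad (xs @ coords w @ [u, e]) \<longleftrightarrow> coords w \<in> A \<and> coords w @ [u] \<in> G \<and> 0 \<le> e \<and>
          e\<^sup>2 = (norm (v - w))\<^sup>2 \<and> s * e + C * e\<^sup>2 < c + t - u"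
          unfolding bad_def using vs by (simp add: xs nth_append del: upt_Suc)
        also have "\<dots> \<longleftrightarrow> w \<in> X \<and> u = f w \<and> e = norm (v - w) \<and> s * e + C * e\<^sup>2 < f v - u"
          using Gi[of w u] vX(2) by (auto simp: A_def)
        finally show ?thesis .
      qed
      note b = this
      have "(\<exists>ys. length ys = ?n + 2 \<and> bad (xs @ ys)) \<longleftrightarrow> (\<exists>(w :: real ^ 'n) u e. bad (xs @ coords w @ [u, e]))"
      proof
        assume "\<exists>ys. length ys = ?n + 2 \<and> bad (xs @ ys)"
        then obtain ys where ys: "length ys = ?n + 2" "bad (xs @ ys)" by blast
        define ws where "ws = take ?n ys"
        have "length (drop ?n ys) = 2" using ys(1) by simp
        then obtain u e where "drop ?n ys = [u, e]"
          by (auto simp only: numeral_2_eq_2 length_Suc_conv length_0_conv)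
        then have ys': "ys = ws @ [u, e]" by (metis append_take_drop_id ws_def)
        have "map (\<lambda>j. (xs @ ys) ! j) [?n + 2..<?n + 2 + ?n] = ws"
          using vs ys by (intro nth_equalityI) (simp_all add: xs nth_append ws_def del: upt_Suc)
        then have "ws \<in> A" using ys(2) unfolding bad_def by simp
        then obtain w :: "real ^ 'n" where "ws = coords w" by (auto simp: A_def)
        then show "\<exists>(w :: real ^ 'n) u e. bad (xs @ coords w @ [u, e])" using ys(2) ys' by auto
      next
        assume "\<exists>(w :: real ^ 'n) u e. bad (xs @ coords w @ [u, e])"
        then obtain w :: "real ^ 'n" and u e where "bad (xs @ coords w @ [u, e])" by blast
        then show "\<exists>ys. length ys = ?n + 2 \<and> bad (xs @ ys)"
          by (intro exI[of _ "coords w @ [u, e]"]) simp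
      qed
      also have "\<dots> \<longleftrightarrow> \<not> slope_le C f X v s"
        unfolding b slope_le_def by (auto simp: not_le)
      finally show ?thesis .
    qed
    show "((map (\<lambda>j. xs ! j) [2..<2 + ?n] \<in> A \<and>
      map (\<lambda>p. p xs) (map (\<lambda>j xs. xs ! j) [2..<2 + ?n] @ [\<lambda>xs. c + xs ! 0]) \<in> G \<and>
      0 \<le> xs ! 1 \<and> xs ! 1 \<le> 1) \<and> \<not> (\<exists>ys. length ys = ?n + 2 \<and> bad (xs @ ys))) \<longleftrightarrow>
      xs \<in> {t # s # coords v | t s v. 0 \<le> s \<and> s \<le> 1 \<and> v \<in> X \<and> f v = c + t \<and> slope_le C f X v s}"
      (is "?l \<longleftrightarrow> xs \<in> ?r")
    proof
      assume l: ?l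
      then obtain v :: "real ^ 'n" where v1: "v \<in> X" "vs = coords v" unfolding v by (auto simp: A_def)
      then have "f v = c + t" using l Gi[of v "c + t"] unfolding v' by auto
      then show "xs \<in> ?r" using l v1 bad[of v] xs by auto
    next
      assume "xs \<in> ?r"
      then obtain v :: "real ^ 'n" where "v \<in> X" "vs = coords v" "f v = c + t" "slope_le C f X v s" "0 \<le> s" "s \<le> 1"
        by (auto simp: xs)
      then show ?l unfolding v v' using bad[of v] Gi[of v "c + t"] by (auto simp: xs A_def)
    qed
  qed
  then have "{xs. length xs = ?n + 2 \<and> xs \<in> {t # s # coords v | t s v. 0 \<le> s \<and> s \<le> 1 \<and> v \<in> X \<and> f v = c + t \<and> slope_le C f X v s}} \<in> S (?n + 2)"
    unfolding definable_pred_def .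
  also have "{xs. length xs = ?n + 2 \<and> xs \<in> {t # s # coords v | t s v. 0 \<le> s \<and> s \<le> 1 \<and> v \<in> X \<and> f v = c + t \<and> slope_le C f X v s}}
    = {t # s # coords v | t s v. 0 \<le> s \<and> s \<le> 1 \<and> v \<in> X \<and> f v = c + t \<and> slope_le C f X v s}"
    by auto
  finally show ?thesis by simp
qed

end

section \<open>A Kurdyka-Lojasiewicz inequality\<close>

context o_minimal_structure
begin

lemma definable_curves_monotone:
  assumes "finite I" "0 < e" "\<And>i. i \<in> I \<Longrightarrow> definable_curve e (g i)"
  shows "\<exists>d>0. d \<le> e \<and> (\<forall>i\<in>I. mono_on {0<..<d} (g i) \<or> antimono_on {0<..<d} (g i))"
proof -
  have "\<forall>\<^sub>F d in at_right 0. mono_on {0<..<d} (g i) \<or> antimono_on {0<..<d} (g i)" if i: "i \<in> I" for i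
  proof -
    obtain d where d: "d > 0" "mono_on {0<..<d} (g i) \<or> antimono_on {0<..<d} (g i)"
      using definable_curve_monotone[OF assms(3)[OF i] assms(2)] by blast
    have "mono_on {0<..<c} (g i) \<or> antimono_on {0<..<c} (g i)" if "0 < c" "c < d" for c
      using d(2) that by (auto intro: monotone_on_subset)
    then show ?thesis unfolding eventually_at_right_field using d(1) by blast
  qed
  then have "\<forall>\<^sub>F d in at_right 0. \<forall>i\<in>I. mono_on {0<..<d} (g i) \<or> antimono_on {0<..<d} (g i)"
    using assms(1) by (intro eventually_ball_finite) auto
  then obtain b where "b > 0" "\<And>c. 0 < c \<Longrightarrow> c < b \<Longrightarrow> \<forall>i\<in>I. mono_on {0<..<c} (g i) \<or> antimono_on {0<..<c} (g i)"
    unfolding eventually_at_right_field by auto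
  then show ?thesis using \<open>0 < e\<close> by (intro exI[of _ "min e (b / 2)"] conjI) simp_all
qed

text \<open>Changing the sign of the decreasing coordinates turns every variation into an increment
  of an increasing function; the sum of these functions bounds all variations at once.\<close>

lemma monotone_total_variation:
  fixes x :: "'i \<Rightarrow> real \<Rightarrow> real"
  assumes "finite I"
    and mono: "\<And>i. i \<in> I \<Longrightarrow> mono_on {0<..<d} (x i) \<or> antimono_on {0<..<d} (x i)"
    and bdd: "\<And>i t. i \<in> I \<Longrightarrow> 0 < t \<Longrightarrow> t < d \<Longrightarrow> \<bar>x i t\<bar> \<le> B"
  shows "\<exists>G B'. (\<forall>a b. 0 < a \<and> a \<le> b \<and> b < d \<longrightarrow> (\<Sum>i\<in>I. \<bar>x i b - x i a\<bar>) \<le> G b - G a) \<and>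
    (\<forall>t. 0 < t \<and> t < d \<longrightarrow> \<bar>G t\<bar> \<le> B')"
proof -
  define G where "G t = (\<Sum>i\<in>I. if mono_on {0<..<d} (x i) then x i t else - x i t)" for t
  have "(\<Sum>i\<in>I. \<bar>x i b - x i a\<bar>) \<le> G b - G a" if ab: "0 < a" "a \<le> b" "b < d" for a b
  proof -
    have "\<bar>x i b - x i a\<bar> \<le> (if mono_on {0<..<d} (x i) then x i b else - x i b)
        - (if mono_on {0<..<d} (x i) then x i a else - x i a)" if i: "i \<in> I" for i
    proof (cases "mono_on {0<..<d} (x i)")
      case True
      have "x i a \<le> x i b" using mono_onD[OF True, of a b] ab by simp
      then show ?thesis using True by simp
    next
      case False
      then have "antimono_on {0<..<d} (x i)" using mono[OF i] by simp
      from monotone_onD[OF this, of a b] have "x i b \<le> x i a" using ab by simp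
      then show ?thesis using False by simp
    qed
    then have "(\<Sum>i\<in>I. \<bar>x i b - x i a\<bar>) \<le> (\<Sum>i\<in>I. (if mono_on {0<..<d} (x i) then x i b else - x i b)
        - (if mono_on {0<..<d} (x i) then x i a else - x i a))"
      by (rule sum_mono)
    then show ?thesis by (simp add: G_def sum_subtractf)
  qed
  moreover have "\<bar>G t\<bar> \<le> (\<Sum>i\<in>I. B)" if "0 < t" "t < d" for t
    unfolding G_def using bdd that by (intro order.trans[OF sum_abs] sum_mono) auto
  ultimately show ?thesis by blast
qed

text \<open>The function \<open>\<Gamma>\<close> measures the length of a definable curve of points of least slope on the
  levels of \<open>f\<close>; it takes the place of the desingularizing function of a Kurdyka-Lojasiewicz inequality.
  The identity is added to it to cover slopes larger than 1.\<close>

theorem Kurdyka_Lojasiewicz: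
  fixes f :: "real ^ 'n::finite \<Rightarrow> real"
  assumes f: "definable_fun_on S D f" and X: "definable_set S X" "X \<subseteq> D"
    and X': "compact X" "continuous_on X f" and "0 \<le> C"
  shows "\<exists>d>0. \<exists>\<Gamma> B. mono_on {0<..<d} \<Gamma> \<and> (\<forall>t. 0 < t \<and> t < d \<longrightarrow> \<bar>\<Gamma> t\<bar> \<le> B) \<and>
    (\<forall>a b v s. 0 < a \<and> a < b \<and> b < d \<and> v \<in> X \<and> f v = c + b \<and> 0 \<le> s \<and> slope_le C f X v s \<longrightarrow>
       b - a \<le> s * (\<Gamma> b - \<Gamma> a))"
proof -
  let ?n = "CARD('n)"
  \<comment> \<open>Pairs of a point on the level \<open>c + t\<close> and an admissible slope bound
    at it, cut off at 1 for compactness.\<close>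
  define W where "W t = {(s, v). 0 \<le> s \<and> s \<le> 1 \<and> v \<in> X \<and> f v = c + t \<and> slope_le C f X v s}" for t
  define F where "F = {t # s # coords v | t s v. 0 \<le> s \<and> s \<le> 1 \<and> v \<in> X \<and> f v = c + t \<and> slope_le C f X v s}"
  have F: "F \<in> S (Suc (Suc ?n))"
    unfolding F_def by (rule definable_slope[OF f X])
  have Fi: "t # xs \<in> F \<longleftrightarrow> (\<exists>s v. (s, v) \<in> W t \<and> xs = s # coords v)" for t xs
    by (auto simp: F_def W_def)
  have "definable_pred S (1 + Suc ?n) (\<lambda>xs. xs \<in> F)" using definable_pred_mem[OF F] by simp
  from definable_pred_ex_append[OF this] have "definable_pred S 1 (\<lambda>xs. W (xs ! 0) \<noteq> {})"
  proof (rule definable_pred_cong[THEN iffD1, rotated])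
    fix xs :: "real list" assume "length xs = 1"
    then obtain t where "xs = [t]" by (auto simp: length_Suc_conv)
    then show "(\<exists>ys. length ys = Suc ?n \<and> xs @ ys \<in> F) \<longleftrightarrow> W (xs ! 0) \<noteq> {}"
      by (simp add: Fi) (metis (no_types) length_Cons length_coords equals0D ex_in_conv surj_pair)
  qed
  from eventually_definable_pred(1)[OF this, of 0]
  consider "\<forall>\<^sub>F t in at_right 0. W t \<noteq> {}" | "\<forall>\<^sub>F t in at_right 0. \<not> W t \<noteq> {}" by blast
  then show ?thesis
  proof cases
    \<comment> \<open>All slope bounds on the levels just above \<open>c\<close> exceed 1, and the
      identity can serve as \<open>\<Gamma>\<close>.\<close>
    case 2
    then obtain d where d: "d > 0" "\<And>t. 0 < t \<Longrightarrow> t < d \<Longrightarrow> W t = {}"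
      unfolding eventually_at_right_field by auto
    have "b - a \<le> s * (b - a)" if "0 < a" "a < b" "b < d" "v \<in> X" "f v = c + b" "0 \<le> s" "slope_le C f X v s" for a b v s
    proof -
      have "(s, v) \<notin> W b" using d(2)[of b] that by simp
      then have "s > 1" using that by (simp add: W_def)
      then show ?thesis using that by (simp add: mult_le_cancel_right1)
    qed
    moreover have "mono_on {0<..<d} (\<lambda>t. t)" by (rule mono_onI)
    moreover have "\<bar>t\<bar> \<le> d" if "0 < t" "t < d" for t using that by simp
    ultimately show ?thesis using d(1) by blast
  next
    case 1
    then obtain d0 where d0: "d0 > 0" "\<And>t. 0 < t \<Longrightarrow> t < d0 \<Longrightarrow> W t \<noteq> {}"
      unfolding eventually_at_right_field by auto
    \<comment> \<open>The slope comes first, so that the selection minimizes it over the whole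
      level; the coordinates follow, so that the selected point is definable in \<open>t\<close> as
      well.\<close>
    define es :: "(real \<times> (real ^ 'n) \<Rightarrow> real) list" where "es = fst # map (\<lambda>i p. coords (snd p) ! i) [0..<?n]"
    define F1 where "F1 = {t # map (\<lambda>e. e p) es | t p. 0 < t \<and> t < d0 \<and> p \<in> W t}"
    have es: "map (\<lambda>e. e p) es = fst p # coords (snd p)" for p :: "real \<times> (real ^ 'n)"
      unfolding es_def by (simp add: comp_def) (intro nth_equalityI, simp_all)
    have "definable_pred S (Suc (Suc ?n)) (\<lambda>xs. xs \<in> F \<and> 0 < xs ! 0 \<and> xs ! 0 < d0)"
      by (intro definable_pred_conj definable_pred_mem[OF F] definable_pred_less poly_funs.const poly_funs.coord) simp_all
    moreover have "{xs. length xs = Suc (Suc ?n) \<and> xs \<in> F \<and> 0 < xs ! 0 \<and> xs ! 0 < d0} = F1"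
      unfolding F1_def es F_def W_def by auto
    ultimately have F1: "F1 \<in> S (Suc (length es))" by (simp add: definable_pred_def es_def)
    have "continuous_on (W t) e" if "e \<in> set es" for t e
      using that by (auto simp: es_def nth_coords intro!: continuous_intros)
    moreover have "compact (W t)" for t
      unfolding W_def by (rule closed_slope_le[OF X'])
    ultimately have "\<exists>\<gamma>. (\<forall>t. 0 < t \<and> t < d0 \<longrightarrow>
        \<gamma> t \<in> W t \<and> (es \<noteq> [] \<longrightarrow> (\<forall>v\<in>W t. hd es (\<gamma> t) \<le> hd es v))) \<and>
      (\<forall>e\<in>set es. definable_curve d0 (\<lambda>t. e (\<gamma> t)))"
      by (intro lexicographic_selection[OF _ _ F1[unfolded F1_def]]) (simp_all add: d0(2))
    then obtain \<gamma> where sel: "\<forall>t. 0 < t \<and> t < d0 \<longrightarrow>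
        \<gamma> t \<in> W t \<and> (es \<noteq> [] \<longrightarrow> (\<forall>v\<in>W t. hd es (\<gamma> t) \<le> hd es v))"
      and curves: "\<forall>e\<in>set es. definable_curve d0 (\<lambda>t. e (\<gamma> t))"
      by blast
    have \<gamma>: "\<gamma> t \<in> W t" "p \<in> W t \<Longrightarrow> fst (\<gamma> t) \<le> fst p" if "0 < t" "t < d0" for t p
      using sel that by (auto simp: es_def)
    have "\<exists>d>0. d \<le> d0 \<and> (\<forall>e\<in>set es. mono_on {0<..<d} (\<lambda>t. e (\<gamma> t)) \<or> antimono_on {0<..<d} (\<lambda>t. e (\<gamma> t)))"
      by (rule definable_curves_monotone) (use curves d0 in auto)
    then obtain d where d: "d > 0" "d \<le> d0"
      and mono: "\<And>e. e \<in> set es \<Longrightarrow> mono_on {0<..<d} (\<lambda>t. e (\<gamma> t)) \<or> antimono_on {0<..<d} (\<lambda>t. e (\<gamma> t))"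
      by blast
    define \<sigma> where "\<sigma> t = fst (\<gamma> t)" for t
    define x where "x t = snd (\<gamma> t)" for t
    have \<gamma>W: "0 \<le> \<sigma> t" "\<sigma> t \<le> 1" "x t \<in> X" "f (x t) = c + t" "slope_le C f X (x t) (\<sigma> t)" if "0 < t" "t < d" for t
      using \<gamma>(1)[of t] that d by (auto simp: W_def \<sigma>_def x_def)
    have \<sigma>_min: "\<sigma> t \<le> s"
      if "0 < t" "t < d" "v \<in> X" "f v = c + t" "0 \<le> s" "slope_le C f X v s" for t v s
    proof (cases "s \<le> 1")
      case True
      then show ?thesis using \<gamma>(2)[of t "(s, v)"] that d by (simp add: W_def \<sigma>_def)
    qed (use \<gamma>W(2)[of t] that in simp)
    obtain B where B: "\<And>v. v \<in> X \<Longrightarrow> norm v \<le> B"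
      using compact_imp_bounded[OF X'(1)] unfolding bounded_iff by blast
    have "\<exists>G B'. (\<forall>a b. 0 < a \<and> a \<le> b \<and> b < d \<longrightarrow> (\<Sum>i<?n. \<bar>coords (x b) ! i - coords (x a) ! i\<bar>) \<le> G b - G a) \<and>
      (\<forall>t. 0 < t \<and> t < d \<longrightarrow> \<bar>G t\<bar> \<le> B')"
    proof (rule monotone_total_variation[where x = "\<lambda>i t. coords (x t) ! i"])
      fix i assume i: "i \<in> {..<?n}"
      show "mono_on {0<..<d} (\<lambda>t. coords (x t) ! i) \<or> antimono_on {0<..<d} (\<lambda>t. coords (x t) ! i)"
        using mono[of "\<lambda>p. coords (snd p) ! i"] i by (auto simp: es_def x_def)
      fix t assume "0 < t" "t < d"
      then show "\<bar>coords (x t) ! i\<bar> \<le> B"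
        using i B[OF \<gamma>W(3)] component_le_norm_cart[of "x t"] by (auto simp: nth_coords intro: order_trans)
    qed simp
    then obtain G B' where G: "\<And>a b. 0 < a \<Longrightarrow> a \<le> b \<Longrightarrow> b < d \<Longrightarrow> (\<Sum>i<?n. \<bar>coords (x b) ! i - coords (x a) ! i\<bar>) \<le> G b - G a"
      and B': "\<And>t. 0 < t \<Longrightarrow> t < d \<Longrightarrow> \<bar>G t\<bar> \<le> B'" by blast
    have xG: "norm (x b - x a) \<le> G b - G a" if "0 < a" "a \<le> b" "b < d" for a b
      using norm_le_sum_coords[of "x b" "x a"] G[OF that] by linarith
    have G_mono: "G a \<le> G b" if "0 < a" "a \<le> b" "b < d" for a b
      using xG[OF that] norm_ge_zero[of "x b - x a"] by linarith
    \<comment> \<open>The curve is parametrized by the level, so \<open>q - p\<close> is exactly the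
      difference of the values of \<open>f\<close>. Testing the slope at \<open>x q\<close> against
      the point \<open>x p\<close> bounds it by increments of \<open>G\<close>.\<close>
    have key: "b - a \<le> s * (G b - G a)"
      if ab: "0 < a" "a < b" "b < d" and s: "\<And>t. a < t \<Longrightarrow> t \<le> b \<Longrightarrow> \<sigma> t \<le> s" for a b s
      using \<open>a < b\<close>
    proof (rule quadratic_error_vanishes[where C = C])
      show "mono_on {a..b} G" using G_mono ab by (intro mono_onI) auto
      show "0 \<le> s" using s[of b] \<gamma>W(1)[of b] ab by simp
      show "0 \<le> C" by fact
      fix p q assume pq: "a \<le> p" "p < q" "q \<le> b"
      have "q - p = f (x q) - f (x p)" using \<gamma>W(4)[of q] \<gamma>W(4)[of p] pq ab by simp
      also have "\<dots> \<le> \<sigma> q * norm (x q - x p) + C * (norm (x q - x p))\<^sup>2"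
        using \<gamma>W(5)[of q] \<gamma>W(3)[of p] pq ab by (simp add: slope_le_def)
      also have "\<dots> \<le> s * (G q - G p) + C * (G q - G p)\<^sup>2"
        using xG[of p q] pq ab s[of q] \<gamma>W(1)[of q] \<open>0 \<le> C\<close>
        by (intro add_mono mult_mono power_mono) auto
      finally show "q - p \<le> s * (G q - G p) + C * (G q - G p)\<^sup>2" .
    qed
    show ?thesis
    proof (cases "mono_on {0<..<d} \<sigma>")
      case True
      \<comment> \<open>With \<open>\<sigma>\<close> increasing, its maximum over the levels between
        \<open>a\<close> and \<open>b\<close> is \<open>\<sigma> b\<close>, which is at most the
        slope \<open>s\<close> of the given point on level \<open>b\<close>.\<close>
      have "b - a \<le> s * ((G b + b) - (G a + a))"
        if "0 < a" "a < b" "b < d" "v \<in> X" "f v = c + b" "0 \<le> s" "slope_le C f X v s" for a b v s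
      proof -
        have "\<sigma> b \<le> s" using \<sigma>_min[of b v s] that by simp
        moreover have "\<sigma> t \<le> \<sigma> b" if "a < t" "t \<le> b" for t
          using mono_onD[OF True, of t b] that \<open>0 < a\<close> \<open>b < d\<close> by simp
        ultimately have "b - a \<le> s * (G b - G a)"
          using that by (intro key) (auto intro: order_trans)
        also have "\<dots> \<le> s * ((G b + b) - (G a + a))" using that by (intro mult_left_mono) auto
        finally show ?thesis .
      qed
      moreover have "mono_on {0<..<d} (\<lambda>t. G t + t)"
        using G_mono by (intro mono_onI add_mono) auto
      moreover have "\<bar>G t + t\<bar> \<le> B' + d" if "0 < t" "t < d" for t
        using B'[OF that] that by linarith
      ultimately show ?thesis using d(1) by blast
    next
      case False
      then have anti: "antimono_on {0<..<d} \<sigma>" using mono[of fst] unfolding \<sigma>_def es_def by simp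
      define s0 where "s0 = \<sigma> (d / 2)"
      have ge: "\<sigma> t \<le> s0" if "d / 2 \<le> t" "t < d" for t
        using monotone_onD[OF anti, of "d / 2" t] that d by (simp add: s0_def)
      have le: "s0 \<le> \<sigma> t" if "0 < t" "t \<le> d / 2" for t
        using monotone_onD[OF anti, of t "d / 2"] that d by (simp add: s0_def)
      \<comment> \<open>If \<open>s0\<close> were 0, all levels beyond \<open>d / 2\<close> would
        contain points of slope 0, and \<open>key\<close> with \<open>s = 0\<close> would make an
        interval of levels have length 0.\<close>
      have s0: "0 < s0"
      proof (rule ccontr)
        assume "\<not> 0 < s0"
        then have "\<sigma> t \<le> 0" if "d / 2 < t" "t \<le> 3 * d / 4" for t
          using ge[of t] that d(1) by linarith
        then have "3 * d / 4 - d / 2 \<le> 0 * (G (3 * d / 4) - G (d / 2))"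
          using d(1) by (intro key) simp_all
        then show False using d(1) by simp
      qed
      \<comment> \<open>With \<open>\<sigma>\<close> decreasing, slopes stay above \<open>s0\<close>
        on all lower levels, and a linear \<open>\<Gamma>\<close> suffices.\<close>
      have "b - a \<le> s * (b / s0 - a / s0)"
        if "0 < a" "a < b" "b < d / 2" "v \<in> X" "f v = c + b" "0 \<le> s" "slope_le C f X v s" for a b v s
      proof -
        have "s0 \<le> s" using \<sigma>_min[of b v s] le[of b] that by simp
        then have "s0 * (b - a) \<le> s * (b - a)" using that by (intro mult_right_mono) auto
        then show ?thesis using s0 by (simp add: field_simps)
      qed
      moreover have "mono_on {0<..<d/2} (\<lambda>t. t / s0)"
        using s0 by (intro mono_onI divide_right_mono) auto
      moreover have "\<bar>t / s0\<bar> \<le> d / s0" if "0 < t" "t < d / 2" for t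
        using that s0 d by (simp add: divide_right_mono)
      ultimately show ?thesis using d(1) half_gt_zero[OF d(1)] by blast
    qed
  qed
qed

end

text \<open>The squared step is bounded by the decrease of \<open>r\<close>, and the decrease by the
  previous step times an increment of \<open>\<Gamma>\<close>. The inequality of arithmetic and
  geometric means makes this linear, and the increments of \<open>\<Gamma>\<close>
  telescope.\<close>

lemma summable_of_KL_descent:
  fixes r d :: "nat \<Rightarrow> real"
  assumes "0 < c" "0 \<le> L" and d: "\<And>k. 0 \<le> d k" and r: "\<And>k. 0 \<le> r k" "r \<longlonglongrightarrow> 0"
    and descent: "\<And>k. c * (d k)\<^sup>2 \<le> r k - r (Suc k)"
    and "0 < \<delta>" and mono: "mono_on {0<..<\<delta>} \<Gamma>" and bdd: "\<And>t. 0 < t \<Longrightarrow> t < \<delta> \<Longrightarrow> \<bar>\<Gamma> t\<bar> \<le> B"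
    and KL: "\<And>k a. 0 < a \<Longrightarrow> a < r (Suc k) \<Longrightarrow> r (Suc k) < \<delta> \<Longrightarrow>
      r (Suc k) - a \<le> L * d k * (\<Gamma> (r (Suc k)) - \<Gamma> a)"
  shows "summable d"
proof -
  have step: "r (Suc k) \<le> r k" for k
  proof -
    have "0 \<le> c * (d k)\<^sup>2" using \<open>0 < c\<close> by simp
    then show ?thesis using descent[of k] by linarith
  qed
  then have dec: "r j \<le> r i" if "i \<le> j" for i j
    using lift_Suc_antimono_le[of r] that by blast
  show ?thesis
  proof (cases "\<exists>N. r N = 0")
    case True
    then obtain N where N: "r N = 0" by blast
    have "d k = 0" if "k \<ge> N" for k
    proof -
      have "r k = 0" "r (Suc k) = 0" using dec[of N k] dec[of N "Suc k"] r(1)[of k] r(1)[of "Suc k"] that N by simp_all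
      then have "c * (d k)\<^sup>2 \<le> 0" using descent[of k] by simp
      then show ?thesis using \<open>0 < c\<close> by (simp add: mult_le_0_iff)
    qed
    then show ?thesis by (intro summable_finite[of "{..<N}"]) auto
  next
    case False
    then have pos: "0 < r k" for k using r(1)[of k] by (metis less_eq_real_def)
    obtain N where N: "\<And>k. k \<ge> N \<Longrightarrow> r k < \<delta>"
      using order_tendstoD(2)[OF r(2) \<open>0 < \<delta>\<close>] unfolding eventually_sequentially by blast
    define g where "g k = \<Gamma> (r k)" for k
    define M where "M = L / c"
    have M: "0 \<le> M" using \<open>0 < c\<close> \<open>0 \<le> L\<close> by (simp add: M_def)
    have g: "g (Suc k) \<le> g k" if "k \<ge> N" for k
      unfolding g_def using mono_onD[OF mono, of "r (Suc k)" "r k"] pos N[of k] N[of "Suc k"] step[of k] that by simp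
    \<comment> \<open>The indices are shifted: the slope at the iterate \<open>Suc k\<close> is
      measured by the step \<open>d k\<close> that led to it, while the decrease after it pays for
      the step \<open>d (Suc k)\<close>.\<close>
    have rec: "d (Suc k) \<le> (d k + M * (g (Suc k) - g (Suc (Suc k)))) / 2" if "k \<ge> N" for k
    proof -
      let ?D = "g (Suc k) - g (Suc (Suc k))"
      have "r (Suc k) - r (Suc (Suc k)) \<le> L * d k * ?D"
      proof (cases "r (Suc (Suc k)) < r (Suc k)")
        case True
        then show ?thesis using KL[of "r (Suc (Suc k))" k] pos N[of "Suc k"] that by (simp add: g_def)
      next
        case False
        then have "r (Suc (Suc k)) = r (Suc k)" using step[of "Suc k"] by simp
        then show ?thesis by (simp add: g_def)
      qed
      then have "c * (d (Suc k))\<^sup>2 \<le> L * d k * ?D" using descent[of "Suc k"] by linarith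
      then have 1: "(d (Suc k))\<^sup>2 \<le> d k * (M * ?D)"
      proof -
        have "(d (Suc k))\<^sup>2 \<le> L * d k * ?D / c"
          using \<open>0 < c\<close> \<open>c * (d (Suc k))\<^sup>2 \<le> L * d k * ?D\<close>
          by (simp only: pos_le_divide_eq mult.commute[of c])
        then show ?thesis by (simp add: M_def mult_ac)
      qed
      have "0 \<le> M * ?D" using M g[of "Suc k"] that by simp
      have "4 * (x * z) \<le> (x + z)\<^sup>2" for x z :: real
        using zero_le_power2[of "x - z"] by (simp add: power2_eq_square algebra_simps)
      from this[of "d k" "M * ?D"] 1 have "(d (Suc k))\<^sup>2 \<le> (d k + M * ?D)\<^sup>2 / 4" by linarith
      also have "\<dots> = ((d k + M * ?D) / 2)\<^sup>2" unfolding power_divide by simp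
      finally have "(d (Suc k))\<^sup>2 \<le> ((d k + M * ?D) / 2)\<^sup>2" .
      then show ?thesis
        by (rule power2_le_imp_le) (use \<open>0 \<le> M * ?D\<close> d[of k] in simp)
    qed
    define s where "s m = (\<Sum>j<m. d (N + j))" for m
    have tele: "(\<Sum>j<m. g (Suc (N + j)) - g (Suc (Suc (N + j)))) = g (Suc N) - g (Suc (N + m))" for m
      by (induction m) auto
    have s: "s m \<le> 2 * d N + 2 * M * B" for m
    proof -
      have "s (Suc m) = d N + (\<Sum>j<m. d (Suc (N + j)))"
        unfolding s_def by (subst sum.lessThan_Suc_shift) simp
      also have "(\<Sum>j<m. d (Suc (N + j))) \<le> (\<Sum>j<m. (d (N + j) + M * (g (Suc (N + j)) - g (Suc (Suc (N + j))))) / 2)"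
        by (intro sum_mono rec) simp
      also have "\<dots> = (s m + M * (g (Suc N) - g (Suc (N + m)))) / 2"
        unfolding tele[symmetric] s_def by (simp add: sum_divide_distrib[symmetric] sum.distrib sum_distrib_left)
      also have "M * (g (Suc N) - g (Suc (N + m))) \<le> M * (2 * B)"
        using bdd[OF pos N, of "Suc N"] bdd[OF pos N, of "Suc (N + m)"] M
        unfolding g_def by (intro mult_left_mono) auto
      finally have "s (Suc m) \<le> d N + (s m + 2 * M * B) / 2" by (simp add: mult_ac)
      moreover have "s m \<le> s (Suc m)" using d by (simp add: s_def)
      \<comment> \<open>Half of the partial sum on the right is absorbed on the left, which doubles
        the remaining terms.\<close>
      moreover have "x \<le> 2 * v + w" if "y \<le> v + (x + w) / 2" "x \<le> y" for v w x y :: real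
        using that by (simp add: field_simps)
      ultimately show ?thesis by blast
    qed
    have "summable (\<lambda>j. d (N + j))"
      using s d unfolding s_def by (intro summableI_nonneg_bounded) auto
    then show ?thesis using summable_iff_shift[of d N] by (simp add: add.commute)
  qed
qed

section \<open>Exponential families\<close>

text \<open>The remainder lies between 0 and \<open>a * (exp a - 1)\<close>; both bounds come from
  the tangent inequality \<open>1 + a \<le> exp a\<close>, taken at \<open>a\<close> and at
  \<open>- a\<close>.\<close>

lemma exp_remainder_le:
  fixes a :: real
  shows "\<bar>exp a - 1 - a\<bar> \<le> a\<^sup>2 * exp \<bar>a\<bar>"
proof -
  have 1: "1 + a \<le> exp a" by (rule exp_ge_add_one_self)
  have "(1 - a) * exp a \<le> exp (- a) * exp a"
    using exp_ge_add_one_self[of "- a"] by (intro mult_right_mono) auto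
  then have 2: "exp a - 1 \<le> a * exp a" by (simp add: algebra_simps exp_minus)
  have "exp a - 1 - a \<le> a * (exp a - 1)" using 2 by (simp add: algebra_simps)
  also have "\<dots> \<le> a\<^sup>2 * exp \<bar>a\<bar>"
  proof (cases "0 \<le> a")
    case True
    then have "a * (exp a - 1) \<le> a * (a * exp a)" using 2 by (rule mult_left_mono[rotated])
    then show ?thesis using True by (simp add: power2_eq_square)
  next
    case False
    then have "a * (exp a - 1) \<le> a * a" using 1 False by (intro mult_left_mono_neg) linarith+
    also have "\<dots> \<le> a * a * exp \<bar>a\<bar>" by (simp add: mult_le_cancel_left1)
    finally show ?thesis by (simp add: power2_eq_square)
  qed
  finally show ?thesis using 1 by linarith
qed

lemma norm_le_DIM_component:
  fixes x :: "'a::euclidean_space"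
  shows "\<exists>b\<in>Basis. norm x \<le> DIM('a) * \<bar>x \<bullet> b\<bar>"
proof (rule ccontr)
  assume "\<not> ?thesis"
  then have "(\<Sum>b\<in>Basis. \<bar>x \<bullet> b\<bar>) < real (card (Basis :: 'a set)) * (norm x / DIM('a))"
    by (intro sum_bounded_above_strict) (auto simp: field_simps not_le)
  then show False using norm_le_l1[of x] by simp
qed

text \<open>Interpreted twice in the final theorem, with the complete data measure and with the
  fibre measure, over the same interior of the parameter set. The last assumption excludes the zero
  measure and makes the partition function positive.\<close>

locale exponential_family =
  fixes m :: "'x measure" and T :: "'x \<Rightarrow> 'a::euclidean_space" and U :: "'a set"
  assumes T [measurable]: "T \<in> borel_measurable m"
    and U: "open U" "convex U"
    and integrable_U: "\<And>\<theta>. \<theta> \<in> U \<Longrightarrow> integrable m (\<lambda>x. exp (\<theta> \<bullet> T x))"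
    and nontrivial: "\<not> (AE x in m. False)"
begin

text \<open>Growth below every exponential of \<open>norm (T x)\<close>. The class contains the
  bounded measurable functions and the linear functions of \<open>T\<close>, is closed under sums
  and products, and is integrable against \<open>exp (\<theta> \<bullet> T x)\<close> at every
  parameter in \<open>U\<close>.\<close>

definition moderate :: "('x \<Rightarrow> real) \<Rightarrow> bool" where
  "moderate \<phi> \<longleftrightarrow> \<phi> \<in> borel_measurable m \<and> (\<forall>e>0. \<exists>C\<ge>0. \<forall>x. \<bar>\<phi> x\<bar> \<le> C * exp (e * norm (T x)))"

lemma moderateD: "moderate \<phi> \<Longrightarrow> \<phi> \<in> borel_measurable m"
  by (simp add: moderate_def)

lemma moderate_bounded:
  assumes "\<phi> \<in> borel_measurable m" "\<And>x. \<bar>\<phi> x\<bar> \<le> C"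
  shows "moderate \<phi>"
  unfolding moderate_def
proof (intro conjI allI impI exI)
  fix e :: real and x assume "e > 0"
  have "\<bar>\<phi> x\<bar> \<le> \<bar>C\<bar> * 1" using assms(2)[of x] by simp
  also have "\<dots> \<le> \<bar>C\<bar> * exp (e * norm (T x))" using \<open>e > 0\<close> by (intro mult_left_mono) auto
  finally show "\<bar>\<phi> x\<bar> \<le> \<bar>C\<bar> * exp (e * norm (T x))" .
qed (use assms in auto)

lemma moderate_const: "moderate (\<lambda>_. c)"
  by (rule moderate_bounded[of _ "\<bar>c\<bar>"]) auto

lemma moderate_inner: "moderate (\<lambda>x. v \<bullet> T x)"
  unfolding moderate_def
proof (intro conjI allI impI)
  fix e :: real assume e: "e > 0"
  have "\<bar>v \<bullet> T x\<bar> \<le> norm v / e * exp (e * norm (T x))" for x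
  proof -
    have "e * norm (T x) \<le> exp (e * norm (T x))"
      using exp_ge_add_one_self[of "e * norm (T x)"] by linarith
    then have "norm v / e * (e * norm (T x)) \<le> norm v / e * exp (e * norm (T x))"
      using e by (intro mult_left_mono) auto
    then show ?thesis using Cauchy_Schwarz_ineq2[of v "T x"] e by simp
  qed
  then show "\<exists>C\<ge>0. \<forall>x. \<bar>v \<bullet> T x\<bar> \<le> C * exp (e * norm (T x))"
    using e by (intro exI[of _ "norm v / e"]) auto
qed simp

lemma moderate_mult:
  assumes "moderate \<phi>" "moderate \<phi>'"
  shows "moderate (\<lambda>x. \<phi> x * \<phi>' x)"
  unfolding moderate_def
proof (intro conjI allI impI)
  fix e :: real assume e: "e > 0"
  then obtain C C' where C: "C \<ge> 0" "C' \<ge> 0" "\<And>x. \<bar>\<phi> x\<bar> \<le> C * exp (e / 2 * norm (T x))"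
    "\<And>x. \<bar>\<phi>' x\<bar> \<le> C' * exp (e / 2 * norm (T x))"
    using assms unfolding moderate_def by (meson half_gt_zero)
  have "\<bar>\<phi> x * \<phi>' x\<bar> \<le> C * C' * exp (e * norm (T x))" for x
  proof -
    have "\<bar>\<phi> x * \<phi>' x\<bar> \<le> (C * exp (e / 2 * norm (T x))) * (C' * exp (e / 2 * norm (T x)))"
      unfolding abs_mult using C by (intro mult_mono) auto
    also have "\<dots> = C * C' * (exp (e / 2 * norm (T x)) * exp (e / 2 * norm (T x)))" by simp
    also have "exp (e / 2 * norm (T x)) * exp (e / 2 * norm (T x)) = exp (e * norm (T x))"
      by (simp add: exp_add[symmetric])
    finally show ?thesis .
  qed
  then show "\<exists>C\<ge>0. \<forall>x. \<bar>\<phi> x * \<phi>' x\<bar> \<le> C * exp (e * norm (T x))"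
    using C by (intro exI[of _ "C * C'"]) auto
qed (intro borel_measurable_times moderateD[OF assms(1)] moderateD[OF assms(2)])

lemma moderate_add:
  assumes "moderate \<phi>" "moderate \<phi>'"
  shows "moderate (\<lambda>x. \<phi> x + \<phi>' x)"
  unfolding moderate_def
proof (intro conjI allI impI)
  fix e :: real assume e: "e > 0"
  then obtain C C' where C: "C \<ge> 0" "C' \<ge> 0" "\<And>x. \<bar>\<phi> x\<bar> \<le> C * exp (e * norm (T x))"
    "\<And>x. \<bar>\<phi>' x\<bar> \<le> C' * exp (e * norm (T x))"
    using assms unfolding moderate_def by meson
  have "\<bar>\<phi> x + \<phi>' x\<bar> \<le> (C + C') * exp (e * norm (T x))" for x
    using C(3)[of x] C(4)[of x] abs_triangle_ineq[of "\<phi> x" "\<phi>' x"] unfolding distrib_right by linarith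
  then show "\<exists>C\<ge>0. \<forall>x. \<bar>\<phi> x + \<phi>' x\<bar> \<le> C * exp (e * norm (T x))"
    using C by (intro exI[of _ "C + C'"]) auto
qed (intro borel_measurable_add moderateD[OF assms(1)] moderateD[OF assms(2)])

text \<open>Openness of \<open>U\<close> leaves room to shift \<theta> along the positive and
  negative coordinate directions. The shifted exponentials together dominate the extra factor, since
  some coordinate of \<open>T x\<close> is comparable to its norm.\<close>

lemma integrable_exp_norm:
  assumes "\<theta> \<in> U"
  shows "\<exists>e>0. integrable m (\<lambda>x. exp (\<theta> \<bullet> T x + e * norm (T x)))"
proof -
  obtain r where r: "r > 0" "ball \<theta> r \<subseteq> U" using U(1) assms open_contains_ball by blast
  let ?n = "real DIM('a)"
  \<comment> \<open>Some coordinate is at least the norm divided by the dimension, and a shift by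
    \<open>r / 2\<close> stays inside the ball; \<open>e\<close> is the resulting exponent.\<close>
  define e where "e = r / (2 * ?n)"
  have e: "e > 0" "e * ?n = r / 2" using r by (simp_all add: e_def)
  let ?g = "\<lambda>x. \<Sum>b\<in>Basis. exp ((\<theta> + (r / 2) *\<^sub>R b) \<bullet> T x) + exp ((\<theta> - (r / 2) *\<^sub>R b) \<bullet> T x)"
  have "\<theta> + (r / 2) *\<^sub>R b \<in> U" "\<theta> - (r / 2) *\<^sub>R b \<in> U" if "b \<in> Basis" for b
    using r that by (auto intro!: subsetD[OF r(2)] simp: dist_norm)
  then have g: "integrable m ?g"
    by (intro Bochner_Integration.integrable_sum Bochner_Integration.integrable_add integrable_U) auto
  have "integrable m (\<lambda>x. exp (\<theta> \<bullet> T x + e * norm (T x)))"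
  proof (rule Bochner_Integration.integrable_bound[OF g])
    show "AE x in m. norm (exp (\<theta> \<bullet> T x + e * norm (T x))) \<le> norm (?g x)"
    proof (intro AE_I2)
      fix x
      obtain b where b: "b \<in> Basis" "norm (T x) \<le> ?n * \<bar>T x \<bullet> b\<bar>"
        using norm_le_DIM_component by blast
      have "e * norm (T x) \<le> e * (?n * \<bar>T x \<bullet> b\<bar>)" using b(2) e(1) by (intro mult_left_mono) auto
      then have le: "e * norm (T x) \<le> r / 2 * \<bar>T x \<bullet> b\<bar>" using e(2) by (simp add: mult.assoc[symmetric])
      have "exp (\<theta> \<bullet> T x + e * norm (T x)) \<le> exp (\<theta> \<bullet> T x + r / 2 * \<bar>T x \<bullet> b\<bar>)"
        using le by simp
      also have "\<dots> \<le> exp ((\<theta> + (r / 2) *\<^sub>R b) \<bullet> T x) + exp ((\<theta> - (r / 2) *\<^sub>R b) \<bullet> T x)"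
        by (cases "0 \<le> T x \<bullet> b") (simp_all add: inner_add_left inner_diff_left inner_commute[of b])
      also have "\<dots> \<le> ?g x"
        using b(1) by (intro member_le_sum[where f = "\<lambda>b. exp ((\<theta> + (r / 2) *\<^sub>R b) \<bullet> T x) + exp ((\<theta> - (r / 2) *\<^sub>R b) \<bullet> T x)"]) (auto intro: add_nonneg_nonneg)
      finally show "norm (exp (\<theta> \<bullet> T x + e * norm (T x))) \<le> norm (?g x)"
        by (simp add: sum_nonneg add_nonneg_nonneg)
    qed
  qed simp
  then show ?thesis using e by blast
qed

lemma integrable_moderate:
  assumes "moderate \<phi>" "\<theta> \<in> U"
  shows "integrable m (\<lambda>x. \<phi> x * exp (\<theta> \<bullet> T x))"
proof -
  obtain e where e: "e > 0" "integrable m (\<lambda>x. exp (\<theta> \<bullet> T x + e * norm (T x)))"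
    using integrable_exp_norm[OF assms(2)] by blast
  obtain C where C: "C \<ge> 0" "\<And>x. \<bar>\<phi> x\<bar> \<le> C * exp (e * norm (T x))"
    using assms(1) e(1) unfolding moderate_def by blast
  show ?thesis
  proof (rule Bochner_Integration.integrable_bound)
    show "integrable m (\<lambda>x. C * exp (\<theta> \<bullet> T x + e * norm (T x)))"
      using e(2) by simp
    show "AE x in m. norm (\<phi> x * exp (\<theta> \<bullet> T x)) \<le> norm (C * exp (\<theta> \<bullet> T x + e * norm (T x)))"
    proof (intro AE_I2)
      fix x
      have "\<bar>\<phi> x\<bar> * exp (\<theta> \<bullet> T x) \<le> C * exp (e * norm (T x)) * exp (\<theta> \<bullet> T x)"
        using C(2) by (intro mult_right_mono) auto
      then show "norm (\<phi> x * exp (\<theta> \<bullet> T x)) \<le> norm (C * exp (\<theta> \<bullet> T x + e * norm (T x)))"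
        using C(1) by (simp add: abs_mult exp_add mult_ac)
    qed
  qed (use moderateD[OF assms(1)] in simp)
qed

definition moment :: "('x \<Rightarrow> real) \<Rightarrow> 'a \<Rightarrow> real" where
  "moment \<phi> \<theta> = (\<integral>x. \<phi> x * exp (\<theta> \<bullet> T x) \<partial>m)"

text \<open>Differentiation under the integral by a direct estimate: the remainder of the
  exponential is of order \<open>(norm h)\<^sup>2\<close> with an integrable factor, uniformly for
  small \<open>h\<close>.\<close>

lemma moment_has_derivative:
  assumes \<phi>: "moderate \<phi>" and \<theta>: "\<theta> \<in> U"
  shows "(moment \<phi> has_derivative (\<lambda>h. moment (\<lambda>x. \<phi> x * (h \<bullet> T x)) \<theta>)) (at \<theta>)"
proof -
  let ?D = "\<lambda>h. moment (\<lambda>x. \<phi> x * (h \<bullet> T x)) \<theta>"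
  have i1: "integrable m (\<lambda>x. \<phi> x * (h \<bullet> T x) * exp (\<theta> \<bullet> T x))" for h
    by (intro integrable_moderate moderate_mult moderate_inner \<phi> \<theta>)
  have lin: "bounded_linear ?D"
    unfolding linear_conv_bounded_linear[symmetric]
  proof (rule linearI)
    fix u v :: 'a and c :: real
    show "?D (u + v) = ?D u + ?D v"
      unfolding moment_def using i1[of u] i1[of v] by (simp add: inner_add_left algebra_simps)
    show "?D (c *\<^sub>R u) = c *\<^sub>R ?D u"
      unfolding moment_def by (simp add: mult.assoc mult.left_commute[of _ c])
  qed
  obtain e where e: "e > 0" "integrable m (\<lambda>x. exp (\<theta> \<bullet> T x + e * norm (T x)))"
    using integrable_exp_norm[OF \<theta>] by blast
  obtain r where r: "r > 0" "ball \<theta> r \<subseteq> U" using U(1) \<theta> open_contains_ball by blast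
  \<comment> \<open>Three factors \<open>exp (\<epsilon> * norm (T x))\<close> arise, from \<phi>,
    from the square of \<open>h \<bullet> T x\<close> and from the exponential in the remainder.
    Together they use up the available exponent \<open>e\<close>.\<close>
  define \<epsilon> where "\<epsilon> = e / 3"
  have "\<epsilon> > 0" using e by (simp add: \<epsilon>_def)
  then obtain C where C: "C \<ge> 0" "\<And>x. \<bar>\<phi> x\<bar> \<le> C * exp (\<epsilon> * norm (T x))"
    using \<phi> unfolding moderate_def by blast
  define J where "J = (\<integral>x. exp (\<theta> \<bullet> T x + e * norm (T x)) \<partial>m)"
  have bound: "norm (moment \<phi> (\<theta> + h) - moment \<phi> \<theta> - ?D h) \<le> (norm h)\<^sup>2 * (C * (4 / \<epsilon>\<^sup>2) * J)"
    if h: "norm h < r" "norm h < \<epsilon>" for h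
  proof -
    have "\<theta> + h \<in> U" using r(2) h(1) by (auto intro!: subsetD[OF r(2)] simp: dist_norm)
    then have i2: "integrable m (\<lambda>x. \<phi> x * exp ((\<theta> + h) \<bullet> T x))" "integrable m (\<lambda>x. \<phi> x * exp (\<theta> \<bullet> T x))"
      using integrable_moderate[OF \<phi>] \<theta> by auto
    let ?R = "\<lambda>x. \<phi> x * exp (\<theta> \<bullet> T x) * (exp (h \<bullet> T x) - 1 - h \<bullet> T x)"
    have R: "?R x = \<phi> x * exp ((\<theta> + h) \<bullet> T x) - \<phi> x * exp (\<theta> \<bullet> T x) - \<phi> x * (h \<bullet> T x) * exp (\<theta> \<bullet> T x)" for x
      by (simp add: inner_add_left exp_add algebra_simps)
    have "moment \<phi> (\<theta> + h) - moment \<phi> \<theta> - ?D h = (\<integral>x. ?R x \<partial>m)"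
      unfolding R moment_def using i1[of h] i2 by simp
    also have "norm \<dots> \<le> (\<integral>x. (norm h)\<^sup>2 * (C * (4 / \<epsilon>\<^sup>2)) * exp (\<theta> \<bullet> T x + e * norm (T x)) \<partial>m)"
    proof (rule order_trans[OF integral_norm_bound integral_mono])
      show "integrable m (\<lambda>x. norm (?R x))" unfolding R using i1[of h] i2 by (intro integrable_norm) simp
      show "integrable m (\<lambda>x. (norm h)\<^sup>2 * (C * (4 / \<epsilon>\<^sup>2)) * exp (\<theta> \<bullet> T x + e * norm (T x)))"
        using e(2) by simp
      fix x
      let ?t = "norm (T x)"
      have hT: "\<bar>h \<bullet> T x\<bar> \<le> norm h * ?t" by (rule Cauchy_Schwarz_ineq2)
      also have "\<dots> \<le> \<epsilon> * ?t" using h(2) by (intro mult_right_mono) auto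
      finally have 1: "exp \<bar>h \<bullet> T x\<bar> \<le> exp (\<epsilon> * ?t)" by simp
      have 2: "(h \<bullet> T x)\<^sup>2 \<le> (norm h)\<^sup>2 * ?t\<^sup>2"
        using power_mono[OF hT, of 2] by (simp add: power_mult_distrib)
      have "\<epsilon> / 2 * ?t \<le> exp (\<epsilon> / 2 * ?t)"
        using exp_ge_add_one_self[of "\<epsilon> / 2 * ?t"] by linarith
      then have "(\<epsilon> / 2 * ?t)\<^sup>2 \<le> (exp (\<epsilon> / 2 * ?t))\<^sup>2"
        using \<open>\<epsilon> > 0\<close> by (intro power_mono) auto
      also have "(exp (\<epsilon> / 2 * ?t))\<^sup>2 = exp (\<epsilon> * ?t)"
        by (simp add: power2_eq_square exp_add[symmetric])
      finally have "\<epsilon>\<^sup>2 * ?t\<^sup>2 \<le> 4 * exp (\<epsilon> * ?t)"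
        by (simp add: power_mult_distrib power_divide)
      then have 3: "?t\<^sup>2 \<le> 4 / \<epsilon>\<^sup>2 * exp (\<epsilon> * ?t)"
        using \<open>\<epsilon> > 0\<close> by (simp add: pos_le_divide_eq mult.commute)
      have "norm (?R x) = \<bar>\<phi> x\<bar> * exp (\<theta> \<bullet> T x) * \<bar>exp (h \<bullet> T x) - 1 - h \<bullet> T x\<bar>"
        by (simp add: abs_mult)
      also have "\<dots> \<le> (C * exp (\<epsilon> * ?t)) * exp (\<theta> \<bullet> T x) * ((h \<bullet> T x)\<^sup>2 * exp \<bar>h \<bullet> T x\<bar>)"
        using C by (intro mult_mono exp_remainder_le) auto
      also have "\<dots> \<le> (C * exp (\<epsilon> * ?t)) * exp (\<theta> \<bullet> T x) * (((norm h)\<^sup>2 * (4 / \<epsilon>\<^sup>2 * exp (\<epsilon> * ?t))) * exp (\<epsilon> * ?t))"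
        using C 1 by (intro mult_left_mono mult_mono order_trans[OF 2]) (use 3 in auto)
      also have "\<dots> = (norm h)\<^sup>2 * (C * (4 / \<epsilon>\<^sup>2)) * (exp (\<theta> \<bullet> T x) * (exp (\<epsilon> * ?t) * exp (\<epsilon> * ?t) * exp (\<epsilon> * ?t)))"
        by simp
      also have "exp (\<epsilon> * ?t) * exp (\<epsilon> * ?t) * exp (\<epsilon> * ?t) = exp (e * ?t)"
        by (simp add: exp_add[symmetric] \<epsilon>_def)
      finally show "norm (?R x) \<le> (norm h)\<^sup>2 * (C * (4 / \<epsilon>\<^sup>2)) * exp (\<theta> \<bullet> T x + e * ?t)"
        by (simp add: exp_add)
    qed
    also have "\<dots> = (norm h)\<^sup>2 * (C * (4 / \<epsilon>\<^sup>2) * J)"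
      unfolding J_def by simp
    finally show ?thesis .
  qed
  have "(\<lambda>h. norm (moment \<phi> (\<theta> + h) - moment \<phi> \<theta> - ?D h) / norm h) \<midarrow>0\<rightarrow> 0"
  proof (rule Lim_null_comparison)
    show "((\<lambda>h. norm h * (C * (4 / \<epsilon>\<^sup>2) * J)) \<longlongrightarrow> 0) (at (0::'a))"
      by (intro tendsto_mult_left_zero tendsto_norm_zero tendsto_ident_at)
    have "0 < min r \<epsilon>" using r \<open>\<epsilon> > 0\<close> by simp
    then have "\<forall>\<^sub>F h in at (0::'a). norm h < min r \<epsilon>"
      unfolding eventually_at dist_norm by fastforce
    then show "\<forall>\<^sub>F h in at 0. norm (norm (moment \<phi> (\<theta> + h) - moment \<phi> \<theta> - ?D h) / norm h) \<le> norm h * (C * (4 / \<epsilon>\<^sup>2) * J)"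
    proof (rule eventually_mono)
      fix h :: 'a assume "norm h < min r \<epsilon>"
      then have "norm (moment \<phi> (\<theta> + h) - moment \<phi> \<theta> - ?D h) \<le> (norm h)\<^sup>2 * (C * (4 / \<epsilon>\<^sup>2) * J)"
        using bound[of h] by simp
      then show "norm (norm (moment \<phi> (\<theta> + h) - moment \<phi> \<theta> - ?D h) / norm h) \<le> norm h * (C * (4 / \<epsilon>\<^sup>2) * J)"
        by (cases "h = 0") (simp_all add: divide_le_eq power2_eq_square mult_ac)
    qed
  qed
  then show ?thesis unfolding has_derivative_at using lin by blast
qed

lemma continuous_on_moment: "moderate \<phi> \<Longrightarrow> continuous_on U (moment \<phi>)"
  using moment_has_derivative has_derivative_continuous continuous_at_imp_continuous_on by blast

end

section \<open>Normalized means, covariances and second-order expansions\<close>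

context exponential_family
begin

definition Z :: "'a \<Rightarrow> real" where "Z = moment (\<lambda>_. 1)"

definition mean :: "('x \<Rightarrow> real) \<Rightarrow> 'a \<Rightarrow> real" where
  "mean \<phi> \<theta> = moment \<phi> \<theta> / Z \<theta>"

text \<open>By \<open>ln_Z_has_derivative\<close> and \<open>mean_has_derivative\<close> this is the
  Hessian of \<open>ln (Z \<theta>)\<close> as a bilinear form in \<open>u\<close> and
  \<open>v\<close>.\<close>

definition cov :: "'a \<Rightarrow> 'a \<Rightarrow> 'a \<Rightarrow> real" where
  "cov \<theta> u v = mean (\<lambda>x. (u \<bullet> T x) * (v \<bullet> T x)) \<theta> - mean (\<lambda>x. u \<bullet> T x) \<theta> * mean (\<lambda>x. v \<bullet> T x) \<theta>"

lemma Z_pos: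
  assumes "\<theta> \<in> U"
  shows "0 < Z \<theta>"
proof -
  have i: "integrable m (\<lambda>x. exp (\<theta> \<bullet> T x))" by (rule integrable_U[OF assms])
  have "0 \<le> Z \<theta>" unfolding Z_def moment_def by (intro integral_nonneg_AE) auto
  moreover have "Z \<theta> \<noteq> 0"
    using integral_nonneg_eq_0_iff_AE[OF i] nontrivial by (simp add: Z_def moment_def)
  ultimately show ?thesis by simp
qed

lemma continuous_on_mean:
  assumes "moderate \<phi>"
  shows "continuous_on U (mean \<phi>)"
proof -
  have "Z \<theta> \<noteq> 0" if "\<theta> \<in> U" for \<theta> using Z_pos[OF that] by simp
  moreover have "continuous_on U Z"
    unfolding Z_def by (rule continuous_on_moment[OF moderate_const])
  ultimately show ?thesis
    unfolding mean_def using assms by (intro continuous_on_divide continuous_on_moment) simp_all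
qed

lemma moment_add: "moderate \<phi> \<Longrightarrow> moderate \<phi>' \<Longrightarrow> \<theta> \<in> U \<Longrightarrow>
    moment (\<lambda>x. \<phi> x + \<phi>' x) \<theta> = moment \<phi> \<theta> + moment \<phi>' \<theta>"
  unfolding moment_def by (simp add: distrib_right integrable_moderate)

lemma moment_cmult: "moment (\<lambda>x. c * \<phi> x) \<theta> = c * moment \<phi> \<theta>"
  unfolding moment_def by (simp add: mult.assoc)

lemma mean_add: "moderate \<phi> \<Longrightarrow> moderate \<phi>' \<Longrightarrow> \<theta> \<in> U \<Longrightarrow>
    mean (\<lambda>x. \<phi> x + \<phi>' x) \<theta> = mean \<phi> \<theta> + mean \<phi>' \<theta>"
  by (simp add: mean_def moment_add add_divide_distrib)

lemma mean_cmult: "mean (\<lambda>x. c * \<phi> x) \<theta> = c * mean \<phi> \<theta>"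
  by (simp add: mean_def moment_cmult)

lemma mean_const: "\<theta> \<in> U \<Longrightarrow> mean (\<lambda>x. c) \<theta> = c"
  using mean_cmult[of c "\<lambda>_. 1" \<theta>] Z_pos[of \<theta>] by (simp add: mean_def Z_def)

lemma mean_cong_AE: "\<phi> \<in> borel_measurable m \<Longrightarrow> \<phi>' \<in> borel_measurable m \<Longrightarrow>
    (AE x in m. \<phi> x = \<phi>' x) \<Longrightarrow> mean \<phi> \<theta> = mean \<phi>' \<theta>"
  unfolding mean_def moment_def by (intro arg_cong2[where f = "(/)"] integral_cong_AE) auto

lemma linear_mean: "\<theta> \<in> U \<Longrightarrow> linear (\<lambda>v. mean (\<lambda>x. v \<bullet> T x) \<theta>)"
  by (rule linearI) (simp_all add: inner_add_left mean_add moderate_inner mean_cmult)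

lemma linear_cov: "\<theta> \<in> U \<Longrightarrow> linear (cov \<theta> u)"
  using linear_mean[of \<theta>]
  by (intro linearI) (simp_all add: cov_def inner_add_left distrib_left mean_add moderate_inner
      moderate_mult mean_cmult linear_add linear_cmul mult.left_commute[of _ "_ :: real"] right_diff_distrib)

lemma cov_commute: "cov \<theta> u v = cov \<theta> v u"
  by (simp add: cov_def mult.commute)

text \<open>Reduces joint continuity and uniform bounds to the finitely many functions
  \<open>cov \<theta> i j\<close> of \<theta> alone.\<close>

lemma cov_expand:
  assumes "\<theta> \<in> U"
  shows "cov \<theta> u v = (\<Sum>i\<in>Basis. \<Sum>j\<in>Basis. (u \<bullet> i) * (v \<bullet> j) * cov \<theta> i j)"
proof -
  have 1: "cov \<theta> u v = (\<Sum>j\<in>Basis. (v \<bullet> j) * cov \<theta> u j)" for u v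
  proof -
    have "cov \<theta> u v = cov \<theta> u (\<Sum>j\<in>Basis. (v \<bullet> j) *\<^sub>R j)" by (simp add: euclidean_representation)
    also have "\<dots> = (\<Sum>j\<in>Basis. (v \<bullet> j) * cov \<theta> u j)"
      using linear_cov[OF assms, of u] by (simp add: linear_sum linear_cmul)
    finally show ?thesis .
  qed
  have 2: "cov \<theta> u j = (\<Sum>i\<in>Basis. (u \<bullet> i) * cov \<theta> i j)" for j
  proof -
    have "cov \<theta> u j = cov \<theta> j u" by (rule cov_commute)
    also have "\<dots> = (\<Sum>i\<in>Basis. (u \<bullet> i) * cov \<theta> j i)" by (rule 1)
    also have "\<dots> = (\<Sum>i\<in>Basis. (u \<bullet> i) * cov \<theta> i j)"
      by (intro sum.cong refl arg_cong2[where f = "(*)"] cov_commute)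
    finally show ?thesis .
  qed
  have "cov \<theta> u v = (\<Sum>j\<in>Basis. (v \<bullet> j) * (\<Sum>i\<in>Basis. (u \<bullet> i) * cov \<theta> i j))"
    unfolding 2[symmetric] by (rule 1)
  also have "\<dots> = (\<Sum>j\<in>Basis. \<Sum>i\<in>Basis. (u \<bullet> i) * (v \<bullet> j) * cov \<theta> i j)"
    by (simp add: sum_distrib_left mult_ac)
  finally show ?thesis by (subst sum.swap)
qed

lemma continuous_on_cov: "continuous_on U (\<lambda>\<theta>. cov \<theta> u v)"
  unfolding cov_def
  by (intro continuous_intros continuous_on_mean moderate_mult moderate_inner)

lemma variance_eq:
  assumes "\<theta> \<in> U"
  shows "cov \<theta> v v = mean (\<lambda>x. (v \<bullet> T x - mean (\<lambda>x. v \<bullet> T x) \<theta>) * (v \<bullet> T x - mean (\<lambda>x. v \<bullet> T x) \<theta>)) \<theta>"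
proof -
  define a where "a = mean (\<lambda>x. v \<bullet> T x) \<theta>"
  have "(v \<bullet> T x - a) * (v \<bullet> T x - a) = ((v \<bullet> T x) * (v \<bullet> T x) + (- 2 * a) * (v \<bullet> T x)) + a * a" for x
    by (simp add: algebra_simps)
  then have "mean (\<lambda>x. (v \<bullet> T x - a) * (v \<bullet> T x - a)) \<theta>
    = mean (\<lambda>x. ((v \<bullet> T x) * (v \<bullet> T x) + (- 2 * a) * (v \<bullet> T x)) + a * a) \<theta>" by presburger
  also have "\<dots> = mean (\<lambda>x. (v \<bullet> T x) * (v \<bullet> T x) + (- 2 * a) * (v \<bullet> T x)) \<theta> + mean (\<lambda>_. a * a) \<theta>"
    by (intro mean_add moderate_add moderate_mult moderate_inner moderate_const assms)
  also have "mean (\<lambda>x. (v \<bullet> T x) * (v \<bullet> T x) + (- 2 * a) * (v \<bullet> T x)) \<theta>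
    = mean (\<lambda>x. (v \<bullet> T x) * (v \<bullet> T x)) \<theta> + mean (\<lambda>x. (- 2 * a) * (v \<bullet> T x)) \<theta>"
    by (intro mean_add moderate_mult moderate_inner moderate_const assms)
  finally have "mean (\<lambda>x. (v \<bullet> T x - a) * (v \<bullet> T x - a)) \<theta>
    = mean (\<lambda>x. (v \<bullet> T x) * (v \<bullet> T x)) \<theta> + (- 2 * a) * a + a * a"
    by (simp only: mean_cmult mean_const[OF assms] a_def)
  then show ?thesis by (simp add: cov_def a_def[symmetric])
qed

lemma variance_nonneg: "\<theta> \<in> U \<Longrightarrow> 0 \<le> cov \<theta> v v"
  unfolding variance_eq unfolding mean_def moment_def
  using Z_pos[of \<theta>] by (intro divide_nonneg_pos integral_nonneg_AE) auto

lemma variance_zero: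
  assumes "\<theta> \<in> U" "cov \<theta> v v = 0"
  shows "AE x in m. v \<bullet> T x = mean (\<lambda>x. v \<bullet> T x) \<theta>"
proof -
  define a where "a = mean (\<lambda>x. v \<bullet> T x) \<theta>"
  have "moderate (\<lambda>x. v \<bullet> T x + - a)"
    by (intro moderate_add moderate_inner moderate_const)
  then have mod: "moderate (\<lambda>x. v \<bullet> T x - a)" by simp
  have i: "integrable m (\<lambda>x. (v \<bullet> T x - a) * (v \<bullet> T x - a) * exp (\<theta> \<bullet> T x))"
    by (intro integrable_moderate moderate_mult mod assms)
  have "(\<integral>x. (v \<bullet> T x - a) * (v \<bullet> T x - a) * exp (\<theta> \<bullet> T x) \<partial>m) = 0"
    using variance_eq[OF assms(1), of v] assms(2) Z_pos[OF assms(1)]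
    by (simp add: a_def mean_def moment_def)
  then have "AE x in m. (v \<bullet> T x - a) * (v \<bullet> T x - a) * exp (\<theta> \<bullet> T x) = 0"
    using integral_nonneg_eq_0_iff_AE[OF i] by simp
  then show ?thesis by (rule AE_mp) (auto simp: a_def)
qed

lemma cov_AE_const:
  assumes \<theta>: "\<theta> \<in> U" and c: "AE x in m. w \<bullet> T x = c"
  shows "cov \<theta> u w = 0"
proof -
  have "mean (\<lambda>x. w \<bullet> T x) \<theta> = mean (\<lambda>_. c) \<theta>"
    by (rule mean_cong_AE) (use c in auto)
  moreover have "mean (\<lambda>x. (u \<bullet> T x) * (w \<bullet> T x)) \<theta> = mean (\<lambda>x. c * (u \<bullet> T x)) \<theta>"
    by (rule mean_cong_AE) (use c in auto)
  ultimately show ?thesis by (simp add: cov_def mean_cmult mean_const \<theta>)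
qed

lemma ln_Z_has_derivative:
  assumes "\<theta> \<in> U"
  shows "((\<lambda>\<theta>. ln (Z \<theta>)) has_derivative (\<lambda>h. mean (\<lambda>x. h \<bullet> T x) \<theta>)) (at \<theta>)"
proof -
  have "(Z has_derivative (\<lambda>h. moment (\<lambda>x. h \<bullet> T x) \<theta>)) (at \<theta>)"
    using moment_has_derivative[OF moderate_const[of 1] assms] by (simp add: Z_def)
  then show ?thesis
    using Z_pos[OF assms] by (auto intro!: derivative_eq_intros simp: mean_def field_simps)
qed

lemma mean_has_derivative:
  assumes "\<theta> \<in> U"
  shows "(mean (\<lambda>x. v \<bullet> T x) has_derivative (\<lambda>h. cov \<theta> v h)) (at \<theta>)"
proof -
  have "(Z has_derivative (\<lambda>h. moment (\<lambda>x. h \<bullet> T x) \<theta>)) (at \<theta>)"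
    using moment_has_derivative[OF moderate_const[of 1] assms] by (simp add: Z_def)
  moreover have "(moment (\<lambda>x. v \<bullet> T x) has_derivative (\<lambda>h. moment (\<lambda>x. (v \<bullet> T x) * (h \<bullet> T x)) \<theta>)) (at \<theta>)"
    by (rule moment_has_derivative[OF moderate_inner assms])
  ultimately show ?thesis
    unfolding mean_def[abs_def] using Z_pos[OF assms]
    by (auto intro!: derivative_eq_intros simp: cov_def mean_def field_simps power2_eq_square)
qed

lemma segment_in_U:
  assumes "x \<in> U" "t \<in> U" "0 \<le> s" "s \<le> 1"
  shows "x + s *\<^sub>R (t - x) \<in> U"
proof -
  have "(1 - s) *\<^sub>R x + s *\<^sub>R t \<in> U" using U(2) assms by (intro convexD) auto
  then show ?thesis by (simp add: algebra_simps)
qed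

lemma mean_diff_eq_cov:
  assumes "x \<in> U" "t \<in> U"
  shows "\<exists>\<xi>\<in>closed_segment x t. mean (\<lambda>y. w \<bullet> T y) t - mean (\<lambda>y. w \<bullet> T y) x = cov \<xi> w (t - x)"
proof -
  let ?g = "\<lambda>s. mean (\<lambda>y. w \<bullet> T y) (x + s *\<^sub>R (t - x))"
  have "DERIV ?g s :> cov (x + s *\<^sub>R (t - x)) w (t - x)" if "0 \<le> s" "s \<le> 1" for s
  proof -
    have s: "x + s *\<^sub>R (t - x) \<in> U" by (rule segment_in_U) (use assms that in auto)
    have "((\<lambda>s. x + s *\<^sub>R (t - x)) has_derivative (\<lambda>h. h *\<^sub>R (t - x))) (at s)"
      by (auto intro!: derivative_eq_intros)
    from has_derivative_compose[OF this mean_has_derivative[OF s, of w]]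
    show ?thesis
      by (simp add: has_field_derivative_def linear_cmul[OF linear_cov[OF s]] mult.commute[of _ "cov _ _ _"])
  qed
  then obtain s where "0 < s" "s < 1" "?g 1 - ?g 0 = (1 - 0) * cov (x + s *\<^sub>R (t - x)) w (t - x)"
    using MVT2[of 0 1 ?g "\<lambda>s. cov (x + s *\<^sub>R (t - x)) w (t - x)"] by auto
  then show ?thesis
    by (intro bexI[of _ "x + s *\<^sub>R (t - x)"]) (auto simp: in_segment algebra_simps intro!: exI[of _ s])
qed

text \<open>Lagrange form of the Bregman divergence of \<open>ln (Z \<theta>)\<close>: it equals
  half the variance of the increment at an intermediate parameter, so bounds on \<open>cov\<close>
  are bounds on the divergence.\<close>

lemma ln_Z_Taylor:
  assumes "x \<in> U" "t \<in> U"
  shows "\<exists>\<xi>\<in>closed_segment x t. ln (Z t) = ln (Z x) + mean (\<lambda>y. (t - x) \<bullet> T y) x + cov \<xi> (t - x) (t - x) / 2"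
proof -
  let ?v = "t - x"
  let ?p = "\<lambda>s. x + s *\<^sub>R ?v"
  define diff where "diff k = (if k = 0 then (\<lambda>s. ln (Z (?p s))) else if k = 1 then (\<lambda>s. mean (\<lambda>y. ?v \<bullet> T y) (?p s))
    else (\<lambda>s. cov (?p s) ?v ?v))" for k :: nat
  have p: "(?p has_derivative (\<lambda>h. h *\<^sub>R ?v)) (at s)" for s
    by (auto intro!: derivative_eq_intros)
  have d: "DERIV (diff k) s :> diff (Suc k) s" if "k < 2" "0 \<le> s" "s \<le> 1" for k s
  proof -
    have s: "?p s \<in> U" by (rule segment_in_U) (use assms that in auto)
    consider "k = 0" | "k = 1" using \<open>k < 2\<close> by linarith
    then show ?thesis
    proof cases
      case 1
      from has_derivative_compose[OF p ln_Z_has_derivative[OF s]]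
      show ?thesis using linear_cmul[OF linear_mean[OF s]] 1
        by (simp add: diff_def has_field_derivative_def mean_cmult mult.commute[of _ "mean _ _"])
    next
      case 2
      from has_derivative_compose[OF p mean_has_derivative[OF s, of ?v]]
      show ?thesis using 2
        by (simp add: diff_def has_field_derivative_def linear_cmul[OF linear_cov[OF s]] mult.commute[of _ "cov _ _ _"])
    qed
  qed
  have "\<exists>s>0. s < 1 \<and> diff 0 1 = (\<Sum>k<2. diff k 0 / fact k * (1 - 0) ^ k) + diff 2 s / fact 2 * (1 - 0) ^ 2"
    by (rule Taylor_up[of 2 diff "diff 0" 0 1 0]) (use d in auto)
  then obtain s where "0 < s" "s < 1" "ln (Z t) = ln (Z x) + mean (\<lambda>y. ?v \<bullet> T y) x + cov (?p s) ?v ?v / 2"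
    by (auto simp: diff_def numeral_2_eq_2)
  then show ?thesis
    by (intro bexI[of _ "?p s"]) (auto simp: in_segment algebra_simps intro!: exI[of _ s])
qed

lemma cov_bound:
  assumes K: "compact K" "K \<subseteq> U"
  shows "\<exists>L\<ge>0. \<forall>\<theta>\<in>K. \<forall>u v. \<bar>cov \<theta> u v\<bar> \<le> L * norm u * norm v"
proof -
  have "\<exists>M\<ge>0. \<forall>\<theta>\<in>K. \<bar>cov \<theta> i j\<bar> \<le> M" for i j
  proof -
    have "compact ((\<lambda>\<theta>. cov \<theta> i j) ` K)"
      using continuous_on_subset[OF continuous_on_cov K(2)] K(1) by (rule compact_continuous_image)
    then obtain M where "\<forall>\<theta>\<in>K. \<bar>cov \<theta> i j\<bar> \<le> M"
      by (auto dest!: compact_imp_bounded simp: bounded_iff)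
    then show ?thesis by (intro exI[of _ "\<bar>M\<bar>"]) auto
  qed
  then obtain M where M: "\<And>i j. 0 \<le> M i j" "\<And>i j \<theta>. \<theta> \<in> K \<Longrightarrow> \<bar>cov \<theta> i j\<bar> \<le> M i j"
    by metis
  define L where "L = (\<Sum>i\<in>Basis. \<Sum>j\<in>Basis. M i j)"
  have "\<bar>cov \<theta> u v\<bar> \<le> L * norm u * norm v" if "\<theta> \<in> K" for \<theta> u v
  proof -
    have "\<bar>cov \<theta> u v\<bar> \<le> (\<Sum>i\<in>Basis. \<Sum>j\<in>Basis. \<bar>(u \<bullet> i) * (v \<bullet> j) * cov \<theta> i j\<bar>)"
      using that K(2) by (subst cov_expand) (auto intro!: order_trans[OF sum_abs] sum_mono)
    also have "\<dots> \<le> (\<Sum>i\<in>Basis. \<Sum>j\<in>Basis. norm u * norm v * M i j)"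
      unfolding abs_mult using M that by (intro sum_mono mult_mono Basis_le_norm) auto
    also have "\<dots> = L * norm u * norm v"
      by (simp add: L_def sum_distrib_left[symmetric] mult_ac)
    finally show ?thesis .
  qed
  moreover have "0 \<le> L" unfolding L_def by (intro sum_nonneg M)
  ultimately show ?thesis by blast
qed

text \<open>A vanishing variance would make \<open>v \<bullet> T x\<close> constant almost
  everywhere. Hence the variance is positive on the compact product of \<open>K\<close> with the
  unit sphere of \<open>V\<close>, attains a positive minimum there, and scales quadratically in
  \<open>v\<close>.\<close>

lemma variance_lower_bound:
  assumes K: "compact K" "K \<subseteq> U" and V: "subspace V"
    and nonconst: "\<And>v c. v \<in> V \<Longrightarrow> v \<noteq> 0 \<Longrightarrow> \<not> (AE x in m. v \<bullet> T x = c)"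
  shows "\<exists>c>0. \<forall>\<theta>\<in>K. \<forall>v\<in>V. c * (norm v)\<^sup>2 \<le> cov \<theta> v v"
proof -
  let ?Q = "K \<times> (V \<inter> sphere 0 1)"
  have Q: "compact ?Q"
    by (intro compact_Times K(1) closed_Int_compact closed_subspace V compact_sphere)
  have pos: "0 < cov \<theta> v v" if "\<theta> \<in> K" "v \<in> V" "v \<noteq> 0" for \<theta> v
    using variance_nonneg[of \<theta> v] variance_zero[of \<theta> v] nonconst[OF that(2,3)] that K(2)
    by (metis less_eq_real_def subsetD)
  have "\<exists>c>0. \<forall>p\<in>?Q. c \<le> cov (fst p) (snd p) (snd p)"
  proof (cases "?Q = {}")
    case True
    then show ?thesis by (intro exI[of _ 1]) auto
  next
    case False
    have "continuous_on ?Q (\<lambda>p. \<Sum>i\<in>Basis. \<Sum>j\<in>Basis. (snd p \<bullet> i) * (snd p \<bullet> j) * cov (fst p) i j)"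
      by (intro continuous_intros continuous_on_compose2[OF continuous_on_cov]) (use K(2) in auto)
    then have "continuous_on ?Q (\<lambda>p. cov (fst p) (snd p) (snd p))"
      by (rule continuous_on_eq) (use K(2) in \<open>auto simp: cov_expand[symmetric]\<close>)
    from continuous_attains_inf[OF Q False this]
    obtain p where p: "p \<in> ?Q" "\<forall>q\<in>?Q. cov (fst p) (snd p) (snd p) \<le> cov (fst q) (snd q) (snd q)" by blast
    then have "0 < cov (fst p) (snd p) (snd p)" by (intro pos) auto
    then show ?thesis using p(2) by blast
  qed
  then obtain c where c: "c > 0" "\<And>\<theta> v. \<theta> \<in> K \<Longrightarrow> v \<in> V \<Longrightarrow> norm v = 1 \<Longrightarrow> c \<le> cov \<theta> v v"
    by (force simp: dist_norm)
  have "c * (norm v)\<^sup>2 \<le> cov \<theta> v v" if "\<theta> \<in> K" "v \<in> V" for \<theta> v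
  proof (cases "v = 0")
    case True
    then show ?thesis using variance_nonneg[of \<theta> v] that K(2) by auto
  next
    case False
    let ?u = "v /\<^sub>R norm v"
    have \<theta>: "\<theta> \<in> U" using that K(2) by blast
    have u: "v = norm v *\<^sub>R ?u" using False by simp
    have "c \<le> cov \<theta> ?u ?u" using that False V by (intro c(2)) (auto intro: subspace_scale)
    then have "c * (norm v)\<^sup>2 \<le> cov \<theta> ?u ?u * (norm v)\<^sup>2" by (rule mult_right_mono) simp
    also have "\<dots> = norm v * (norm v * cov \<theta> ?u ?u)" by (simp add: power2_eq_square)
    also have "norm v * cov \<theta> ?u ?u = cov \<theta> ?u v"
      using linear_cmul[OF linear_cov[OF \<theta>], of ?u "norm v" ?u] u by simp
    also have "\<dots> = cov \<theta> v ?u" by (rule cov_commute)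
    also have "norm v * \<dots> = cov \<theta> v v"
      using linear_cmul[OF linear_cov[OF \<theta>], of v "norm v" ?u] u by simp
    finally show ?thesis .
  qed
  then show ?thesis using c(1) by blast
qed

end

section \<open>Orthogonal projections\<close>

context
  fixes V :: "'a::euclidean_space set"
  assumes V: "subspace V"
begin

lemma orth_proj_unique:
  assumes "p \<in> V" "\<And>v. v \<in> V \<Longrightarrow> (x - p) \<bullet> v = 0"
  shows "orth_proj V x = p"
  unfolding orth_proj_def
proof (rule the_equality)
  show "p \<in> V \<and> (\<forall>v\<in>V. orthogonal (x - p) v)" using assms by (simp add: orthogonal_def)
  fix p' assume p': "p' \<in> V \<and> (\<forall>v\<in>V. orthogonal (x - p') v)"
  have "p - p' \<in> V" using p' assms(1) V by (simp add: subspace_diff)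
  then have "(x - p') \<bullet> (p - p') = 0" "(x - p) \<bullet> (p - p') = 0"
    using p' assms(2) by (auto simp: orthogonal_def)
  then have "(p - p') \<bullet> (p - p') = 0" by (simp add: inner_diff_left)
  then show "p' = p" by simp
qed

lemma
  shows orth_proj_in: "orth_proj V x \<in> V"
    and orth_proj_orthogonal: "v \<in> V \<Longrightarrow> (x - orth_proj V x) \<bullet> v = 0"
proof -
  obtain p z where pz: "p \<in> span V" "\<And>w. w \<in> span V \<Longrightarrow> orthogonal z w" "x = p + z"
    using orthogonal_subspace_decomp_exists[of V x] by blast
  have sp: "span V = V" using V by (simp add: span_eq_iff)
  have p: "p \<in> V" "\<And>v. v \<in> V \<Longrightarrow> (x - p) \<bullet> v = 0"
    using pz unfolding sp by (simp_all add: orthogonal_def)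
  from orth_proj_unique[OF this] have "orth_proj V x = p" .
  with p show "orth_proj V x \<in> V" "v \<in> V \<Longrightarrow> (x - orth_proj V x) \<bullet> v = 0" by simp_all
qed

lemma linear_orth_proj: "linear (orth_proj V)"
proof (rule linearI)
  fix x y :: 'a and c :: real
  show "orth_proj V (x + y) = orth_proj V x + orth_proj V y"
  proof (rule orth_proj_unique)
    fix v assume v: "v \<in> V"
    have "(x + y - (orth_proj V x + orth_proj V y)) \<bullet> v
      = (x - orth_proj V x) \<bullet> v + (y - orth_proj V y) \<bullet> v" by (simp add: algebra_simps)
    then show "(x + y - (orth_proj V x + orth_proj V y)) \<bullet> v = 0"
      using orth_proj_orthogonal[OF v] by simp
  qed (intro subspace_add V orth_proj_in)
  show "orth_proj V (c *\<^sub>R x) = c *\<^sub>R orth_proj V x"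
  proof (rule orth_proj_unique)
    fix v assume v: "v \<in> V"
    have "(c *\<^sub>R x - c *\<^sub>R orth_proj V x) \<bullet> v = c * ((x - orth_proj V x) \<bullet> v)"
      by (simp add: algebra_simps)
    then show "(c *\<^sub>R x - c *\<^sub>R orth_proj V x) \<bullet> v = 0"
      using orth_proj_orthogonal[OF v] by simp
  qed (intro subspace_scale V orth_proj_in)
qed

lemma orth_proj_self_adjoint: "orth_proj V x \<bullet> y = x \<bullet> orth_proj V y"
proof -
  have "(x - orth_proj V x) \<bullet> orth_proj V y = 0" "(y - orth_proj V y) \<bullet> orth_proj V x = 0"
    by (intro orth_proj_orthogonal orth_proj_in)+
  then have "x \<bullet> orth_proj V y = orth_proj V x \<bullet> orth_proj V y"
    "y \<bullet> orth_proj V x = orth_proj V y \<bullet> orth_proj V x" by (simp_all add: inner_diff_left)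
  then show ?thesis by (metis inner_commute)
qed

lemma norm_orth_proj_le: "norm (orth_proj V x) \<le> norm x"
proof -
  have "(norm (orth_proj V x))\<^sup>2 = x \<bullet> orth_proj V x"
    using orth_proj_orthogonal[OF orth_proj_in, of x x]
    by (simp add: power2_norm_eq_inner inner_diff_left)
  also have "\<dots> \<le> norm x * norm (orth_proj V x)" by (rule norm_cauchy_schwarz)
  finally show ?thesis
    by (cases "orth_proj V x = 0") (simp_all add: power2_eq_square)
qed

end

section \<open>Sequences and compact sets\<close>

text \<open>Meant for a sequence that need not converge itself, while all its accumulation points
  look the same to \<open>F\<close>.\<close>

lemma tendsto_of_accumulation_points:
  fixes s :: "nat \<Rightarrow> 'a::metric_space" and F :: "'a \<Rightarrow> 'b::metric_space"
  assumes C: "compact C" "\<And>k. s k \<in> C" and F: "continuous_on C F"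
    and acc: "\<And>a. accumulation_point s a \<Longrightarrow> F a = l"
  shows "(\<lambda>k. F (s k)) \<longlonglongrightarrow> l"
proof (rule ccontr)
  assume "\<not> ?thesis"
  then obtain e where e: "e > 0" "\<not> (\<forall>\<^sub>F k in sequentially. dist (F (s k)) l < e)"
    unfolding tendsto_iff by blast
  then have "infinite {k. \<not> dist (F (s k)) l < e}"
    unfolding eventually_sequentially infinite_nat_iff_unbounded_le by auto
  then obtain r :: "nat \<Rightarrow> nat" where r: "strict_mono r" "\<And>n. \<not> dist (F (s (r n))) l < e"
    using infinite_enumerate by blast
  obtain a r' where a: "a \<in> C" "strict_mono r'" "((s \<circ> r) \<circ> r') \<longlonglongrightarrow> a"
    using C unfolding compact_def by (metis comp_apply)
  have "accumulation_point s a"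
    unfolding accumulation_point_def
    by (intro exI[of _ "r \<circ> r'"] conjI strict_mono_o r a) (use a(3) in \<open>simp add: comp_assoc\<close>)
  then have "F a = l" by (rule acc)
  moreover have "(\<lambda>n. F (((s \<circ> r) \<circ> r') n)) \<longlonglongrightarrow> F a"
    using F a C(2) by (intro continuous_on_tendsto_compose[OF F a(3) a(1)]) auto
  ultimately have "\<forall>\<^sub>F n in sequentially. dist (F (s (r (r' n)))) l < e"
    using e(1) by (auto dest: tendstoD)
  then obtain n where "dist (F (s (r (r' n)))) l < e"
    using eventually_happens'[OF sequentially_bot] by blast
  then show False using r(2) by blast
qed

lemma closure_range_cases:
  fixes s :: "nat \<Rightarrow> 'a::metric_space"
  assumes "a \<in> closure (range s)"
  shows "a \<in> range s \<or> accumulation_point s a"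
  using assms islimpt_range_imp_convergent_subsequence[of a s]
  unfolding closure_def accumulation_point_def by blast

text \<open>Replaces a compact set of unknown complexity by a slightly larger one that is definable,
  still compact and still inside \<open>U\<close>.\<close>

lemma compact_subset_finite_cboxes:
  fixes C U :: "'a::euclidean_space set"
  assumes "compact C" "open U" "C \<subseteq> U"
  shows "\<exists>I. finite I \<and> C \<subseteq> (\<Union>(a, b)\<in>I. cbox a b) \<and> (\<Union>(a, b)\<in>I. cbox a b) \<subseteq> U"
proof -
  define B where "B = {(a, b). cbox a b \<subseteq> U}"
  have "C \<subseteq> (\<Union>p\<in>B. box (fst p) (snd p))"
  proof
    fix x assume "x \<in> C"
    then have "x \<in> U" using assms(3) by blast
    then obtain a b where "cbox a b \<subseteq> U" "x \<in> box a b"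
      using open_contains_cbox[OF assms(2)] by metis
    then show "x \<in> (\<Union>p\<in>B. box (fst p) (snd p))"
      by (intro UN_I[of "(a, b)"]) (simp_all add: B_def)
  qed
  then obtain I where I: "I \<subseteq> B" "finite I" "C \<subseteq> (\<Union>p\<in>I. box (fst p) (snd p))"
    using compactE_image[OF assms(1), of B "\<lambda>p. box (fst p) (snd p)"] open_box by metis
  show ?thesis
  proof (intro exI[of _ I] conjI I(2))
    show "C \<subseteq> (\<Union>(a, b)\<in>I. cbox a b)"
    proof
      fix x assume "x \<in> C"
      then obtain p where "p \<in> I" "x \<in> box (fst p) (snd p)" using I(3) by blast
      then show "x \<in> (\<Union>(a, b)\<in>I. cbox a b)"
        using box_subset_cbox[of "fst p" "snd p"] by (intro UN_I[of p]) (auto simp: case_prod_beta)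
    qed
    show "(\<Union>(a, b)\<in>I. cbox a b) \<subseteq> U" using I(1) unfolding B_def by blast
  qed
qed

context o_minimal_structure
begin

lemma definable_cbox:
  fixes a b :: "real ^ 'n::finite"
  shows "coords ` cbox a b \<in> S CARD('n)"
proof -
  have "definable_pred S CARD('n) (\<lambda>xs. \<forall>i<CARD('n). coords a ! i \<le> xs ! i \<and> xs ! i \<le> coords b ! i)"
    by (intro definable_pred_all_less definable_pred_conj definable_pred_le poly_funs.const poly_funs.coord)
  moreover have "{xs. length xs = CARD('n) \<and> (\<forall>i<CARD('n). coords a ! i \<le> xs ! i \<and> xs ! i \<le> coords b ! i)}
    = coords ` cbox a b" (is "?l = ?r")
  proof
    have ix: "\<exists>i<CARD('n). j = from_nat_into UNIV i" for j :: 'n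
    proof -
      have "j \<in> from_nat_into UNIV ` {..<CARD('n)}"
        by (simp add: bij_betw_imp_surj_on[OF bij_coord_index])
      then show ?thesis by blast
    qed
    show "?l \<subseteq> ?r"
    proof
      fix xs assume xs: "xs \<in> ?l"
      define v :: "real ^ 'n" where "v = (\<chi> j. xs ! (inv_into {..<CARD('n)} (from_nat_into UNIV) j))"
      have v: "v $ from_nat_into UNIV i = xs ! i" if "i < CARD('n)" for i
        using that bij_betw_inv_into_left[OF bij_coord_index[where 'n = 'n]] by (simp add: v_def)
      have "coords v = xs" using xs v by (intro nth_equalityI) (auto simp: nth_coords)
      moreover have "v \<in> cbox a b"
        unfolding mem_box_cart
      proof
        fix j :: 'n
        obtain i where "i < CARD('n)" "j = from_nat_into UNIV i" using ix by blast
        then show "a $ j \<le> v $ j \<and> v $ j \<le> b $ j"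
          using xs v by (auto simp: nth_coords)
      qed
      ultimately show "xs \<in> ?r" by blast
    qed
    show "?r \<subseteq> ?l" by (auto simp: mem_box_cart nth_coords)
  qed
  ultimately show ?thesis by (simp add: definable_pred_def)
qed

lemma definable_finite_cboxes:
  fixes I :: "((real ^ 'n::finite) \<times> (real ^ 'n)) set"
  assumes "finite I"
  shows "coords ` (\<Union>(a, b)\<in>I. cbox a b) \<in> S CARD('n)"
  using assms
proof (induction I)
  case empty
  then show ?case using S_empty by simp
next
  case (insert p I)
  have "coords ` (\<Union>(a, b)\<in>insert p I. cbox a b)
    = coords ` cbox (fst p) (snd p) \<union> coords ` (\<Union>(a, b)\<in>I. cbox a b)"
    by (cases p) auto
  then show ?case using S_Un[OF definable_cbox insert.IH] by metis
qed

lemma definable_set_Int: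
  fixes A B :: "(real ^ 'n::finite) set"
  assumes "definable_set S A" "definable_set S B"
  shows "definable_set S (A \<inter> B)"
proof -
  have "definable_pred S CARD('n) (\<lambda>xs. xs \<in> coords ` A \<and> xs \<in> coords ` B)"
    using assms unfolding definable_set_def by (intro definable_pred_conj definable_pred_mem)
  moreover have "{xs. length xs = CARD('n) \<and> xs \<in> coords ` A \<and> xs \<in> coords ` B} = coords ` (A \<inter> B)"
    by (auto dest: injD[OF inj_coords])
  ultimately show ?thesis by (simp add: definable_pred_def definable_set_def)
qed

end

section \<open>Mean statistic and tilted measures\<close>

context exponential_family
begin

text \<open>The gradient of \<open>ln (Z \<theta>)\<close>, and the expectation of \<open>T\<close>
  under the tilted measure, assembled from scalar means so that their convergence and
  differentiability carry over by coordinates.\<close>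

definition mean_statistic :: "'a \<Rightarrow> 'a" where
  "mean_statistic \<theta> = (\<Sum>b\<in>Basis. mean (\<lambda>x. b \<bullet> T x) \<theta> *\<^sub>R b)"

lemma inner_mean_statistic:
  assumes "\<theta> \<in> U"
  shows "v \<bullet> mean_statistic \<theta> = mean (\<lambda>x. v \<bullet> T x) \<theta>"
proof -
  have "mean (\<lambda>x. v \<bullet> T x) \<theta> = mean (\<lambda>x. (\<Sum>b\<in>Basis. (v \<bullet> b) *\<^sub>R b) \<bullet> T x) \<theta>"
    by (simp add: euclidean_representation)
  also have "\<dots> = (\<Sum>b\<in>Basis. (v \<bullet> b) * mean (\<lambda>x. b \<bullet> T x) \<theta>)"
    using linear_mean[OF assms] by (subst linear_sum[OF linear_mean[OF assms]]) (simp add: linear_cmul mean_cmult)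
  finally show ?thesis by (simp add: mean_statistic_def inner_sum_right mult.commute)
qed

lemma ln_Z_has_derivative': "\<theta> \<in> U \<Longrightarrow> ((\<lambda>\<theta>. ln (Z \<theta>)) has_derivative (\<lambda>h. h \<bullet> mean_statistic \<theta>)) (at \<theta>)"
  using ln_Z_has_derivative[of \<theta>] by (simp add: inner_mean_statistic)

definition tilted :: "'a \<Rightarrow> 'x measure" where
  "tilted \<theta> = density m (\<lambda>x. ennreal (exp (\<theta> \<bullet> T x) / Z \<theta>))"

lemma integral_tilted:
  assumes "\<theta> \<in> U" "\<phi> \<in> borel_measurable m"
  shows "(\<integral>x. \<phi> x \<partial>tilted \<theta>) = mean \<phi> \<theta>"
proof -
  have "(\<integral>x. \<phi> x \<partial>tilted \<theta>) = (\<integral>x. (exp (\<theta> \<bullet> T x) / Z \<theta>) *\<^sub>R \<phi> x \<partial>m)"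
    unfolding tilted_def using Z_pos[OF assms(1)] assms(2) by (intro integral_density) auto
  also have "\<dots> = (\<integral>x. (\<phi> x * exp (\<theta> \<bullet> T x)) / Z \<theta> \<partial>m)"
    by (simp add: mult.commute)
  also have "\<dots> = mean \<phi> \<theta>" by (simp add: mean_def moment_def)
  finally show ?thesis .
qed

text \<open>Self-adjointness moves \<open>P\<close> from \<open>T x\<close> onto the basis vectors,
  which leaves scalar means of linear functions of \<open>T\<close>.\<close>

lemma integral_tilted_linear:
  fixes P :: "'a \<Rightarrow> 'a"
  assumes \<theta>: "\<theta> \<in> U" and P: "linear P" "\<And>x y. P x \<bullet> y = x \<bullet> P y"
  shows "(\<integral>x. P (T x) \<partial>tilted \<theta>) = P (mean_statistic \<theta>)"
proof -
  have [measurable]: "P \<in> borel_measurable borel"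
    using P(1) by (intro borel_measurable_continuous_onI linear_continuous_on)
      (simp add: linear_conv_bounded_linear)
  have i: "integrable m (\<lambda>x. (P b \<bullet> T x) * exp (\<theta> \<bullet> T x))" for b
    by (rule integrable_moderate[OF moderate_inner \<theta>])
  have "(\<integral>x. P (T x) \<partial>tilted \<theta>) = (\<integral>x. (exp (\<theta> \<bullet> T x) / Z \<theta>) *\<^sub>R P (T x) \<partial>m)"
    unfolding tilted_def using Z_pos[OF \<theta>] by (intro integral_density) auto
  also have "\<dots> = (\<integral>x. (\<Sum>b\<in>Basis. (((P b \<bullet> T x) * exp (\<theta> \<bullet> T x)) / Z \<theta>) *\<^sub>R b) \<partial>m)"
  proof (rule arg_cong[where f = "integral\<^sup>L m"], rule ext)
    fix x
    have "(exp (\<theta> \<bullet> T x) / Z \<theta>) *\<^sub>R P (T x) = (exp (\<theta> \<bullet> T x) / Z \<theta>) *\<^sub>R (\<Sum>b\<in>Basis. (P (T x) \<bullet> b) *\<^sub>R b)"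
      by (simp add: euclidean_representation)
    also have "\<dots> = (\<Sum>b\<in>Basis. (((P b \<bullet> T x) * exp (\<theta> \<bullet> T x)) / Z \<theta>) *\<^sub>R b)"
      unfolding scaleR_sum_right by (intro sum.cong) (simp_all add: P(2) inner_commute mult.commute)
    finally show "(exp (\<theta> \<bullet> T x) / Z \<theta>) *\<^sub>R P (T x) = (\<Sum>b\<in>Basis. (((P b \<bullet> T x) * exp (\<theta> \<bullet> T x)) / Z \<theta>) *\<^sub>R b)" .
  qed
  also have "\<dots> = (\<Sum>b\<in>Basis. mean (\<lambda>x. P b \<bullet> T x) \<theta> *\<^sub>R b)"
    using i by (subst Bochner_Integration.integral_sum) (auto simp: mean_def moment_def)
  also have "\<dots> = (\<Sum>b\<in>Basis. (P (mean_statistic \<theta>) \<bullet> b) *\<^sub>R b)"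
    by (intro sum.cong refl arg_cong2[where f = "(*\<^sub>R)"]) (simp add: P(2)[symmetric] inner_commute inner_mean_statistic[OF \<theta>])
  finally show ?thesis by (simp add: euclidean_representation)
qed

text \<open>The unnormalized densities differ by the constant factor \<open>exp c\<close>, which the
  normalization removes. Applied to parameters with equal projection onto \<open>V\<close>.\<close>

lemma tilted_eq:
  assumes \<theta>: "\<theta> \<in> U" and c: "AE x in m. (\<theta>' - \<theta>) \<bullet> T x = c"
  shows "tilted \<theta>' = tilted \<theta>"
proof -
  have e: "AE x in m. exp (\<theta>' \<bullet> T x) = exp c * exp (\<theta> \<bullet> T x)"
    using c by (rule AE_mp) (auto simp: exp_add[symmetric] inner_diff_left)
  have "Z \<theta>' = (\<integral>x. exp c * exp (\<theta> \<bullet> T x) \<partial>m)"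
    unfolding Z_def moment_def using e by (intro integral_cong_AE) auto
  then have "Z \<theta>' = exp c * Z \<theta>" by (simp add: Z_def moment_def)
  then show ?thesis
    unfolding tilted_def using e by (intro density_cong) auto
qed

end

section \<open>Convergence of the constrained EM algorithm\<close>

text \<open>Only integrability is at stake, so bounding the exponential of a convex combination by
  the sum of the two exponentials suffices in place of the Hoelder inequality.\<close>

lemma convex_natural_params:
  fixes T :: "'x \<Rightarrow> real ^ 'n::finite"
  assumes [measurable]: "T \<in> borel_measurable \<mu>"
  shows "convex (natural_params \<mu> T)"
proof (rule convexI)
  fix a b :: "real ^ 'n" and u v :: real
  assume ab: "a \<in> natural_params \<mu> T" "b \<in> natural_params \<mu> T" and uv: "0 \<le> u" "0 \<le> v" "u + v = 1"
  have "integrable \<mu> (\<lambda>x. exp (a \<bullet> T x) + exp (b \<bullet> T x))"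
    using ab by (simp add: natural_params_def)
  then have "integrable \<mu> (\<lambda>x. exp ((u *\<^sub>R a + v *\<^sub>R b) \<bullet> T x))"
  proof (rule Bochner_Integration.integrable_bound)
    show "AE x in \<mu>. norm (exp ((u *\<^sub>R a + v *\<^sub>R b) \<bullet> T x)) \<le> norm (exp (a \<bullet> T x) + exp (b \<bullet> T x))"
    proof (intro AE_I2)
      fix x
      have "(u *\<^sub>R a + v *\<^sub>R b) \<bullet> T x \<le> max (a \<bullet> T x) (b \<bullet> T x)"
        using convex_bound_le[of "a \<bullet> T x" "max (a \<bullet> T x) (b \<bullet> T x)" "b \<bullet> T x" u v] uv
        by (simp add: inner_add_left)
      then have "exp ((u *\<^sub>R a + v *\<^sub>R b) \<bullet> T x) \<le> exp (max (a \<bullet> T x) (b \<bullet> T x))" by simp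
      also have "\<dots> \<le> exp (a \<bullet> T x) + exp (b \<bullet> T x)" by (simp add: max_def)
      finally show "norm (exp ((u *\<^sub>R a + v *\<^sub>R b) \<bullet> T x)) \<le> norm (exp (a \<bullet> T x) + exp (b \<bullet> T x))" by simp
    qed
  qed simp
  then show "u *\<^sub>R a + v *\<^sub>R b \<in> natural_params \<mu> T" by (simp add: natural_params_def)
qed

context exponential_family
begin

lemma orth_complement_AE_const:
  assumes "subspace V" "AE x in m. T x - t\<^sub>0 \<in> V" "orth_proj V w = 0"
  shows "AE x in m. w \<bullet> T x = w \<bullet> t\<^sub>0"
  using assms(2)
proof (rule AE_mp, intro AE_I2 impI)
  fix x assume "T x - t\<^sub>0 \<in> V"
  from orth_proj_orthogonal[OF assms(1) this, of w] show "w \<bullet> T x = w \<bullet> t\<^sub>0"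
    using assms(3) by (simp add: inner_diff_right)
qed

text \<open>Directions orthogonal to \<open>V\<close> give statistics that are constant almost
  everywhere, and constants have no covariance. This is how the accurate parameter enters all
  estimates.\<close>

lemma cov_orth_proj:
  assumes V: "subspace V" "AE x in m. T x - t\<^sub>0 \<in> V" and \<theta>: "\<theta> \<in> U"
  shows "cov \<theta> u w = cov \<theta> (orth_proj V u) (orth_proj V w)"
proof -
  have 1: "cov \<theta> u w = cov \<theta> u (orth_proj V w)" for u w
  proof -
    have "orth_proj V (w - orth_proj V w) = 0"
      using orth_proj_orthogonal[OF V(1)] by (intro orth_proj_unique[OF V(1)] subspace_0 V(1)) simp
    then have "cov \<theta> u (w - orth_proj V w) = 0"
      by (rule cov_AE_const[OF \<theta> orth_complement_AE_const[OF V]])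
    then show ?thesis using linear_diff[OF linear_cov[OF \<theta>]] by simp
  qed
  show ?thesis using 1[of u w] 1[of "orth_proj V w" u] by (metis cov_commute)
qed

end

text \<open>Otherwise the values of \<open>T\<close> would lie almost everywhere in a translate of
  the part of \<open>V\<close> orthogonal to \<open>v\<close>, whose dimension is smaller.\<close>

lemma accurate_space_nonconst:
  assumes V: "accurate_space T m V" and v: "v \<in> V" "v \<noteq> 0"
  shows "\<not> (AE x in m. v \<bullet> T x = c)"
proof
  assume c: "AE x in m. v \<bullet> T x = c"
  obtain t0 where t0: "AE x in m. T x - t0 \<in> V" and sV: "subspace V"
    using V unfolding accurate_space_def by blast
  define W where "W = {w \<in> V. v \<bullet> w = 0}"
  have sW: "subspace W"
    using sV unfolding W_def subspace_def by (auto simp: inner_add_right)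
  \<comment> \<open>Moves \<open>t0\<close> along \<open>v\<close> until
    \<open>v \<bullet> t1 = c\<close>; since \<open>v\<close> belongs to \<open>V\<close>,
    differences \<open>T x - t1\<close> stay in \<open>V\<close>.\<close>
  define t1 where "t1 = t0 + ((c - v \<bullet> t0) / (v \<bullet> v)) *\<^sub>R v"
  have "AE x in m. T x - t1 \<in> W"
    using t0 c
  proof eventually_elim
    case (elim x)
    have "T x - t1 = (T x - t0) - ((c - v \<bullet> t0) / (v \<bullet> v)) *\<^sub>R v" by (simp add: t1_def)
    also have "\<dots> \<in> V" by (intro subspace_diff subspace_scale sV elim v)
    finally show ?case using elim v by (simp add: W_def t1_def inner_diff_right inner_add_right)
  qed
  then have "dim V \<le> dim W" using V sW unfolding accurate_space_def by blast
  moreover have "v \<notin> W" using v by (simp add: W_def)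
  then have "W \<subset> V" using v(1) unfolding W_def by blast
  then have "dim W < dim V" using sV sW by (intro dim_psubset) (simp add: span_eq_iff[THEN iffD2])
  ultimately show False by simp
qed

lemma incomplete_density_eq:
  "incomplete_density \<mu> T m t = exp (- log_partition \<mu> T t) * (\<integral>x. exp (t \<bullet> T x) \<partial>m)"
proof -
  have "ef_density \<mu> T t x = exp (- log_partition \<mu> T t) * exp (t \<bullet> T x)" for x
    by (simp add: ef_density_def exp_add[symmetric])
  then show ?thesis by (simp add: incomplete_density_def)
qed

text \<open>The complete data partition function cancels, so the conditional law is an exponential
  family under the fibre measure alone.\<close>

lemma cond_distr_eq:
  "cond_distr \<mu> T m t = density m (\<lambda>x. ennreal (exp (t \<bullet> T x) / (\<integral>x. exp (t \<bullet> T x) \<partial>m)))"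
proof -
  have "ef_density \<mu> T t x / incomplete_density \<mu> T m t = exp (t \<bullet> T x) / (\<integral>x. exp (t \<bullet> T x) \<partial>m)" for x
    unfolding incomplete_density_eq
    by (simp add: ef_density_def exp_diff exp_minus field_simps)
  then show ?thesis by (simp add: cond_distr_def)
qed

text \<open>Fermat's rule on a constraint set. It will be applied to the limiting EM objective, not
  to the likelihood.\<close>

lemma normal_cone_of_local_min:
  assumes D: "(Q has_derivative (\<lambda>h. h \<bullet> g)) (at a)"
    and min: "\<forall>\<^sub>F z in at a within M. Q a \<le> Q z"
  shows "- g \<in> normal_cone M a"
  unfolding normal_cone_def
proof (intro CollectI allI impI)
  fix \<epsilon> :: real assume "\<epsilon> > 0"
  then obtain d where d: "d > 0" "\<And>z. norm (z - a) < d \<Longrightarrow> norm (Q z - Q a - (z - a) \<bullet> g) \<le> \<epsilon> * norm (z - a)"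
    using D unfolding has_derivative_at_alt by blast
  have "\<forall>\<^sub>F z in at a within M. norm (z - a) < d"
    unfolding eventually_at using d(1) by (intro exI[of _ d]) (simp add: dist_norm)
  with min show "\<forall>\<^sub>F z in at a within M. - g \<bullet> (z - a) \<le> \<epsilon> * norm (z - a)"
  proof eventually_elim
    case (elim z)
    then show ?case using d(2)[of z] by (simp add: inner_commute abs_le_iff)
  qed
qed

lemma convergent_of_summable_dist:
  fixes s :: "nat \<Rightarrow> 'a::banach"
  assumes "summable (\<lambda>k. norm (s (Suc k) - s k))"
  shows "convergent s"
proof -
  have "summable (\<lambda>k. s (Suc k) - s k)" using assms by (rule summable_norm_cancel)
  then have "(\<lambda>n. \<Sum>k<n. s (Suc k) - s k) \<longlonglongrightarrow> (\<Sum>k. s (Suc k) - s k)" by (rule summable_LIMSEQ)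
  then have "(\<lambda>n. s n - s 0) \<longlonglongrightarrow> (\<Sum>k. s (Suc k) - s k)" by (simp add: sum_lessThan_telescope)
  from tendsto_add[OF this tendsto_const[of "s 0"]] show ?thesis unfolding convergent_def by auto
qed

theorem theorem2:
  fixes \<mu> :: "'x::topological_space measure"
    and N :: "'y measure"
    and h :: "'x \<Rightarrow> 'y"
    and \<kappa> :: "'y \<Rightarrow> 'x measure"
    and y :: 'y
    and T :: "'x \<Rightarrow> real ^ 'n::finite"
    and M V :: "(real ^ 'n) set"
    and S :: "nat \<Rightarrow> real list set set"
    and \<theta> :: "nat \<Rightarrow> real ^ 'n"
  defines "\<Theta> \<equiv> natural_params \<mu> T"
    and "p \<equiv> ef_density \<mu> T"
    and "q \<equiv> incomplete_density \<mu> T (\<kappa> y)"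
    and "\<P> \<equiv> cond_distr \<mu> T (\<kappa> y)"
    and "P \<equiv> orth_proj V"
  assumes borel: "sets \<mu> = sets borel"
    and sigma_finite: "sigma_finite_measure \<mu>"
    and disint: "disintegration \<mu> N h \<kappa>"
    and y: "y \<in> space N"
    and T: "T \<in> borel_measurable \<mu>"
    and full_dim: "aff_dim \<Theta> = int CARD('n)"
    and minimal: "minimal_family \<mu> T"
    and q: "\<And>t. t \<in> \<Theta> \<Longrightarrow> integrable (\<kappa> y) (p t) \<and> 0 < q t"
    and V: "accurate_space T (\<kappa> y) V"
    and M: "closed M" "M \<subseteq> closure \<Theta>"
    and o_minimal: "o_minimal S"
    and definable: "definable_fun_on S \<Theta> (\<lambda>t. - ln (q t))" "definable_set S M"
    and bounded: "bounded (range \<theta>)"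
    and in_M: "\<And>k. \<theta> k \<in> M"
    and em: "\<And>k. is_arg_min (\<lambda>t. - (\<integral>x. ln (p t x) \<partial>\<P> (\<theta> k))) (\<lambda>t. t \<in> M \<inter> \<Theta>) (\<theta> (Suc k))"
    and interior: "\<And>k. \<theta> k \<in> interior \<Theta>"
    and interior_acc: "\<And>a. accumulation_point \<theta> a \<Longrightarrow> a \<in> interior \<Theta>"
  shows "(\<exists>\<theta>'. (\<lambda>k. P (\<theta> k)) \<longlonglongrightarrow> \<theta>' \<and>
            (\<forall>a. accumulation_point \<theta> a \<longrightarrow>
               critical_on M (\<lambda>t. - ln (q t)) a \<and>
               P a = \<theta>' \<and>
               weakly_converges (\<lambda>k. \<P> (\<theta> k)) (\<P> a))) \<and>
         (\<forall>a b. accumulation_point \<theta> a \<and> accumulation_point \<theta> b \<longrightarrow> \<P> a = \<P> b) \<and>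
         convergent (\<lambda>k. \<integral>x. P (T x) \<partial>\<P> (\<theta> k))"
proof -
  interpret o_minimal_structure S by standard (rule o_minimal)
  define m where "m = \<kappa> y"
  define U where "U = interior \<Theta>"
  define lp where "lp = log_partition \<mu> T"
  have sets_m: "sets m = sets \<mu>" using disint y unfolding disintegration_def m_def by blast
  have Tm: "T \<in> borel_measurable m" using T by (simp add: measurable_cong_sets[OF sets_m refl])
  have U\<Theta>: "U \<subseteq> \<Theta>" by (simp add: U_def interior_subset)
  have U: "open U" "convex U"
    unfolding U_def \<Theta>_def by (auto intro: convex_interior convex_natural_params T)
  have \<theta>U: "\<theta> k \<in> U" for k using interior by (simp add: U_def)
  have \<theta>\<Theta>: "\<theta> k \<in> \<Theta>" for k using U\<Theta> \<theta>U by blast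
  have \<Theta>_int: "integrable m (\<lambda>x. exp (t \<bullet> T x))" if "t \<in> \<Theta>" for t
  proof -
    have "integrable m (\<lambda>x. exp (lp t) * p t x)" using q[OF that] by (simp add: m_def)
    moreover have "exp (lp t) * p t x = exp (t \<bullet> T x)" for x
      by (simp add: p_def ef_density_def lp_def exp_add[symmetric])
    ultimately show ?thesis by simp
  qed
  have q_eq: "q t = exp (- lp t) * (\<integral>x. exp (t \<bullet> T x) \<partial>m)" for t
    unfolding q_def m_def lp_def by (rule incomplete_density_eq)
  have "\<not> (AE x in m. False)"
  proof
    assume "AE x in m. False"
    then have "(\<integral>x. exp (\<theta> 0 \<bullet> T x) \<partial>m) = 0" by (intro integral_eq_zero_AE) auto
    then show False using q[of "\<theta> 0"] U\<Theta> \<theta>U[of 0] q_eq by auto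
  qed
  then interpret Y: exponential_family m T U
    using Tm U \<Theta>_int U\<Theta> by unfold_locales auto
  have "\<not> (AE x in \<mu>. False)"
  proof
    assume F: "AE x in \<mu>. False"
    obtain b :: "real ^ 'n" where "b \<in> Basis" using nonempty_Basis by blast
    then have "b \<noteq> 0" by auto
    moreover have "AE x in \<mu>. b \<bullet> T x = 0" using F by (rule AE_mp) auto
    ultimately show False using minimal unfolding minimal_family_def by blast
  qed
  then interpret X: exponential_family \<mu> T U
    using T U U\<Theta> by unfold_locales (auto simp: \<Theta>_def natural_params_def)
  have lp_eq: "lp t = ln (X.Z t)" for t
    by (simp add: lp_def log_partition_def X.Z_def X.moment_def)
  have Z_eq: "(\<integral>x. exp (t \<bullet> T x) \<partial>m) = Y.Z t" for t
    by (simp add: Y.Z_def Y.moment_def)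
  have Z_pos: "0 < Y.Z t" if "t \<in> \<Theta>" for t
    using q[OF that] unfolding q_eq Z_eq by (simp add: zero_less_mult_iff)
  define f where "f t = - ln (q t)" for t
  \<comment> \<open>A difference of two convex functions: an EM step replaces the second by its
    linearization at the current iterate and minimizes the result.\<close>
  have f_eq: "f t = lp t - ln (Y.Z t)" if "t \<in> \<Theta>" for t
    unfolding f_def q_eq Z_eq using Z_pos[OF that] by (simp add: ln_mult)
  have \<P>_eq: "\<P> t = Y.tilted t" for t
    unfolding \<P>_def Y.tilted_def m_def[symmetric] cond_distr_eq Z_eq ..
  have lp_deriv: "(lp has_derivative (\<lambda>h. h \<bullet> X.mean_statistic t)) (at t)" if "t \<in> U" for t
    using X.ln_Z_has_derivative'[OF that] unfolding lp_eq[symmetric] by simp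

  have sV: "subspace V" using V unfolding accurate_space_def by blast
  obtain t0 where t0: "AE x in m. T x - t0 \<in> V" using V unfolding accurate_space_def m_def by blast
  have P_lin: "linear P" unfolding P_def by (rule linear_orth_proj[OF sV])
  have P_cont: "continuous_on A P" for A
    using P_lin by (intro linear_continuous_on) (simp add: linear_conv_bounded_linear)
  have P_le: "norm (P x) \<le> norm x" for x unfolding P_def by (rule norm_orth_proj_le[OF sV])
  have tilted_P: "Y.tilted a = Y.tilted b" if "a \<in> U" "b \<in> U" "P a = P b" for a b
  proof (rule Y.tilted_eq[OF that(2)])
    have "orth_proj V (a - b) = 0" using linear_diff[OF P_lin, of a b] that(3) by (simp add: P_def)
    then show "AE x in m. (a - b) \<bullet> T x = (a - b) \<bullet> t0" by (rule Y.orth_complement_AE_const[OF sV t0])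
  qed

  define C0 where "C0 = closure (range \<theta>)"
  have C0: "compact C0" "\<And>k. \<theta> k \<in> C0"
    unfolding C0_def using bounded by (simp_all add: compact_closure subsetD[OF closure_subset])
  have C0U: "C0 \<subseteq> U"
    unfolding C0_def using closure_range_cases[of _ \<theta>] interior_acc \<theta>U by (auto simp: U_def)
  obtain I where I: "finite I" "C0 \<subseteq> (\<Union>(a, b)\<in>I. cbox a b)" "(\<Union>(a, b)\<in>I. cbox a b) \<subseteq> U"
    using compact_subset_finite_cboxes[OF C0(1) U(1) C0U] by blast
  define K where "K = (\<Union>(a, b)\<in>I. cbox a b)"
  have K: "compact K" "K \<subseteq> U" "\<And>k. \<theta> k \<in> K"
    unfolding K_def using I subsetD[OF I(2) C0(2)] by (auto intro!: compact_UN)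
  \<comment> \<open>The mean value and Taylor arguments run along segments, which may leave
    \<open>K\<close>; the constants \<open>c\<close> and \<open>L\<close> are therefore taken on the
    hull, which stays inside the convex set \<open>U\<close>.\<close>
  define H where "H = convex hull K"
  have H: "compact H" "H \<subseteq> U"
    unfolding H_def using K U(2) by (auto intro: compact_convex_hull hull_minimal[THEN subsetD])
  have seg: "closed_segment a b \<subseteq> H" if "a \<in> K" "b \<in> K" for a b
    unfolding H_def using that by (intro closed_segment_subset_convex_hull) (auto intro: hull_inc)
  obtain c where c: "c > 0" "\<And>t v. t \<in> H \<Longrightarrow> v \<in> V \<Longrightarrow> c * (norm v)\<^sup>2 \<le> Y.cov t v v"
    using Y.variance_lower_bound[OF H sV] accurate_space_nonconst[OF V] unfolding m_def by metis
  obtain L where L: "L \<ge> 0" "\<And>t u v. t \<in> H \<Longrightarrow> \<bar>Y.cov t u v\<bar> \<le> L * norm u * norm v"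
    using Y.cov_bound[OF H] by blast

  define e where "e k = Y.mean_statistic (\<theta> k)" for k
  define d where "d k = norm (P (\<theta> (Suc k)) - P (\<theta> k))" for k
  have EM: "\<theta> (Suc k) \<in> \<Theta>" "t \<in> M \<Longrightarrow> t \<in> \<Theta> \<Longrightarrow> lp (\<theta> (Suc k)) - \<theta> (Suc k) \<bullet> e k \<le> lp t - t \<bullet> e k" for k t
  proof -
    \<comment> \<open>Valid for every \<open>t\<close>, also outside \<open>U\<close>: the
      integrating law has its parameter in \<open>U\<close>, and under it every linear function of
      \<open>T\<close> is integrable.\<close>
    have Q: "- (\<integral>x. ln (p t x) \<partial>\<P> (\<theta> k)) = lp t - t \<bullet> e k" for t
    proof -
      have "(\<integral>x. ln (p t x) \<partial>\<P> (\<theta> k)) = (\<integral>x. t \<bullet> T x + - lp t \<partial>Y.tilted (\<theta> k))"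
        by (simp add: \<P>_eq p_def ef_density_def lp_def)
      also have "\<dots> = Y.mean (\<lambda>x. t \<bullet> T x + - lp t) (\<theta> k)"
        by (rule Y.integral_tilted[OF \<theta>U]) simp
      also have "\<dots> = t \<bullet> e k - lp t"
        using Y.mean_add[OF Y.moderate_inner Y.moderate_const \<theta>U, of t "- lp t" k]
        by (simp add: Y.mean_const[OF \<theta>U] e_def Y.inner_mean_statistic[OF \<theta>U])
      finally show ?thesis by simp
    qed
    show "\<theta> (Suc k) \<in> \<Theta>" using em[of k] by (simp add: is_arg_min_def)
    show "lp (\<theta> (Suc k)) - \<theta> (Suc k) \<bullet> e k \<le> lp t - t \<bullet> e k" if "t \<in> M" "t \<in> \<Theta>"
      using em[of k] that unfolding is_arg_min_def Q by force
  qed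

  have Taylor: "\<exists>\<xi>\<in>H. ln (Y.Z t) = ln (Y.Z s) + (t - s) \<bullet> Y.mean_statistic s + Y.cov \<xi> (t - s) (t - s) / 2"
    if "s \<in> K" "t \<in> K" for s t
  proof -
    have st: "s \<in> U" "t \<in> U" using that K(2) by auto
    from Y.ln_Z_Taylor[OF st] show ?thesis
      using seg[OF that] unfolding Y.inner_mean_statistic[OF st(1)] by blast
  qed
  \<comment> \<open>Comparing the new iterate with the old one in the EM objective leaves the
    divergence of the two as the gain in \<open>f\<close>; it is at least \<open>c / 2\<close> times
    the squared projected step.\<close>
  have descent: "c / 2 * (d k)\<^sup>2 \<le> f (\<theta> k) - f (\<theta> (Suc k))" for k
  proof -
    let ?v = "\<theta> (Suc k) - \<theta> k"
    obtain \<xi> where \<xi>: "\<xi> \<in> H"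
      "ln (Y.Z (\<theta> (Suc k))) = ln (Y.Z (\<theta> k)) + ?v \<bullet> e k + Y.cov \<xi> ?v ?v / 2"
      using Taylor[OF K(3) K(3)] unfolding e_def by blast
    have "Y.cov \<xi> ?v ?v = Y.cov \<xi> (P ?v) (P ?v)"
      unfolding P_def using \<xi>(1) H(2) by (intro Y.cov_orth_proj[OF sV t0]) auto
    moreover have "c * (norm (P ?v))\<^sup>2 \<le> Y.cov \<xi> (P ?v) (P ?v)"
      using orth_proj_in[OF sV] by (intro c(2) \<xi>(1)) (simp add: P_def)
    ultimately have "c * (d k)\<^sup>2 \<le> Y.cov \<xi> ?v ?v"
      by (simp add: d_def linear_diff[OF P_lin])
    moreover have "lp (\<theta> (Suc k)) - \<theta> (Suc k) \<bullet> e k \<le> lp (\<theta> k) - \<theta> k \<bullet> e k"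
      using EM(2)[OF in_M] U\<Theta> \<theta>U by blast
    ultimately show ?thesis
      using \<xi>(2) f_eq[OF \<theta>\<Theta>[of k]] f_eq[OF \<theta>\<Theta>[of "Suc k"]] unfolding inner_diff_left by linarith
  qed
  \<comment> \<open>Two errors separate the EM objective from \<open>f\<close> near the new iterate.
    Its linear term was taken at \<open>\<theta> k\<close>, which costs a covariance with the step,
    at most \<open>L * d k * norm (w - \<theta> (Suc k))\<close>; the curvature of
    \<open>ln (Y.Z t)\<close> costs the quadratic term with constant \<open>L / 2\<close>.\<close>
  have slope: "slope_le (L / 2) f (M \<inter> K) (\<theta> (Suc k)) (L * d k)" for k
    unfolding slope_le_def
  proof
    fix w assume w: "w \<in> M \<inter> K"
    let ?t = "\<theta> (Suc k)" and ?v = "\<theta> (Suc k) - \<theta> k"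
    obtain \<xi> where \<xi>: "\<xi> \<in> H"
      "ln (Y.Z w) = ln (Y.Z ?t) + (w - ?t) \<bullet> e (Suc k) + Y.cov \<xi> (w - ?t) (w - ?t) / 2"
      using Taylor[OF K(3), of w "Suc k"] w unfolding e_def by blast
    obtain \<eta> where \<eta>: "\<eta> \<in> H" "(w - ?t) \<bullet> e (Suc k) - (w - ?t) \<bullet> e k = Y.cov \<eta> (w - ?t) ?v"
      using Y.mean_diff_eq_cov[OF \<theta>U \<theta>U, of k "Suc k" "w - ?t"] seg[OF K(3) K(3), of k "Suc k"]
      unfolding e_def by (auto simp: Y.inner_mean_statistic[OF \<theta>U])
    have "Y.cov \<eta> (w - ?t) ?v = Y.cov \<eta> (P (w - ?t)) (P ?v)"
      unfolding P_def using \<eta>(1) H(2) by (intro Y.cov_orth_proj[OF sV t0]) auto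
    also have "\<dots> \<le> L * norm (P (w - ?t)) * norm (P ?v)"
      using L(2)[OF \<eta>(1), of "P (w - ?t)" "P ?v"] by linarith
    also have "\<dots> \<le> L * norm (w - ?t) * norm (P ?v)"
      using L(1) P_le by (intro mult_right_mono mult_left_mono) auto
    finally have 1: "Y.cov \<eta> (w - ?t) ?v \<le> L * d k * norm (w - ?t)"
      by (simp add: d_def linear_diff[OF P_lin] mult_ac)
    have 2: "Y.cov \<xi> (w - ?t) (w - ?t) / 2 \<le> L / 2 * (norm (w - ?t))\<^sup>2"
      using L(2)[OF \<xi>(1), of "w - ?t" "w - ?t"] by (simp add: power2_eq_square mult_ac)
    have w\<Theta>: "w \<in> \<Theta>" using w K(2) U\<Theta> by blast
    have "lp ?t - ?t \<bullet> e k \<le> lp w - w \<bullet> e k" using EM(2)[of w k] w w\<Theta> by blast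
    then have "f ?t - f w \<le> L * d k * norm (w - ?t) + L / 2 * (norm (w - ?t))\<^sup>2"
      using \<xi>(2) \<eta>(2) 1 2 f_eq[OF w\<Theta>] f_eq[OF EM(1)[of k]] by (simp add: inner_diff_left)
    then show "f ?t - f w \<le> L * d k * norm (?t - w) + L / 2 * (norm (?t - w))\<^sup>2"
      by (simp add: norm_minus_commute)
  qed

  have f_cont: "continuous_on U f"
  proof -
    have "continuous_on U lp"
      using lp_deriv by (meson continuous_at_imp_continuous_on has_derivative_continuous)
    moreover have "continuous_on U (\<lambda>t. ln (Y.Z t))"
      using Y.ln_Z_has_derivative by (meson continuous_at_imp_continuous_on has_derivative_continuous)
    ultimately have "continuous_on U (\<lambda>t. lp t - ln (Y.Z t))" by (rule continuous_on_diff)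
    then show ?thesis by (rule continuous_on_eq) (use f_eq U\<Theta> in auto)
  qed
  have f_dec: "f (\<theta> (Suc k)) \<le> f (\<theta> k)" for k
  proof -
    have "0 \<le> c / 2 * (d k)\<^sup>2" using c(1) by simp
    then show ?thesis using descent[of k] by linarith
  qed
  have "Bseq (\<lambda>k. f (\<theta> k))"
  proof -
    have "compact (f ` K)" using continuous_on_subset[OF f_cont K(2)] K(1) by (rule compact_continuous_image)
    then show ?thesis
      unfolding Bseq_eq_bounded using K(3) by (auto intro!: bounded_subset[OF compact_imp_bounded])
  qed
  then obtain fs where fs: "(\<lambda>k. f (\<theta> k)) \<longlonglongrightarrow> fs"
    using Bseq_monoseq_convergent[of "\<lambda>k. f (\<theta> k)"] f_dec unfolding monoseq_Suc convergent_def by blast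
  have fs_le: "fs \<le> f (\<theta> k)" for k
    using decseq_ge[OF _ fs] f_dec by (simp add: decseq_Suc_iff)

  have X: "definable_set S (M \<inter> K)" "M \<inter> K \<subseteq> \<Theta>" "compact (M \<inter> K)" "continuous_on (M \<inter> K) f"
  proof -
    have "definable_set S K"
      unfolding definable_set_def K_def by (rule definable_finite_cboxes[OF I(1)])
    then show "definable_set S (M \<inter> K)" by (rule definable_set_Int[OF definable(2)])
    show "M \<inter> K \<subseteq> \<Theta>" using K(2) U\<Theta> by blast
    show "compact (M \<inter> K)" using M(1) K(1) by (rule closed_Int_compact)
    show "continuous_on (M \<inter> K) f" using K(2) by (intro continuous_on_subset[OF f_cont]) auto
  qed
  have "definable_fun_on S \<Theta> f" using definable(1) unfolding f_def .
  from Kurdyka_Lojasiewicz[OF this X, of "L / 2" fs] obtain \<delta> \<Gamma> B where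
    \<Gamma>: "\<delta> > 0" "mono_on {0<..<\<delta>} \<Gamma>" "\<forall>t. 0 < t \<and> t < \<delta> \<longrightarrow> \<bar>\<Gamma> t\<bar> \<le> B"
      "\<forall>a b v s. 0 < a \<and> a < b \<and> b < \<delta> \<and> v \<in> M \<inter> K \<and> f v = fs + b \<and> 0 \<le> s \<and> slope_le (L / 2) f (M \<inter> K) v s \<longrightarrow>
         b - a \<le> s * (\<Gamma> b - \<Gamma> a)"
    using L(1) by auto
  have "summable d"
  proof (rule summable_of_KL_descent[where r = "\<lambda>k. f (\<theta> k) - fs" and c = "c / 2" and L = L and \<Gamma> = \<Gamma> and \<delta> = \<delta> and B = B])
    show "(\<lambda>k. f (\<theta> k) - fs) \<longlonglongrightarrow> 0" using fs by (simp add: LIM_zero)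
    fix k a assume a: "0 < a" "a < f (\<theta> (Suc k)) - fs" "f (\<theta> (Suc k)) - fs < \<delta>"
    have "0 \<le> L * d k" using L(1) by (simp add: d_def)
    then show "f (\<theta> (Suc k)) - fs - a \<le> L * d k * (\<Gamma> (f (\<theta> (Suc k)) - fs) - \<Gamma> a)"
      using \<Gamma>(4)[rule_format, of a "f (\<theta> (Suc k)) - fs" "\<theta> (Suc k)" "L * d k"] a slope[of k] in_M K(3)
      by simp
  qed (use c(1) L(1) fs_le descent \<Gamma> in \<open>auto simp: d_def\<close>)
  then have "convergent (\<lambda>k. P (\<theta> k))"
    unfolding d_def by (rule convergent_of_summable_dist)
  then obtain \<theta>' where \<theta>': "(\<lambda>k. P (\<theta> k)) \<longlonglongrightarrow> \<theta>'" by (auto simp: convergent_def)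

  have acc_U: "a \<in> U" if "accumulation_point \<theta> a" for a
    using interior_acc[OF that] by (simp add: U_def)
  have acc_P: "P a = \<theta>'" if a: "accumulation_point \<theta> a" for a
  proof -
    obtain r where r: "strict_mono r" "(\<theta> \<circ> r) \<longlonglongrightarrow> a" using a unfolding accumulation_point_def by blast
    have "(\<lambda>k. P ((\<theta> \<circ> r) k)) \<longlonglongrightarrow> P a"
      by (rule continuous_on_tendsto_compose[OF P_cont[of UNIV] r(2)]) auto
    moreover have "(\<lambda>k. P ((\<theta> \<circ> r) k)) \<longlonglongrightarrow> \<theta>'"
      using LIMSEQ_subseq_LIMSEQ[OF \<theta>' r(1)] by (simp add: comp_def)
    ultimately show ?thesis by (rule LIMSEQ_unique)
  qed
  have acc_tilted: "Y.tilted a = Y.tilted b" if "accumulation_point \<theta> a" "accumulation_point \<theta> b" for a b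
    using that by (intro tilted_P acc_U) (simp_all add: acc_P)
  \<comment> \<open>The whole sequence of means converges although the iterates need not: all
    accumulation points define the same tilted measure.\<close>
  have lim_mean: "(\<lambda>k. Y.mean \<phi> (\<theta> k)) \<longlonglongrightarrow> Y.mean \<phi> a" if a: "accumulation_point \<theta> a" and \<phi>: "Y.moderate \<phi>" for \<phi> a
  proof (rule tendsto_of_accumulation_points[OF C0])
    show "continuous_on C0 (Y.mean \<phi>)" using Y.continuous_on_mean[OF \<phi>] C0U by (rule continuous_on_subset)
    fix b assume b: "accumulation_point \<theta> b"
    show "Y.mean \<phi> b = Y.mean \<phi> a"
      using acc_tilted[OF a b] Y.integral_tilted[OF acc_U[OF a], of \<phi>] Y.integral_tilted[OF acc_U[OF b], of \<phi>]
        Y.moderateD[OF \<phi>] by simp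
  qed
  have lim_e: "e \<longlonglongrightarrow> Y.mean_statistic a" if "accumulation_point \<theta> a" for a
    unfolding e_def Y.mean_statistic_def
    by (intro tendsto_intros lim_mean[OF that] Y.moderate_inner)

  have weak: "weakly_converges (\<lambda>k. \<P> (\<theta> k)) (\<P> a)" if a: "accumulation_point \<theta> a" for a
    unfolding weakly_converges_def
  proof (intro allI impI)
    fix g :: "'x \<Rightarrow> real" assume g: "continuous_on UNIV g \<and> bounded (range g)"
    then have "g \<in> borel_measurable borel" by (intro borel_measurable_continuous_onI) simp
    then have gm: "g \<in> borel_measurable m"
      by (simp add: measurable_cong_sets[OF trans[OF sets_m borel] refl])
    obtain B where "\<And>x. \<bar>g x\<bar> \<le> B" using g unfolding bounded_iff by auto
    then have "Y.moderate g" by (rule Y.moderate_bounded[OF gm])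
    from lim_mean[OF a this] show "(\<lambda>k. \<integral>x. g x \<partial>\<P> (\<theta> k)) \<longlonglongrightarrow> (\<integral>x. g x \<partial>\<P> a)"
      by (simp add: \<P>_eq Y.integral_tilted[OF _ gm] \<theta>U acc_U[OF a])
  qed

  have critical: "critical_on M (\<lambda>t. - ln (q t)) a" if a: "accumulation_point \<theta> a" for a
  proof -
    obtain r where r: "strict_mono r" "(\<theta> \<circ> r) \<longlonglongrightarrow> a" using a unfolding accumulation_point_def by blast
    have aU: "a \<in> U" by (rule acc_U[OF a])
    have aM: "a \<in> M" by (rule closed_sequentially[OF M(1) _ r(2)]) (simp add: in_M)
    let ?e = "Y.mean_statistic a"
    \<comment> \<open>This is the gradient at \<open>a\<close> both of \<open>f\<close> and of the
      limiting EM objective \<open>lp t - t \<bullet> ?e\<close>.\<close>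
    let ?g = "X.mean_statistic a - ?e"
    \<comment> \<open>The iterate with index \<open>r (Suc j)\<close> minimizes the objective formed
      at its predecessor. Starting at \<open>Suc j\<close> makes the index positive. The
      predecessors need not approach \<open>a\<close>, but their mean statistics converge because
      the whole sequence \<open>e\<close> does.\<close>
    define r' where "r' j = r (Suc j) - 1" for j
    have r'_Suc: "Suc (r' j) = r (Suc j)" for j
      using strict_mono_imp_increasing[OF r(1), of "Suc j"] by (simp add: r'_def)
    have r'_ge: "j \<le> r' j" for j
      using strict_mono_imp_increasing[OF r(1), of "Suc j"] by (simp add: r'_def)
    have r'_lim: "filterlim r' sequentially sequentially"
      by (rule filterlim_at_top_mono[OF filterlim_ident]) (simp add: r'_ge)
    have lim1: "(\<lambda>j. \<theta> (Suc (r' j))) \<longlonglongrightarrow> a"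
      unfolding r'_Suc using LIMSEQ_Suc[OF r(2)] by simp
    have lim2: "(\<lambda>j. e (r' j)) \<longlonglongrightarrow> ?e"
      by (rule filterlim_compose[OF lim_e[OF a] r'_lim])
    have "isCont lp a" using has_derivative_continuous[OF lp_deriv[OF aU]] .
    then have lim3: "(\<lambda>j. lp (\<theta> (Suc (r' j)))) \<longlonglongrightarrow> lp a" by (rule isCont_tendsto_compose) (rule lim1)
    \<comment> \<open>Passage to the limit in the EM inequality for a fixed competitor
      \<open>t\<close>: the point \<open>a\<close> minimizes the limiting objective globally,
      although it is only critical for \<open>f\<close>.\<close>
    have min: "lp a - a \<bullet> ?e \<le> lp t - t \<bullet> ?e" if "t \<in> M" "t \<in> \<Theta>" for t
    proof (rule LIMSEQ_le)
      show "(\<lambda>j. lp (\<theta> (Suc (r' j))) - \<theta> (Suc (r' j)) \<bullet> e (r' j)) \<longlonglongrightarrow> lp a - a \<bullet> ?e"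
        by (intro tendsto_intros lim1 lim2 lim3)
      show "(\<lambda>j. lp t - t \<bullet> e (r' j)) \<longlonglongrightarrow> lp t - t \<bullet> ?e"
        by (intro tendsto_intros lim2)
    qed (use EM(2)[OF that] in blast)
    have "GDERIV (\<lambda>t. - ln (q t)) a :> ?g"
    proof -
      have "((\<lambda>t. lp t - ln (Y.Z t)) has_derivative (\<lambda>h. h \<bullet> X.mean_statistic a - h \<bullet> ?e)) (at a)"
        by (intro has_derivative_diff lp_deriv Y.ln_Z_has_derivative' aU)
      then have "((\<lambda>t. - ln (q t)) has_derivative (\<lambda>h. h \<bullet> X.mean_statistic a - h \<bullet> ?e)) (at a)"
        by (rule has_derivative_transform_within_open[OF _ U(1) aU]) (use f_eq U\<Theta> in \<open>auto simp: f_def\<close>)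
      then show ?thesis by (simp add: gderiv_def inner_diff_right)
    qed
    moreover have "- ?g \<in> normal_cone M a"
    proof (rule normal_cone_of_local_min)
      show "((\<lambda>t. lp t - t \<bullet> ?e) has_derivative (\<lambda>h. h \<bullet> ?g)) (at a)"
        unfolding inner_diff_right
        by (intro has_derivative_diff lp_deriv aU has_derivative_inner_left has_derivative_ident)
      \<comment> \<open>EM minimizes over \<open>M \<inter> \<Theta>\<close>; near the interior
        point \<open>a\<close> this is all of \<open>M\<close>.\<close>
      have "\<forall>\<^sub>F z in at a within M. z \<in> M" by (auto simp: eventually_at_filter)
      moreover have "\<forall>\<^sub>F z in at a within M. z \<in> U"
        by (rule eventually_at_in_open'[OF U(1) aU, THEN filter_leD[OF at_le[of M UNIV], rotated]]) simp
      ultimately show "\<forall>\<^sub>F z in at a within M. lp a - a \<bullet> ?e \<le> lp z - z \<bullet> ?e"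
        by eventually_elim (use min U\<Theta> in blast)
    qed
    ultimately show ?thesis unfolding critical_on_def using aM by blast
  qed

  have "convergent (\<lambda>k. \<integral>x. P (T x) \<partial>\<P> (\<theta> k))"
  proof -
    \<comment> \<open>An accumulation point is needed to name the limit of the means; boundedness of
      the iterates provides one.\<close>
    obtain a r where "strict_mono r" "(\<theta> \<circ> r) \<longlonglongrightarrow> a"
      using C0 unfolding compact_def by metis
    then have a: "accumulation_point \<theta> a" unfolding accumulation_point_def by blast
    have "(\<integral>x. P (T x) \<partial>\<P> (\<theta> k)) = P (e k)" for k
      unfolding \<P>_eq e_def
      by (intro Y.integral_tilted_linear \<theta>U P_lin) (simp add: P_def orth_proj_self_adjoint[OF sV])
    moreover have "(\<lambda>k. P (e k)) \<longlonglongrightarrow> P (Y.mean_statistic a)"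
      by (rule continuous_on_tendsto_compose[OF P_cont[of UNIV] lim_e[OF a]]) auto
    ultimately show ?thesis unfolding convergent_def by auto
  qed
  moreover have "\<P> a = \<P> b" if "accumulation_point \<theta> a" "accumulation_point \<theta> b" for a b
    unfolding \<P>_eq using that by (rule acc_tilted)
  ultimately show ?thesis
    by (intro conjI exI[of _ \<theta>'] allI impI; (elim conjE)?)
      (rule \<theta>' critical acc_P weak | assumption)+
qed

end
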